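(* Let $n\ge 1$, let $R$ be a commutative $\mathbf{Q}$-algebra, and let $\delta$ be a triangular $R$-derivation of the polynomial ring $R[x_1,\ldots,x_n]$, i.e. an $R$-derivation such that $f_i:=\delta(x_i)\in R[x_1,\ldots,x_{i-1}]$ for each $i=1,\ldots,n$ (in particular $f_1\in R$). Let $h\in R[x_1,\ldots,x_n]$ satisfy $\delta(h)=0$, and let $\phi:=\exp h\delta\in \mathrm{GA}_n(R)$. Let $\mathfrak{p}\in \operatorname{Spec} R$, let $\kappa(\mathfrak{p})$ be the residue field of the localization $R_{\mathfrak{p}}$, and let $\phi_{\mathfrak{p}}\in \mathrm{GA}_n(\kappa(\mathfrak{p}))$ be the automorphism induced by $\phi$. If $f_1\notin \mathfrak{p}$, then $\phi_{\mathfrak{p}}$ is tame.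
   Context: For a commutative ring $A$ and $n\ge 1$, $\mathrm{GA}_n(A)$ denotes the group of $A$-algebra automorphisms of the polynomial ring $A[x_1,\ldots,x_n]$. An element $\phi\in \mathrm{GA}_n(A)$ is called affine if the total degrees of $\phi(x_1),\ldots,\phi(x_n)$ are all equal to one, and triangular if $\phi(x_i)\in A^*x_i+A[x_1,\ldots,x_{i-1}]$ for each $i$. $\mathrm{TA}_n(A)$ denotes the subgroup of $\mathrm{GA}_n(A)$ generated by the affine automorphisms and the triangular automorphisms. An element of $\mathrm{GA}_n(A)$ is called tame if it belongs to $\mathrm{TA}_n(A)$, and wild otherwise. For a triangular $R$-derivation $\delta$ of $R[x_1,\ldots,x_n]$ over a commutative $\mathbf{Q}$-algebra $R$ and $h$ with $\delta(h)=0$, the automorphism $\exp h\delta\in \mathrm{GA}_n(R)$ is defined by $(\exp h\delta)(q)=\sum_{l\ge 0} h^l\delta^l(q)/l!$ for $q\in R[x_1,\ldots,x_n]$ (a finite sum, since $\delta$ is locally nilpotent). For $\phi \in \mathrm{GA}_n(R)$ and $\mathfrak{p}\in\operatorname{Spec}R$, the induced automorphism $\phi_{\mathfrak{p}}$ is the $\kappa(\mathfrak{p})$-algebra automorphism of $\kappa(\mathfrak{p})[x_1,\ldots,x_n]=\kappa(\mathfrak{p})\otimes_R R[x_1,\ldots,x_n]$ obtained from $\phi$ by base change along $R\to\kappa(\mathfrak{p})$, i.e. it sends $x_i$ to the image of $\phi(x_i)$ in $\kappa(\mathfrak{p})[x_1,\ldots,x_n]$. *)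

theory Defs
  imports
    "HOL-Algebra.Ideal"
    "HOL-Algebra.QuotRing"
    "HOL-Algebra.Module"
    "HOL-Algebra.Bij"
    "HOL-Algebra.Generated_Groups"
    "HOL-Algebra.Indexed_Polynomials"
    "HOL-Algebra.Algebraic_Closure_Type"
begin

section \<open>The polynomial algebra \<open>A[x\<^sub>1, \<dots>, x\<^sub>n]\<close>\<close>

text \<open>
  Polynomials are represented as in \<^theory>\<open>HOL-Algebra.Indexed_Polynomials\<close>: a monomial is a
  multiset of variables and a polynomial maps each monomial to its coefficient. Variables are
  numbered \<open>1, \<dots>, n\<close>, so \<open>A[x\<^sub>1, \<dots>, x\<^sub>k]\<close> is a subset of \<open>A[x\<^sub>1, \<dots>, x\<^sub>n]\<close> for \<open>k \<le> n\<close>. The library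
  does not provide the product of two such polynomials; it is the convolution below.
\<close>

definition mpoly_mult ::
  "('a, 'b) ring_scheme \<Rightarrow> (nat multiset \<Rightarrow> 'a) \<Rightarrow> (nat multiset \<Rightarrow> 'a) \<Rightarrow> (nat multiset \<Rightarrow> 'a)"
  where "mpoly_mult A p q = (\<lambda>m. \<Oplus>\<^bsub>A\<^esub>k\<in>{k. k \<subseteq># m}. p k \<otimes>\<^bsub>A\<^esub> q (m - k))"

definition mpoly_ring :: "('a, 'b) ring_scheme \<Rightarrow> nat \<Rightarrow> ('a, nat multiset \<Rightarrow> 'a) module"
  where "mpoly_ring A n =
    \<lparr>carrier = ring.indexed_pset A {1..n} (carrier A),
     monoid.mult = mpoly_mult A,
     one = ring.indexed_const A \<one>\<^bsub>A\<^esub>,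
     zero = ring.indexed_const A \<zero>\<^bsub>A\<^esub>,
     add = ring.indexed_padd A,
     module.smult = (\<lambda>a p m. a \<otimes>\<^bsub>A\<^esub> p m)\<rparr>"

abbreviation mpoly_var :: "('a, 'b) ring_scheme \<Rightarrow> nat \<Rightarrow> (nat multiset \<Rightarrow> 'a)"
  where "mpoly_var A i \<equiv> ring.indexed_var A i"

abbreviation mpoly_const :: "('a, 'b) ring_scheme \<Rightarrow> 'a \<Rightarrow> (nat multiset \<Rightarrow> 'a)"
  where "mpoly_const A a \<equiv> ring.indexed_const A a"

text \<open>The total degree of the zero polynomial is set to 0.\<close>

definition total_degree :: "('a, 'b) ring_scheme \<Rightarrow> (nat multiset \<Rightarrow> 'a) \<Rightarrow> nat"
  where "total_degree A p = Max (insert 0 (size ` {m. p m \<noteq> \<zero>\<^bsub>A\<^esub>}))"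


section \<open>Polynomial automorphisms and tameness\<close>

text \<open>
  As in \<^theory>\<open>HOL-Algebra.Bij\<close>, automorphisms are extensional functions on the carrier, and the
  group operation is composition.
\<close>

definition GA :: "('a, 'b) ring_scheme \<Rightarrow> nat \<Rightarrow> ((nat multiset \<Rightarrow> 'a) \<Rightarrow> (nat multiset \<Rightarrow> 'a)) monoid"
  where "GA A n = (let P = mpoly_ring A n in
    BijGroup (carrier P)
      \<lparr>carrier := {\<phi> \<in> Bij (carrier P). \<phi> \<in> ring_hom P P \<and>
        (\<forall>a\<in>carrier A. \<forall>q\<in>carrier P. \<phi> (a \<odot>\<^bsub>P\<^esub> q) = a \<odot>\<^bsub>P\<^esub> \<phi> q)}\<rparr>)"

definition affine_automorphisms ::
  "('a, 'b) ring_scheme \<Rightarrow> nat \<Rightarrow> ((nat multiset \<Rightarrow> 'a) \<Rightarrow> (nat multiset \<Rightarrow> 'a)) set"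
  where "affine_automorphisms A n =
    {\<phi> \<in> carrier (GA A n). \<forall>i\<in>{1..n}. total_degree A (\<phi> (mpoly_var A i)) = 1}"

definition triangular_automorphisms ::
  "('a, 'b) ring_scheme \<Rightarrow> nat \<Rightarrow> ((nat multiset \<Rightarrow> 'a) \<Rightarrow> (nat multiset \<Rightarrow> 'a)) set"
  where "triangular_automorphisms A n =
    {\<phi> \<in> carrier (GA A n). \<forall>i\<in>{1..n}. \<exists>u\<in>Units A. \<exists>g\<in>carrier (mpoly_ring A (i - 1)).
      \<phi> (mpoly_var A i) = u \<odot>\<^bsub>mpoly_ring A n\<^esub> mpoly_var A i \<oplus>\<^bsub>mpoly_ring A n\<^esub> g}"

definition TA :: "('a, 'b) ring_scheme \<Rightarrow> nat \<Rightarrow> ((nat multiset \<Rightarrow> 'a) \<Rightarrow> (nat multiset \<Rightarrow> 'a)) set"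
  where "TA A n = generate (GA A n) (affine_automorphisms A n \<union> triangular_automorphisms A n)"

definition tame ::
  "('a, 'b) ring_scheme \<Rightarrow> nat \<Rightarrow> ((nat multiset \<Rightarrow> 'a) \<Rightarrow> (nat multiset \<Rightarrow> 'a)) \<Rightarrow> bool"
  where "tame A n \<phi> \<longleftrightarrow> \<phi> \<in> TA A n"


section \<open>Triangular derivations and exponentials\<close>

definition mpoly_derivation ::
  "('a, 'b) ring_scheme \<Rightarrow> nat \<Rightarrow> ((nat multiset \<Rightarrow> 'a) \<Rightarrow> (nat multiset \<Rightarrow> 'a)) \<Rightarrow> bool"
  where "mpoly_derivation A n \<delta> \<longleftrightarrow> (let P = mpoly_ring A n in
    \<delta> \<in> carrier P \<rightarrow> carrier P \<and>
    (\<forall>p\<in>carrier P. \<forall>q\<in>carrier P. \<delta> (p \<oplus>\<^bsub>P\<^esub> q) = \<delta> p \<oplus>\<^bsub>P\<^esub> \<delta> q) \<and>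
    (\<forall>a\<in>carrier A. \<forall>q\<in>carrier P. \<delta> (a \<odot>\<^bsub>P\<^esub> q) = a \<odot>\<^bsub>P\<^esub> \<delta> q) \<and>
    (\<forall>p\<in>carrier P. \<forall>q\<in>carrier P.
      \<delta> (p \<otimes>\<^bsub>P\<^esub> q) = (\<delta> p \<otimes>\<^bsub>P\<^esub> q) \<oplus>\<^bsub>P\<^esub> (p \<otimes>\<^bsub>P\<^esub> \<delta> q)))"

definition triangular_derivation ::
  "('a, 'b) ring_scheme \<Rightarrow> nat \<Rightarrow> ((nat multiset \<Rightarrow> 'a) \<Rightarrow> (nat multiset \<Rightarrow> 'a)) \<Rightarrow> bool"
  where "triangular_derivation A n \<delta> \<longleftrightarrow> mpoly_derivation A n \<delta> \<and>
    (\<forall>i\<in>{1..n}. \<delta> (mpoly_var A i) \<in> carrier (mpoly_ring A (i - 1)))"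

text \<open>
  The field of rational numbers as a ring record. A commutative \<open>\<rat>\<close>-algebra is a record \<open>R\<close> with
  \<^term>\<open>algebra rat_field R\<close>.
\<close>

abbreviation rat_field :: "rat ring"
  where "rat_field \<equiv> ring_of_type_algebra"

text \<open>
  The map \<open>exp h\<delta>\<close> on \<open>R[x\<^sub>1, \<dots>, x\<^sub>n]\<close>, for \<open>\<delta>\<close> locally nilpotent with \<open>\<delta> h = 0\<close>. The sum ranges over
  the finitely many \<open>l\<close> with \<open>\<delta>\<^sup>l q \<noteq> 0\<close>; the factor \<open>1/l!\<close> acts through its image in \<open>R\<close>.
\<close>

definition exp_derivation ::
  "(rat, 'a, 'm) module_scheme \<Rightarrow> nat \<Rightarrow> (nat multiset \<Rightarrow> 'a) \<Rightarrow>
    ((nat multiset \<Rightarrow> 'a) \<Rightarrow> (nat multiset \<Rightarrow> 'a)) \<Rightarrow> (nat multiset \<Rightarrow> 'a) \<Rightarrow> (nat multiset \<Rightarrow> 'a)"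
  where "exp_derivation R n h \<delta> = (let P = mpoly_ring R n in
    (\<lambda>q\<in>carrier P. \<Oplus>\<^bsub>P\<^esub>l\<in>{l. (\<delta> ^^ l) q \<noteq> \<zero>\<^bsub>P\<^esub>}.
      ((1 / fact l) \<odot>\<^bsub>R\<^esub> \<one>\<^bsub>R\<^esub>) \<odot>\<^bsub>P\<^esub> (h [^]\<^bsub>P\<^esub> l \<otimes>\<^bsub>P\<^esub> (\<delta> ^^ l) q)))"


section \<open>The residue field at a prime ideal\<close>

text \<open>Two fractions \<open>a/s\<close> and \<open>b/t\<close> are identified iff \<open>u(at - bs) = 0\<close> for some \<open>u \<notin> \<pp>\<close>.\<close>

definition fraction_rel :: "('a, 'b) ring_scheme \<Rightarrow> 'a set \<Rightarrow> (('a \<times> 'a) \<times> ('a \<times> 'a)) set"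
  where "fraction_rel R \<pp> =
    {((a, s), (b, t)). a \<in> carrier R \<and> b \<in> carrier R \<and> s \<in> carrier R - \<pp> \<and> t \<in> carrier R - \<pp> \<and>
      (\<exists>u\<in>carrier R - \<pp>. u \<otimes>\<^bsub>R\<^esub> (a \<otimes>\<^bsub>R\<^esub> t \<ominus>\<^bsub>R\<^esub> b \<otimes>\<^bsub>R\<^esub> s) = \<zero>\<^bsub>R\<^esub>)}"

definition fraction :: "('a, 'b) ring_scheme \<Rightarrow> 'a set \<Rightarrow> 'a \<Rightarrow> 'a \<Rightarrow> ('a \<times> 'a) set"
  where "fraction R \<pp> a s = fraction_rel R \<pp> `` {(a, s)}"

text \<open>
  The localization \<open>R\<^sub>\<pp>\<close>. The operations are \<open>(a/s)(b/t) = ab/st\<close> and \<open>a/s + b/t = (at + bs)/st\<close>;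
  the unions over representatives are unions of copies of a single class.
\<close>

definition localization :: "('a, 'b) ring_scheme \<Rightarrow> 'a set \<Rightarrow> ('a \<times> 'a) set ring"
  where "localization R \<pp> =
    \<lparr>carrier = (carrier R \<times> (carrier R - \<pp>)) // fraction_rel R \<pp>,
     monoid.mult = (\<lambda>U V. \<Union>(a, s)\<in>U. \<Union>(b, t)\<in>V. fraction R \<pp> (a \<otimes>\<^bsub>R\<^esub> b) (s \<otimes>\<^bsub>R\<^esub> t)),
     one = fraction R \<pp> \<one>\<^bsub>R\<^esub> \<one>\<^bsub>R\<^esub>,
     zero = fraction R \<pp> \<zero>\<^bsub>R\<^esub> \<one>\<^bsub>R\<^esub>,
     add = (\<lambda>U V. \<Union>(a, s)\<in>U. \<Union>(b, t)\<in>V.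
       fraction R \<pp> (a \<otimes>\<^bsub>R\<^esub> t \<oplus>\<^bsub>R\<^esub> b \<otimes>\<^bsub>R\<^esub> s) (s \<otimes>\<^bsub>R\<^esub> t))\<rparr>"

text \<open>The maximal ideal \<open>\<pp>R\<^sub>\<pp>\<close> of the local ring \<open>R\<^sub>\<pp>\<close>, and \<open>\<kappa>(\<pp>) = R\<^sub>\<pp> / \<pp>R\<^sub>\<pp>\<close>.\<close>

definition localization_max_ideal :: "('a, 'b) ring_scheme \<Rightarrow> 'a set \<Rightarrow> ('a \<times> 'a) set set"
  where "localization_max_ideal R \<pp> = {fraction R \<pp> a s | a s. a \<in> \<pp> \<and> s \<in> carrier R - \<pp>}"

definition residue_field :: "('a, 'b) ring_scheme \<Rightarrow> 'a set \<Rightarrow> ('a \<times> 'a) set set ring"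
  where "residue_field R \<pp> = localization R \<pp> Quot localization_max_ideal R \<pp>"

definition residue_map :: "('a, 'b) ring_scheme \<Rightarrow> 'a set \<Rightarrow> 'a \<Rightarrow> ('a \<times> 'a) set set"
  where "residue_map R \<pp> a =
    localization_max_ideal R \<pp> +>\<^bsub>localization R \<pp>\<^esub> fraction R \<pp> a \<one>\<^bsub>R\<^esub>"


section \<open>Base change\<close>

text \<open>The \<open>B\<close>-algebra endomorphism of \<open>B[x\<^sub>1, \<dots>, x\<^sub>n]\<close> sending \<open>x\<^sub>i\<close> to \<open>g i\<close>.\<close>

definition mpoly_subst ::
  "('a, 'b) ring_scheme \<Rightarrow> nat \<Rightarrow> (nat \<Rightarrow> nat multiset \<Rightarrow> 'a) \<Rightarrow>
    (nat multiset \<Rightarrow> 'a) \<Rightarrow> (nat multiset \<Rightarrow> 'a)"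
  where "mpoly_subst B n g = (let P = mpoly_ring B n in
    (\<lambda>q\<in>carrier P. \<Oplus>\<^bsub>P\<^esub>m\<in>{m. q m \<noteq> \<zero>\<^bsub>B\<^esub>}. q m \<odot>\<^bsub>P\<^esub> (\<Otimes>\<^bsub>P\<^esub>i\<in>{1..n}. g i [^]\<^bsub>P\<^esub> count m i)))"

text \<open>
  The endomorphism of \<open>B[x\<^sub>1, \<dots>, x\<^sub>n]\<close> obtained from an \<open>A\<close>-algebra endomorphism \<open>\<phi>\<close> of
  \<open>A[x\<^sub>1, \<dots>, x\<^sub>n]\<close> by base change along \<open>\<iota> : A \<rightarrow> B\<close>.
\<close>

definition base_change ::
  "('a, 'b) ring_scheme \<Rightarrow> ('c, 'd) ring_scheme \<Rightarrow> ('a \<Rightarrow> 'c) \<Rightarrow> nat \<Rightarrow>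
    ((nat multiset \<Rightarrow> 'a) \<Rightarrow> (nat multiset \<Rightarrow> 'a)) \<Rightarrow> (nat multiset \<Rightarrow> 'c) \<Rightarrow> (nat multiset \<Rightarrow> 'c)"
  where "base_change A B \<iota> n \<phi> = mpoly_subst B n (\<lambda>i. \<iota> \<circ> \<phi> (mpoly_var A i))"

definition induced_automorphism ::
  "('a, 'b) ring_scheme \<Rightarrow> 'a set \<Rightarrow> nat \<Rightarrow>
    ((nat multiset \<Rightarrow> 'a) \<Rightarrow> (nat multiset \<Rightarrow> 'a)) \<Rightarrow>
    (nat multiset \<Rightarrow> ('a \<times> 'a) set set) \<Rightarrow> (nat multiset \<Rightarrow> ('a \<times> 'a) set set)"
  where "induced_automorphism R \<pp> n \<phi> =
    base_change R (residue_field R \<pp>) (residue_map R \<pp>) n \<phi>"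

end

theory Submission
  imports Defs
begin

text \<open>
  Write \<open>K = \<kappa>(\<pp>)\<close> and let \<open>c \<in> K\<close> be the image of \<open>f\<^sub>1\<close>, a unit, so that \<open>s = x\<^sub>1/c\<close> is a slice of \<open>\<delta>\<close>
  after base change. For a ring homomorphism \<open>j : R[x] \<rightarrow> K[x]\<close> and any \<open>t \<in> K[x]\<close>, not
  necessarily a constant of \<open>\<delta>\<close>, the series \<open>E\<^sub>t(q) = \<Sum>\<^sub>l t\<^sup>l j(\<delta>\<^sup>l q)/l!\<close> is a ring homomorphism by the
  Leibniz rule, it commutes with homomorphisms of the target, and replacing \<open>j\<close> by \<open>E\<^sub>t\<close> turns \<open>E\<^sub>u\<close> into \<open>E\<close>
  at \<open>u + t\<close>. Comparing values on the variables then gives every identity needed, without ever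
  constructing a derivation of \<open>K[x]\<close>.

  Take \<open>j\<close> to be the coefficient map. The substitution \<open>\<tau>\<close> fixing \<open>x\<^sub>1\<close> and sending \<open>x\<^sub>i\<close> to \<open>E\<close> at \<open>-s\<close> of \<open>x\<^sub>i\<close>
  for \<open>i \<ge> 2\<close> is triangular; its inverse \<open>\<tau>'\<close> is given by the same series at \<open>s\<close>, with \<open>j\<close> followed
  by the projection \<open>\<rho>\<close> that sets \<open>x\<^sub>1 = 0\<close>. Since \<open>\<phi>\<^sub>\<pp>\<close> sends \<open>s\<close> to \<open>s + h\<close>, it fixes every \<open>\<tau>(x\<^sub>i)\<close> with \<open>i \<ge> 2\<close>,
  and \<open>\<delta>(h) = 0\<close> yields \<open>h = \<tau>(\<rho>(h))\<close>. Hence \<open>\<tau>'\<phi>\<^sub>\<pp>\<tau>\<close> is the elementary automorphism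
  \<open>x\<^sub>1 \<mapsto> x\<^sub>1 + c \<rho>(h)\<close>, where \<open>\<rho>(h)\<close> does not involve \<open>x\<^sub>1\<close>.
\<close>

section \<open>The polynomial ring\<close>

text \<open>Each submultiset is the multiset of a word over the support of \<open>m\<close> of
  length at most \<open>size m\<close>, and such words are finite in number. Finiteness matters
  because \<open>finsum\<close> over an infinite index set falls back to a default value.\<close>

lemma finite_submultisets: "finite {k. k \<subseteq># (m :: 'b multiset)}"
proof -
  have "{k. k \<subseteq># m} \<subseteq> mset ` {xs. set xs \<subseteq> set_mset m \<and> length xs \<le> size m}"
  proof
    fix k assume "k \<in> {k. k \<subseteq># m}"
    then have k: "k \<subseteq># m" by simp
    obtain xs where xs: "k = mset xs" by (metis ex_mset)
    have "set xs \<subseteq> set_mset m" "length xs \<le> size m"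
      using set_mset_mono[OF k] size_mset_mono[OF k] unfolding xs by auto
    then show "k \<in> mset ` {xs. set xs \<subseteq> set_mset m \<and> length xs \<le> size m}"
      unfolding xs by blast
  qed
  then show ?thesis
    by (rule finite_subset) (intro finite_imageI finite_lists_length_le finite_set_mset)
qed

lemma submset_diff_diff: "k \<subseteq># m \<Longrightarrow> m - (m - k) = (k :: 'b multiset)"
  by (auto simp: mset_subset_eq_exists_conv)

text \<open>The index shift behind multiplication by a variable: removing one \<open>i\<close> is
  inverse to \<open>add_mset i\<close>. It reindexes the convolution sum in
  \<open>mpoly_mult_pmult\<close>.\<close>

lemma submultisets_add_mset:
  "i \<in># m \<Longrightarrow> {k. k \<subseteq># m \<and> i \<in># k} = add_mset i ` {k. k \<subseteq># m - {#i#}}"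
proof -
  assume i: "i \<in># m"
  have "k \<in> add_mset i ` {k. k \<subseteq># m - {#i#}}" if "k \<subseteq># m" "i \<in># k" for k
    by (rule image_eqI[of _ _ "k - {#i#}"]) (use that i in \<open>auto simp: subset_eq_diff_conv\<close>)
  moreover have "add_mset i k \<subseteq># m" if "k \<subseteq># m - {#i#}" for k
    using that i by (metis insert_DiffM mset_subset_eq_add_mset_cancel)
  ultimately show ?thesis by auto
qed

context cring
begin

abbreviation mpolys :: "nat \<Rightarrow> (nat multiset \<Rightarrow> 'a) set"
  where "mpolys n \<equiv> carrier (mpoly_ring R n)"

lemma mpoly_ring_simps [simp]:
  "monoid.mult (mpoly_ring R n) = mpoly_mult R"
  "one (mpoly_ring R n) = indexed_const \<one>"
  "zero (mpoly_ring R n) = indexed_const \<zero>"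
  "add (mpoly_ring R n) = indexed_padd"
  "module.smult (mpoly_ring R n) = (\<lambda>a p m. a \<otimes> p m)"
  by (auto simp: mpoly_ring_def)

lemma mpolys_def: "mpolys n = indexed_pset {1..n} (carrier R)"
  by (simp add: mpoly_ring_def)

lemma mpolys_coeff [simp, intro]: "p \<in> mpolys n \<Longrightarrow> p m \<in> carrier R"
  unfolding mpolys_def
  by (rule carrier_coeffE[OF indexed_pset_in_carrier[OF subset_refl]])

lemma mpolys_finite_support: "p \<in> mpolys n \<Longrightarrow> finite {m. p m \<noteq> \<zero>}"
  unfolding mpolys_def
proof (induction rule: indexed_pset.induct)
  case (indexed_const k)
  have "{m. indexed_const k m \<noteq> \<zero>} \<subseteq> {{#}}" by (auto simp: indexed_const_def)
  then show ?case by (rule finite_subset) simp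
next
  case (indexed_padd p q)
  have "{m. (p \<Oplus> q) m \<noteq> \<zero>} \<subseteq> {m. p m \<noteq> \<zero>} \<union> {m. q m \<noteq> \<zero>}" by (auto simp: indexed_padd_def)
  then show ?case by (rule finite_subset) (use indexed_padd in simp)
next
  case (indexed_pmult p i)
  have "{m. (p \<Otimes> i) m \<noteq> \<zero>} \<subseteq> add_mset i ` {m. p m \<noteq> \<zero>}"
  proof
    fix m assume "m \<in> {m. (p \<Otimes> i) m \<noteq> \<zero>}"
    then have "i \<in># m" "p (m - {#i#}) \<noteq> \<zero>"
      by (auto simp: indexed_pmult_def split: if_splits)
    then show "m \<in> add_mset i ` {m. p m \<noteq> \<zero>}"
      by (intro image_eqI[of _ _ "m - {#i#}"]) auto
  qed
  then show ?case by (rule finite_surj[OF indexed_pmult.IH])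
qed

lemma mpolys_const [simp, intro]: "a \<in> carrier R \<Longrightarrow> indexed_const a \<in> mpolys n"
  unfolding mpolys_def by (rule indexed_pset.indexed_const)

lemma mpolys_padd [simp, intro]: "p \<in> mpolys n \<Longrightarrow> q \<in> mpolys n \<Longrightarrow> p \<Oplus> q \<in> mpolys n"
  unfolding mpolys_def by (rule indexed_pset.indexed_padd)

lemma mpolys_pmult: "p \<in> mpolys n \<Longrightarrow> i \<in> {1..n} \<Longrightarrow> p \<Otimes> i \<in> mpolys n"
  unfolding mpolys_def by (rule indexed_pset.indexed_pmult)

lemma mpolys_var: "i \<in> {1..n} \<Longrightarrow> mpoly_var R i \<in> mpolys n"
  unfolding indexed_var_def by (simp add: mpolys_pmult)

lemma mpolys_mono: "k \<le> n \<Longrightarrow> mpolys k \<subseteq> mpolys n"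
proof
  fix p assume "p \<in> mpolys k" "k \<le> n"
  then show "p \<in> mpolys n"
    unfolding mpolys_def
    by (induction rule: indexed_pset.induct)
       (auto intro: indexed_pset.intros)
qed

text \<open>With \<open>mpoly_mult_padd\<close> and \<open>mpoly_mult_pmult\<close> this computes
  the convolution recursively in its left factor, along the constructors of
  \<open>indexed_pset\<close>. Closure and associativity then follow by induction, without
  rearranging double sums.\<close>

lemma mpoly_mult_const:
  assumes "a \<in> carrier R" "\<And>m. q m \<in> carrier R"
  shows "mpoly_mult R (indexed_const a) q = (\<lambda>m. a \<otimes> q m)"
proof
  fix m
  have "mpoly_mult R (indexed_const a) q m =
     (\<Oplus>k\<in>{k. k \<subseteq># m}. if {#} = k then a \<otimes> q (m - k) else \<zero>)"
    unfolding mpoly_mult_def using assms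
    by (intro finsum_cong') (auto simp: indexed_const_def)
  also have "\<dots> = a \<otimes> q (m - {#})"
    using assms by (subst add.finprod_singleton) (auto simp: finite_submultisets)
  finally show "mpoly_mult R (indexed_const a) q m = a \<otimes> q m" by simp
qed

text \<open>The involution \<open>k \<mapsto> m - k\<close> of the submultisets of \<open>m\<close>
  exchanges the roles of the two factors.\<close>

lemma mpoly_mult_comm:
  assumes "\<And>m. p m \<in> carrier R" "\<And>m. q m \<in> carrier R"
  shows "mpoly_mult R p q = mpoly_mult R q p"
proof
  fix m :: "nat multiset"
  have im: "(\<lambda>k. m - k) ` {k. k \<subseteq># m} = {k. k \<subseteq># m}"
  proof -
    have "k \<in> (\<lambda>k. m - k) ` {k. k \<subseteq># m}" if "k \<subseteq># m" for k
      using that by (intro image_eqI[of _ _ "m - k"]) (auto simp: submset_diff_diff)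
    then show ?thesis by auto
  qed
  have inj: "inj_on (\<lambda>k. m - k) {k. k \<subseteq># m}"
    by (intro inj_onI) (metis mem_Collect_eq subset_mset.diff_add subset_mset.add_diff_inverse add_right_cancel)
  have "mpoly_mult R p q m = (\<Oplus>k\<in>(\<lambda>k. m - k) ` {k. k \<subseteq># m}. p k \<otimes> q (m - k))"
    unfolding im mpoly_mult_def ..
  also have "\<dots> = (\<Oplus>k\<in>{k. k \<subseteq># m}. p (m - k) \<otimes> q (m - (m - k)))"
    using assms by (intro finsum_reindex inj) auto
  also have "\<dots> = (\<Oplus>k\<in>{k. k \<subseteq># m}. q k \<otimes> p (m - k))"
    using assms by (intro finsum_cong') (auto simp: submset_diff_diff m_comm)
  finally show "mpoly_mult R p q m = mpoly_mult R q p m"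
    unfolding mpoly_mult_def .
qed

text \<open>Terms whose \<open>k\<close> does not contain \<open>i\<close> vanish. If
  \<open>i\<close> occurs in \<open>m\<close>, the remaining ones are indexed by the submultisets of
  \<open>m - {#i#}\<close>; otherwise none remain.\<close>

lemma mpoly_mult_pmult:
  assumes "\<And>m. p m \<in> carrier R" "\<And>m. q m \<in> carrier R"
  shows "mpoly_mult R (p \<Otimes> i) q = mpoly_mult R p q \<Otimes> i"
proof
  fix m
  show "mpoly_mult R (p \<Otimes> i) q m = (mpoly_mult R p q \<Otimes> i) m"
  proof (cases "i \<in># m")
    case True
    have "mpoly_mult R (p \<Otimes> i) q m
        = (\<Oplus>k\<in>add_mset i ` {k. k \<subseteq># m - {#i#}}. (p \<Otimes> i) k \<otimes> q (m - k))"
      unfolding mpoly_mult_def submultisets_add_mset[OF True, symmetric]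
      using assms
      by (intro add.finprod_mono_neutral_cong_right)
         (auto simp: finite_submultisets indexed_pmult_def)
    also have "\<dots> = (\<Oplus>k\<in>{k. k \<subseteq># m - {#i#}}. (p \<Otimes> i) (add_mset i k) \<otimes> q (m - add_mset i k))"
      using assms by (intro finsum_reindex) (auto simp: indexed_pmult_def inj_on_def)
    also have "\<dots> = (\<Oplus>k\<in>{k. k \<subseteq># m - {#i#}}. p k \<otimes> q (m - {#i#} - k))"
      using assms by (intro finsum_cong') (auto simp: indexed_pmult_def diff_diff_add_mset)
    finally show ?thesis
      using True by (simp add: indexed_pmult_def mpoly_mult_def)
  next
    case False
    have "mpoly_mult R (p \<Otimes> i) q m = (\<Oplus>k\<in>{k. k \<subseteq># m}. \<zero>)"
      unfolding mpoly_mult_def using assms False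
      by (intro finsum_cong') (auto simp: indexed_pmult_def dest: mset_subset_eqD)
    then show ?thesis using False by (simp add: indexed_pmult_def)
  qed
qed

lemma mpoly_mult_padd:
  assumes "\<And>m. p m \<in> carrier R" "\<And>m. q m \<in> carrier R" "\<And>m. r m \<in> carrier R"
  shows "mpoly_mult R (p \<Oplus> q) r = mpoly_mult R p r \<Oplus> mpoly_mult R q r"
proof
  fix m
  have "mpoly_mult R (p \<Oplus> q) r m
      = (\<Oplus>k\<in>{k. k \<subseteq># m}. p k \<otimes> r (m - k) \<oplus> q k \<otimes> r (m - k))"
    unfolding mpoly_mult_def using assms
    by (intro finsum_cong') (auto simp: indexed_padd_def l_distr)
  also have "\<dots> = (mpoly_mult R p r \<Oplus> mpoly_mult R q r) m"
    unfolding mpoly_mult_def indexed_padd_def using assms by (intro finsum_addf) auto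
  finally show "mpoly_mult R (p \<Oplus> q) r m = (mpoly_mult R p r \<Oplus> mpoly_mult R q r) m" .
qed

lemma smult_pmult: "a \<in> carrier R \<Longrightarrow> (\<lambda>m. a \<otimes> (p \<Otimes> i) m) = (\<lambda>m. a \<otimes> p m) \<Otimes> i"
  by (auto simp: indexed_pmult_def)

lemma smult_padd:
  "a \<in> carrier R \<Longrightarrow> (\<And>m. p m \<in> carrier R) \<Longrightarrow> (\<And>m. q m \<in> carrier R) \<Longrightarrow>
    (\<lambda>m. a \<otimes> (p \<Oplus> q) m) = (\<lambda>m. a \<otimes> p m) \<Oplus> (\<lambda>m. a \<otimes> q m)"
  by (auto simp: indexed_padd_def r_distr)

lemma smult_const: "a \<in> carrier R \<Longrightarrow> (\<lambda>m. a \<otimes> indexed_const b m) = indexed_const (a \<otimes> b)"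
  by (auto simp: indexed_const_def)

lemma mpolys_smult:
  assumes "p \<in> mpolys n" "a \<in> carrier R"
  shows "(\<lambda>m. a \<otimes> p m) \<in> mpolys n"
  using assms(1) unfolding mpolys_def
proof (induction rule: indexed_pset.induct)
  case (indexed_const k) then show ?case
    using assms(2) by (simp add: smult_const indexed_pset.indexed_const)
next
  case (indexed_padd p q)
  then have "carrier_coeff p" "carrier_coeff q" using indexed_pset_in_carrier by blast+
  with indexed_padd show ?case
    using assms(2) by (simp add: smult_padd carrier_coeffE indexed_pset.indexed_padd)
next
  case (indexed_pmult p i) then show ?case
    using assms(2) by (simp add: smult_pmult indexed_pset.indexed_pmult)
qed

lemma mpolys_induct [consumes 1, case_names const padd pmult]:
  assumes "p \<in> mpolys n"
    and "\<And>a. a \<in> carrier R \<Longrightarrow> Q (indexed_const a)"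
    and "\<And>p q. p \<in> mpolys n \<Longrightarrow> q \<in> mpolys n \<Longrightarrow> Q p \<Longrightarrow> Q q \<Longrightarrow> Q (p \<Oplus> q)"
    and "\<And>p i. p \<in> mpolys n \<Longrightarrow> i \<in> {1..n} \<Longrightarrow> Q p \<Longrightarrow> Q (p \<Otimes> i)"
  shows "Q p"
proof -
  have "p \<in> mpolys n \<and> Q p"
    using assms(1) unfolding mpolys_def
    by (induction rule: indexed_pset.induct, fold mpolys_def)
       (auto intro: assms(2-) mpolys_pmult)
  then show ?thesis ..
qed

lemma mpolys_mult [simp, intro]:
  assumes "p \<in> mpolys n" "q \<in> mpolys n"
  shows "mpoly_mult R p q \<in> mpolys n"
  using assms(1)
proof (induction rule: mpolys_induct)
  case (const a) then show ?case
    using assms(2) by (simp add: mpoly_mult_const mpolys_smult)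
next
  case (padd p p')
  note [simp] = mpolys_coeff[of _ n]
  from padd assms show ?case by (simp add: mpoly_mult_padd)
next
  case (pmult p i)
  note [simp] = mpolys_coeff[of _ n]
  from pmult assms show ?case by (simp add: mpoly_mult_pmult mpolys_pmult)
qed

lemma mpoly_mult_assoc:
  assumes "p \<in> mpolys n" "q \<in> mpolys n" "r \<in> mpolys n"
  shows "mpoly_mult R (mpoly_mult R p q) r = mpoly_mult R p (mpoly_mult R q r)"
proof -
  note [simp] = mpolys_coeff[of _ n]
  from assms(1) show ?thesis
  proof (induction rule: mpolys_induct)
    case (const a)
    have "mpoly_mult R (\<lambda>m. a \<otimes> q m) r = (\<lambda>m. a \<otimes> mpoly_mult R q r m)"
      unfolding mpoly_mult_def using assms const
      by (subst finsum_rdistr) (auto intro!: ext finsum_cong' simp: finite_submultisets m_assoc)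
    with const assms show ?case by (simp add: mpoly_mult_const)
  next
    case (padd p p')
    with assms(2,3) show ?case by (simp add: mpoly_mult_padd)
  next
    case (pmult p i)
    with assms(2,3) show ?case by (simp add: mpoly_mult_pmult)
  qed
qed

lemma pmult_eq_mult:
  assumes "\<And>m. p m \<in> carrier R"
  shows "p \<Otimes> i = mpoly_mult R (mpoly_var R i) p"
  unfolding indexed_var_def using assms indexed_const_in_carrier[of "carrier R" \<one>]
  by (simp add: mpoly_mult_pmult mpoly_mult_const)

lemma mpoly_cring: "cring (mpoly_ring R n)"
proof (rule cringI)
  show "abelian_group (mpoly_ring R n)"
  proof (rule abelian_groupI)
    fix p assume p: "p \<in> mpolys n"
    \<comment> \<open>\<open>indexed_pset\<close> has no constructor for negation, so the additive
      inverse is taken as the scalar multiple by -1, which \<open>mpolys_smult\<close> keeps inside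
      the carrier.\<close>
    have "(\<lambda>m. (\<ominus> \<one>) \<otimes> p m) \<oplus>\<^bsub>mpoly_ring R n\<^esub> p = \<zero>\<^bsub>mpoly_ring R n\<^esub>"
      using p by (auto simp: indexed_padd_def indexed_const_def l_minus l_neg intro!: ext)
    then show "\<exists>q\<in>mpolys n. q \<oplus>\<^bsub>mpoly_ring R n\<^esub> p = \<zero>\<^bsub>mpoly_ring R n\<^esub>"
      using mpolys_smult[OF p, of "\<ominus> \<one>"] by blast
  next
    show "\<And>p q r. p \<in> mpolys n \<Longrightarrow> q \<in> mpolys n \<Longrightarrow> r \<in> mpolys n \<Longrightarrow>
        (p \<oplus>\<^bsub>mpoly_ring R n\<^esub> q) \<oplus>\<^bsub>mpoly_ring R n\<^esub> r = p \<oplus>\<^bsub>mpoly_ring R n\<^esub> (q \<oplus>\<^bsub>mpoly_ring R n\<^esub> r)"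
      by (auto simp: indexed_padd_def a_assoc intro!: ext)
    show "\<And>p q. p \<in> mpolys n \<Longrightarrow> q \<in> mpolys n \<Longrightarrow>
        p \<oplus>\<^bsub>mpoly_ring R n\<^esub> q = q \<oplus>\<^bsub>mpoly_ring R n\<^esub> p"
      by (auto simp: indexed_padd_def a_comm intro!: ext)
    show "\<And>p. p \<in> mpolys n \<Longrightarrow> \<zero>\<^bsub>mpoly_ring R n\<^esub> \<oplus>\<^bsub>mpoly_ring R n\<^esub> p = p"
      by (auto simp: indexed_padd_def indexed_const_def intro!: ext)
  qed auto
  show "comm_monoid (mpoly_ring R n)"
  proof (rule comm_monoidI)
    show "\<And>p. p \<in> mpolys n \<Longrightarrow> \<one>\<^bsub>mpoly_ring R n\<^esub> \<otimes>\<^bsub>mpoly_ring R n\<^esub> p = p"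
      using mpolys_coeff[of _ n] by (simp add: mpoly_mult_const)
    show "\<And>p q. p \<in> mpolys n \<Longrightarrow> q \<in> mpolys n \<Longrightarrow>
        p \<otimes>\<^bsub>mpoly_ring R n\<^esub> q = q \<otimes>\<^bsub>mpoly_ring R n\<^esub> p"
      using mpolys_coeff[of _ n] by (simp add: mpoly_mult_comm)
  qed (simp_all add: mpoly_mult_assoc)
  show "\<And>p q r. p \<in> mpolys n \<Longrightarrow> q \<in> mpolys n \<Longrightarrow> r \<in> mpolys n \<Longrightarrow>
      (p \<oplus>\<^bsub>mpoly_ring R n\<^esub> q) \<otimes>\<^bsub>mpoly_ring R n\<^esub> r
      = p \<otimes>\<^bsub>mpoly_ring R n\<^esub> r \<oplus>\<^bsub>mpoly_ring R n\<^esub> q \<otimes>\<^bsub>mpoly_ring R n\<^esub> r"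
    using mpolys_coeff[of _ n] by (simp add: mpoly_mult_padd)
qed


text \<open>From here on the polynomial ring is handled through its \<open>cring\<close> laws;
  unfolding its operations would keep those laws from matching.\<close>

declare mpoly_ring_simps [simp del]

end

section \<open>Substitution homomorphisms\<close>

context cring
begin

lemma smult_mpoly_eq:
  assumes "a \<in> carrier R" "p \<in> mpolys n"
  shows "a \<odot>\<^bsub>mpoly_ring R n\<^esub> p = indexed_const a \<otimes>\<^bsub>mpoly_ring R n\<^esub> p"
  using assms mpolys_coeff[of p n] by (simp add: mpoly_ring_simps mpoly_mult_const)

text \<open>Multiplication by a variable replaces the constructor \<open>indexed_pmult\<close>, so
  that ring homomorphisms can be pushed through each case.\<close>

lemma mpoly_ring_induct [consumes 1, case_names const add mult]:
  assumes "p \<in> mpolys n"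
    and "\<And>a. a \<in> carrier R \<Longrightarrow> Q (indexed_const a)"
    and "\<And>p q. p \<in> mpolys n \<Longrightarrow> q \<in> mpolys n \<Longrightarrow> Q p \<Longrightarrow> Q q \<Longrightarrow> Q (p \<oplus>\<^bsub>mpoly_ring R n\<^esub> q)"
    and "\<And>p i. p \<in> mpolys n \<Longrightarrow> i \<in> {1..n} \<Longrightarrow> Q p \<Longrightarrow> Q (mpoly_var R i \<otimes>\<^bsub>mpoly_ring R n\<^esub> p)"
  shows "Q p"
  using assms(1)
proof (induction rule: mpolys_induct)
  case (pmult p i)
  then show ?case
    using assms(4)[of p i] mpolys_coeff[of p n]
    by (simp add: pmult_eq_mult mpoly_ring_simps)
qed (use assms(2,3) in \<open>simp_all add: mpoly_ring_simps\<close>)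

lemma const_ring_hom: "indexed_const \<in> ring_hom R (mpoly_ring R n)"
proof (rule ring_hom_memI)
  fix a b assume ab: "a \<in> carrier R" "b \<in> carrier R"
  then have "mpoly_mult R (indexed_const a) (indexed_const b) = indexed_const (a \<otimes> b)"
    using mpolys_coeff[OF mpolys_const[of b n]] by (simp add: mpoly_mult_const smult_const)
  then show "indexed_const (a \<otimes> b) = indexed_const a \<otimes>\<^bsub>mpoly_ring R n\<^esub> indexed_const b"
    by (simp add: mpoly_ring_simps)
qed (auto simp: mpoly_ring_simps indexed_padd_const)

text \<open>With \<open>F\<close> the identity this is an induction over the generators of the
  subring in the first \<open>k\<close> variables. Invariance and nilpotency of triangular
  derivations are obtained in that way.\<close>

lemma mpoly_hom_closed:
  assumes "F \<in> ring_hom (mpoly_ring R n) S" "k \<le> n" "p \<in> mpolys k"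
    and "\<And>a. a \<in> carrier R \<Longrightarrow> F (indexed_const a) \<in> H"
    and "\<And>i. i \<in> {1..k} \<Longrightarrow> F (mpoly_var R i) \<in> H"
    and "\<And>x y. x \<in> H \<Longrightarrow> y \<in> H \<Longrightarrow> x \<oplus>\<^bsub>S\<^esub> y \<in> H"
    and "\<And>x y. x \<in> H \<Longrightarrow> y \<in> H \<Longrightarrow> x \<otimes>\<^bsub>S\<^esub> y \<in> H"
  shows "F p \<in> H"
  using assms(3)
proof (induction rule: mpoly_ring_induct)
  case (add p q)
  then have "F (p \<oplus>\<^bsub>mpoly_ring R n\<^esub> q) = F p \<oplus>\<^bsub>S\<^esub> F q"
    using mpolys_mono[OF assms(2)] by (intro ring_hom_add[OF assms(1)]) auto
  with add assms(6) show ?case by (simp add: mpoly_ring_simps)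
next
  case (mult p i)
  then have "F (mpoly_var R i \<otimes>\<^bsub>mpoly_ring R n\<^esub> p) = F (mpoly_var R i) \<otimes>\<^bsub>S\<^esub> F p"
    using mpolys_mono[OF assms(2)] assms(2)
    by (intro ring_hom_mult[OF assms(1)]) (auto intro!: mpolys_var)
  with mult assms(5,7) show ?case by (simp add: mpoly_ring_simps)
qed (rule assms)

text \<open>The comparison principle for all later identities. The bound \<open>k\<close> covers
  homomorphisms that agree only on the first variables, such as an elementary automorphism moving
  \<open>x\<^sub>n\<close> and the identity.\<close>

lemma mpoly_hom_eqI:
  assumes "F \<in> ring_hom (mpoly_ring R n) S" "G \<in> ring_hom (mpoly_ring R n) S"
    and "k \<le> n" "p \<in> mpolys k"
    and "\<And>a. a \<in> carrier R \<Longrightarrow> F (indexed_const a) = G (indexed_const a)"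
    and "\<And>i. i \<in> {1..k} \<Longrightarrow> F (mpoly_var R i) = G (mpoly_var R i)"
  shows "F p = G p"
  using assms(4)
proof (induction rule: mpoly_ring_induct)
  case (add p q)
  then have "F (p \<oplus>\<^bsub>mpoly_ring R n\<^esub> q) = G (p \<oplus>\<^bsub>mpoly_ring R n\<^esub> q)"
    using mpolys_mono[OF assms(3)]
    by (subst ring_hom_add[OF assms(1)], blast, blast, subst ring_hom_add[OF assms(2)]) auto
  then show ?case by (simp add: mpoly_ring_simps)
next
  case (mult p i)
  then have "F (mpoly_var R i \<otimes>\<^bsub>mpoly_ring R n\<^esub> p) = G (mpoly_var R i \<otimes>\<^bsub>mpoly_ring R n\<^esub> p)"
    using mpolys_mono[OF assms(3)] mpolys_var[of i n] assms(3) assms(6)[of i]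
    by (subst ring_hom_mult[OF assms(1)], force, blast, subst ring_hom_mult[OF assms(2)]) auto
  then show ?case by (simp add: mpoly_ring_simps)
qed (rule assms)

section \<open>Evaluation of polynomials at a tuple of polynomials\<close>

context
  fixes n :: nat and g :: "nat \<Rightarrow> nat multiset \<Rightarrow> 'a"
  assumes g_Pi: "g \<in> {1..n} \<rightarrow> mpolys n"
begin

private lemma g: "i \<in> {1..n} \<Longrightarrow> g i \<in> mpolys n"
  using g_Pi by blast

interpretation P: cring "mpoly_ring R n" by (rule mpoly_cring)

private definition mon :: "nat multiset \<Rightarrow> nat multiset \<Rightarrow> 'a"
  where "mon m = (\<Otimes>\<^bsub>mpoly_ring R n\<^esub>i\<in>{1..n}. g i [^]\<^bsub>mpoly_ring R n\<^esub> count m i)"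

private lemma mon_closed: "mon m \<in> mpolys n"
  unfolding mon_def using g by (intro P.finprod_closed) auto

private lemma mon_add_mset:
  assumes "i \<in> {1..n}"
  shows "mon (add_mset i m) = g i \<otimes>\<^bsub>mpoly_ring R n\<^esub> mon m"
proof -
  have "mon (add_mset i m) = (\<Otimes>\<^bsub>mpoly_ring R n\<^esub>j\<in>{1..n}.
      (if i = j then g j else \<one>\<^bsub>mpoly_ring R n\<^esub>) \<otimes>\<^bsub>mpoly_ring R n\<^esub> g j [^]\<^bsub>mpoly_ring R n\<^esub> count m j)"
    unfolding mon_def using g by (intro P.finprod_cong') (auto simp: P.m_comm)
  also have "\<dots> = (\<Otimes>\<^bsub>mpoly_ring R n\<^esub>j\<in>{1..n}. if i = j then g j else \<one>\<^bsub>mpoly_ring R n\<^esub>) \<otimes>\<^bsub>mpoly_ring R n\<^esub> mon m"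
    unfolding mon_def using g by (intro P.finprod_multf) auto
  also have "(\<Otimes>\<^bsub>mpoly_ring R n\<^esub>j\<in>{1..n}. if i = j then g j else \<one>\<^bsub>mpoly_ring R n\<^esub>) = g i"
    using g assms by (intro P.finprod_singleton) auto
  finally show ?thesis .
qed

text \<open>Enlarging the support adds only terms with coefficient zero. The freedom in
  \<open>T\<close> gives two summands a common index set in \<open>subst_add\<close>.\<close>

private lemma subst_eq:
  assumes "q \<in> mpolys n" "finite T" "{m. q m \<noteq> \<zero>} \<subseteq> T"
  shows "mpoly_subst R n g q =
    (\<Oplus>\<^bsub>mpoly_ring R n\<^esub>m\<in>T. indexed_const (q m) \<otimes>\<^bsub>mpoly_ring R n\<^esub> mon m)"
proof -
  have "mpoly_subst R n g q =
    (\<Oplus>\<^bsub>mpoly_ring R n\<^esub>m\<in>{m. q m \<noteq> \<zero>}. q m \<odot>\<^bsub>mpoly_ring R n\<^esub> mon m)"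
    unfolding mpoly_subst_def mon_def Let_def using assms(1) by simp
  also have "\<dots> = (\<Oplus>\<^bsub>mpoly_ring R n\<^esub>m\<in>T. indexed_const (q m) \<otimes>\<^bsub>mpoly_ring R n\<^esub> mon m)"
  proof (rule P.add.finprod_mono_neutral_cong_left)
    fix m assume "m \<in> T - {m. q m \<noteq> \<zero>}"
    then have "indexed_const (q m) = \<zero>\<^bsub>mpoly_ring R n\<^esub>" by (simp add: mpoly_ring_simps)
    then show "indexed_const (q m) \<otimes>\<^bsub>mpoly_ring R n\<^esub> mon m = \<zero>\<^bsub>mpoly_ring R n\<^esub>"
      by (simp add: mon_closed)
  qed (use assms in \<open>auto simp: smult_mpoly_eq mon_closed\<close>)
  finally show ?thesis .
qed

private lemma subst_closed: "q \<in> mpolys n \<Longrightarrow> mpoly_subst R n g q \<in> mpolys n"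
  by (subst subst_eq[OF _ mpolys_finite_support subset_refl])
     (auto intro!: P.finsum_closed mon_closed)

lemma mpoly_subst_const:
  assumes "a \<in> carrier R" shows "mpoly_subst R n g (indexed_const a) = indexed_const a"
proof -
  have mon: "mon {#} = \<one>\<^bsub>mpoly_ring R n\<^esub>"
    unfolding mon_def using g by (simp add: P.finprod_one_eqI)
  have "mpoly_subst R n g (indexed_const a)
      = (\<Oplus>\<^bsub>mpoly_ring R n\<^esub>m\<in>{{#}}. indexed_const (indexed_const a m) \<otimes>\<^bsub>mpoly_ring R n\<^esub> mon m)"
    using mpolys_const[OF assms] by (intro subst_eq) (auto simp: indexed_const_def[of a])
  also have "\<dots> = indexed_const a"
  proof -
    have "indexed_const a {#} = a" by (simp add: indexed_const_def)
    then show ?thesis using mpolys_const[OF assms, of n] mon by simp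
  qed
  finally show ?thesis .
qed

private lemma subst_add:
  assumes "p \<in> mpolys n" "q \<in> mpolys n"
  shows "mpoly_subst R n g (p \<oplus>\<^bsub>mpoly_ring R n\<^esub> q)
    = mpoly_subst R n g p \<oplus>\<^bsub>mpoly_ring R n\<^esub> mpoly_subst R n g q"
proof -
  let ?T = "{m. p m \<noteq> \<zero>} \<union> {m. q m \<noteq> \<zero>}"
  have fin: "finite ?T" using assms mpolys_finite_support by simp
  have "mpoly_subst R n g (p \<oplus>\<^bsub>mpoly_ring R n\<^esub> q) = (\<Oplus>\<^bsub>mpoly_ring R n\<^esub>m\<in>?T.
      indexed_const ((p \<oplus>\<^bsub>mpoly_ring R n\<^esub> q) m) \<otimes>\<^bsub>mpoly_ring R n\<^esub> mon m)"
    using assms fin P.a_closed[of p q]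
    by (intro subst_eq) (auto simp: mpoly_ring_simps indexed_padd_def[of p q])
  also have "\<dots> = (\<Oplus>\<^bsub>mpoly_ring R n\<^esub>m\<in>?T.
      indexed_const (p m) \<otimes>\<^bsub>mpoly_ring R n\<^esub> mon m \<oplus>\<^bsub>mpoly_ring R n\<^esub>
      indexed_const (q m) \<otimes>\<^bsub>mpoly_ring R n\<^esub> mon m)"
  proof (rule P.finsum_cong')
    fix m
    have "indexed_const ((p \<oplus>\<^bsub>mpoly_ring R n\<^esub> q) m)
        = indexed_const (p m) \<oplus>\<^bsub>mpoly_ring R n\<^esub> indexed_const (q m)"
      by (simp add: mpoly_ring_simps indexed_padd_const) (simp add: indexed_padd_def)
    then show "indexed_const ((p \<oplus>\<^bsub>mpoly_ring R n\<^esub> q) m) \<otimes>\<^bsub>mpoly_ring R n\<^esub> mon m =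
      indexed_const (p m) \<otimes>\<^bsub>mpoly_ring R n\<^esub> mon m \<oplus>\<^bsub>mpoly_ring R n\<^esub>
      indexed_const (q m) \<otimes>\<^bsub>mpoly_ring R n\<^esub> mon m"
      using assms mon_closed by (simp add: P.l_distr)
  qed (use assms in \<open>auto intro!: mon_closed P.a_closed P.m_closed\<close>)
  also have "\<dots> = mpoly_subst R n g p \<oplus>\<^bsub>mpoly_ring R n\<^esub> mpoly_subst R n g q"
    using assms fin
    by (subst (1 2) subst_eq[of _ ?T]) (auto intro!: P.finsum_addf P.m_closed mon_closed)
  finally show ?thesis .
qed

private lemma subst_mult_const:
  assumes "q \<in> mpolys n" "a \<in> carrier R"
  shows "mpoly_subst R n g (indexed_const a \<otimes>\<^bsub>mpoly_ring R n\<^esub> q)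
    = indexed_const a \<otimes>\<^bsub>mpoly_ring R n\<^esub> mpoly_subst R n g q"
proof -
  let ?T = "{m. q m \<noteq> \<zero>}"
  note fin = mpolys_finite_support[OF assms(1)]
  have e: "indexed_const a \<otimes>\<^bsub>mpoly_ring R n\<^esub> q = (\<lambda>m. a \<otimes> q m)"
    using assms mpolys_coeff[of q n] by (simp add: mpoly_ring_simps mpoly_mult_const)
  have cc: "indexed_const (a \<otimes> q m) = indexed_const a \<otimes>\<^bsub>mpoly_ring R n\<^esub> indexed_const (q m)" for m
    using assms by (intro ring_hom_mult[OF const_ring_hom]) auto
  have "mpoly_subst R n g (\<lambda>m. a \<otimes> q m) = (\<Oplus>\<^bsub>mpoly_ring R n\<^esub>m\<in>?T.
      indexed_const (a \<otimes> q m) \<otimes>\<^bsub>mpoly_ring R n\<^esub> mon m)"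
    using assms fin by (intro subst_eq) (auto intro: mpolys_smult)
  also have "\<dots> = (\<Oplus>\<^bsub>mpoly_ring R n\<^esub>m\<in>?T.
      indexed_const a \<otimes>\<^bsub>mpoly_ring R n\<^esub> (indexed_const (q m) \<otimes>\<^bsub>mpoly_ring R n\<^esub> mon m))"
    using assms by (intro P.finsum_cong') (auto simp: cc P.m_assoc mon_closed)
  also have "\<dots> = indexed_const a \<otimes>\<^bsub>mpoly_ring R n\<^esub> mpoly_subst R n g q"
    using assms fin
    by (subst subst_eq[of q ?T]) (auto intro!: P.finsum_rdistr[symmetric] mon_closed)
  finally show ?thesis by (simp add: e)
qed

text \<open>Multiplication by \<open>x\<^sub>i\<close> shifts the support by
  \<open>add_mset i\<close>, and \<open>mon_add_mset\<close> extracts one factor \<open>g i\<close>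
  from every shifted monomial.\<close>

private lemma subst_mult_var:
  assumes "q \<in> mpolys n" "i \<in> {1..n}"
  shows "mpoly_subst R n g (mpoly_var R i \<otimes>\<^bsub>mpoly_ring R n\<^esub> q)
    = g i \<otimes>\<^bsub>mpoly_ring R n\<^esub> mpoly_subst R n g q"
proof -
  let ?T = "{m. q m \<noteq> \<zero>}"
  note fin = mpolys_finite_support[OF assms(1)]
  have e: "mpoly_var R i \<otimes>\<^bsub>mpoly_ring R n\<^esub> q = q \<Otimes> i"
    using assms mpolys_coeff[of q n] by (simp add: mpoly_ring_simps pmult_eq_mult)
  have sub: "{m. (q \<Otimes> i) m \<noteq> \<zero>} \<subseteq> add_mset i ` ?T"
  proof
    fix m assume "m \<in> {m. (q \<Otimes> i) m \<noteq> \<zero>}"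
    then have "i \<in># m" "q (m - {#i#}) \<noteq> \<zero>"
      by (auto simp: indexed_pmult_def split: if_splits)
    then show "m \<in> add_mset i ` ?T"
      by (intro image_eqI[of _ _ "m - {#i#}"]) auto
  qed
  have "mpoly_subst R n g (q \<Otimes> i) = (\<Oplus>\<^bsub>mpoly_ring R n\<^esub>m\<in>add_mset i ` ?T.
      indexed_const ((q \<Otimes> i) m) \<otimes>\<^bsub>mpoly_ring R n\<^esub> mon m)"
    using assms fin sub by (intro subst_eq) (auto intro: mpolys_pmult)
  also have "\<dots> = (\<Oplus>\<^bsub>mpoly_ring R n\<^esub>m\<in>?T.
      indexed_const ((q \<Otimes> i) (add_mset i m)) \<otimes>\<^bsub>mpoly_ring R n\<^esub> mon (add_mset i m))"
    using assms by (intro P.finsum_reindex) (auto intro!: mpolys_const P.m_closed mon_closed simp: indexed_pmult_def inj_on_def)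
  also have "\<dots> = (\<Oplus>\<^bsub>mpoly_ring R n\<^esub>m\<in>?T.
      g i \<otimes>\<^bsub>mpoly_ring R n\<^esub> (indexed_const (q m) \<otimes>\<^bsub>mpoly_ring R n\<^esub> mon m))"
    using assms g by (intro P.finsum_cong') (auto simp: indexed_pmult_def mon_add_mset P.m_lcomm mon_closed)
  also have "\<dots> = g i \<otimes>\<^bsub>mpoly_ring R n\<^esub> mpoly_subst R n g q"
    using assms fin g
    by (subst subst_eq[of q ?T]) (auto intro!: P.finsum_rdistr[symmetric] mon_closed)
  finally show ?thesis by (simp add: e)
qed

lemma mpoly_subst_var:
  assumes "i \<in> {1..n}" shows "mpoly_subst R n g (mpoly_var R i) = g i"
  using subst_mult_var[of "\<one>\<^bsub>mpoly_ring R n\<^esub>" i] assms g[OF assms] mpoly_subst_const[of \<one>]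
    mpolys_var[OF assms] by (simp add: mpoly_ring_simps(2)[symmetric, of n])

lemma mpoly_subst_ring_hom: "mpoly_subst R n g \<in> ring_hom (mpoly_ring R n) (mpoly_ring R n)"
proof (rule ring_hom_memI)
  fix p q assume p: "p \<in> mpolys n" and q: "q \<in> mpolys n"
  \<comment> \<open>Induction on the left factor suffices, because products with a constant and with
    a single variable have been computed above.\<close>
  from p show "mpoly_subst R n g (p \<otimes>\<^bsub>mpoly_ring R n\<^esub> q)
    = mpoly_subst R n g p \<otimes>\<^bsub>mpoly_ring R n\<^esub> mpoly_subst R n g q"
  proof (induction rule: mpoly_ring_induct)
    case (const a) with q show ?case by (simp add: subst_mult_const mpoly_subst_const)
  next
    case (add p p') with q show ?case by (simp add: subst_add P.l_distr subst_closed)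
  next
    case (mult p i) with q g[of i] show ?case
      by (simp add: subst_mult_var P.m_assoc subst_closed mpolys_var)
  qed
next
  show "mpoly_subst R n g \<one>\<^bsub>mpoly_ring R n\<^esub> = \<one>\<^bsub>mpoly_ring R n\<^esub>"
    by (simp add: mpoly_ring_simps mpoly_subst_const)
qed (simp_all add: subst_closed subst_add)

end

end

section \<open>Base change and tame automorphisms\<close>

context ring_hom_cring
begin

lemma comp_const: "h \<circ> mpoly_const R a = mpoly_const S (h a)"
  by (auto simp: R.indexed_const_def S.indexed_const_def)

lemma comp_pmult: "h \<circ> ring.indexed_pmult R p i = ring.indexed_pmult S (h \<circ> p) i"
  by (auto simp: R.indexed_pmult_def S.indexed_pmult_def)

lemma comp_var: "h \<circ> mpoly_var R i = mpoly_var S i"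
  by (simp add: R.indexed_var_def S.indexed_var_def comp_pmult comp_const)

lemma comp_padd:
  assumes "p \<in> R.mpolys n" "q \<in> R.mpolys n"
  shows "h \<circ> ring.indexed_padd R p q = ring.indexed_padd S (h \<circ> p) (h \<circ> q)"
  using R.mpolys_coeff[OF assms(1)] R.mpolys_coeff[OF assms(2)]
  by (auto simp: R.indexed_padd_def S.indexed_padd_def)

lemma comp_mpolys: "p \<in> R.mpolys n \<Longrightarrow> h \<circ> p \<in> S.mpolys n"
proof (induction rule: R.mpolys_induct)
  case (const a) then show ?case unfolding comp_const by simp
next
  case (padd p q) then show ?case unfolding comp_padd[OF padd.hyps] by (intro S.mpolys_padd)
next
  case (pmult p i) then show ?case unfolding comp_pmult by (intro S.mpolys_pmult)
qed

lemma comp_mult: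
  assumes "p \<in> R.mpolys n" "q \<in> R.mpolys n"
  shows "h \<circ> mpoly_mult R p q = mpoly_mult S (h \<circ> p) (h \<circ> q)"
proof
  fix m
  show "(h \<circ> mpoly_mult R p q) m = mpoly_mult S (h \<circ> p) (h \<circ> q) m"
    using R.mpolys_coeff[OF assms(1)] R.mpolys_coeff[OF assms(2)]
    unfolding mpoly_mult_def comp_def
    by (subst hom_finsum) (auto intro!: S.finsum_cong')
qed

lemma comp_ring_hom: "(\<circ>) h \<in> ring_hom (mpoly_ring R n) (mpoly_ring S n)"
  by (rule ring_hom_memI)
     (simp_all add: R.mpoly_ring_simps S.mpoly_ring_simps comp_mpolys comp_mult comp_padd comp_const)

end

section \<open>Automorphisms given by substitutions, and the tame subgroup\<close>

context cring
begin

lemma GA_carrier: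
  "carrier (GA R n) = {\<phi> \<in> Bij (mpolys n). \<phi> \<in> ring_hom (mpoly_ring R n) (mpoly_ring R n) \<and>
    (\<forall>a\<in>carrier R. \<forall>q\<in>mpolys n. \<phi> (a \<odot>\<^bsub>mpoly_ring R n\<^esub> q) = a \<odot>\<^bsub>mpoly_ring R n\<^esub> \<phi> q)}"
  by (simp add: GA_def Let_def)

lemma GA_mult: "\<phi> \<in> Bij (mpolys n) \<Longrightarrow> \<psi> \<in> Bij (mpolys n) \<Longrightarrow>
    \<phi> \<otimes>\<^bsub>GA R n\<^esub> \<psi> = compose (mpolys n) \<phi> \<psi>"
  by (simp add: GA_def Let_def BijGroup_def)

text \<open>Both composites of the two substitutions fix constants and, by assumption, variables, so
  they are the identity by \<open>mpoly_hom_eqI\<close>.\<close>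

lemma mpoly_subst_GA:
  assumes g: "g \<in> {1..n} \<rightarrow> mpolys n"
    and g': "g' \<in> {1..n} \<rightarrow> mpolys n"
    and gg': "\<And>i. i \<in> {1..n} \<Longrightarrow> mpoly_subst R n g (g' i) = mpoly_var R i"
    and g'g: "\<And>i. i \<in> {1..n} \<Longrightarrow> mpoly_subst R n g' (g i) = mpoly_var R i"
  shows "mpoly_subst R n g \<in> carrier (GA R n)"
proof -
  note F = mpoly_subst_ring_hom[OF g] and G = mpoly_subst_ring_hom[OF g']
  note subst_simps = mpoly_subst_const[OF g] mpoly_subst_const[OF g'] mpoly_subst_var[OF g] mpoly_subst_var[OF g']
  have id: "(\<lambda>p. p) \<in> ring_hom (mpoly_ring R n) (mpoly_ring R n)"
    by (rule ring_hom_memI) auto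
  have comp: "(\<lambda>p. mpoly_subst R n a (mpoly_subst R n b p)) \<in> ring_hom (mpoly_ring R n) (mpoly_ring R n)"
    if "a \<in> {1..n} \<rightarrow> mpolys n" "b \<in> {1..n} \<rightarrow> mpolys n" for a b
    using ring_hom_trans[OF mpoly_subst_ring_hom[OF that(2)] mpoly_subst_ring_hom[OF that(1)]]
    by (simp add: comp_def)
  have FG: "mpoly_subst R n g (mpoly_subst R n g' p) = p" if "p \<in> mpolys n" for p
    by (rule mpoly_hom_eqI[OF comp[OF g g'] id order_refl that])
       (use gg' in \<open>simp_all add: subst_simps\<close>)
  have GF: "mpoly_subst R n g' (mpoly_subst R n g p) = p" if "p \<in> mpolys n" for p
    by (rule mpoly_hom_eqI[OF comp[OF g' g] id order_refl that])
       (use g'g in \<open>simp_all add: subst_simps\<close>)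
  have "bij_betw (mpoly_subst R n g) (mpolys n) (mpolys n)"
    using FG GF ring_hom_closed[OF F] ring_hom_closed[OF G]
    by (intro bij_betw_byWitness[of _ "mpoly_subst R n g'"]) auto
  moreover have "mpoly_subst R n g \<in> extensional (mpolys n)"
    by (simp add: mpoly_subst_def Let_def)
  moreover have "mpoly_subst R n g (a \<odot>\<^bsub>mpoly_ring R n\<^esub> q) = a \<odot>\<^bsub>mpoly_ring R n\<^esub> mpoly_subst R n g q"
    if "a \<in> carrier R" "q \<in> mpolys n" for a q
    using that ring_hom_closed[OF F, of q] ring_hom_mult[OF F, of "indexed_const a" q]
    by (simp add: smult_mpoly_eq subst_simps)
  ultimately show ?thesis
    using F by (simp add: GA_carrier Bij_def)
qed

text \<open>Membership in \<open>Bij\<close> is carried along because the product of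
  \<open>BijGroup\<close> is composition only for arguments in \<open>Bij\<close>.\<close>

lemma TA_compose:
  assumes "\<phi> \<in> TA R n \<inter> Bij (mpolys n)" "\<psi> \<in> TA R n \<inter> Bij (mpolys n)"
  shows "compose (mpolys n) \<phi> \<psi> \<in> TA R n \<inter> Bij (mpolys n)"
proof -
  have "\<phi> \<otimes>\<^bsub>GA R n\<^esub> \<psi> \<in> TA R n"
    using assms unfolding TA_def by (auto intro: generate.eng)
  with assms show ?thesis by (simp add: GA_mult compose_Bij)
qed

lemma generators_TA:
  "affine_automorphisms R n \<union> triangular_automorphisms R n \<subseteq> TA R n \<inter> Bij (mpolys n)"
  unfolding TA_def
  by (auto intro: generate.incl simp: affine_automorphisms_def triangular_automorphisms_def GA_carrier)

text \<open>Nontriviality enters here: over the zero ring every polynomial has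
  \<open>total_degree\<close> 0 by convention.\<close>

lemma total_degree_var:
  assumes "\<one> \<noteq> \<zero>" shows "total_degree R (mpoly_var R i) = 1"
proof -
  have "mpoly_var R i m = (if m = {#i#} then \<one> else \<zero>)" for m
    by (cases "i \<in># m") (auto simp: indexed_var_def indexed_pmult_def indexed_const_def
        dest!: multi_member_split)
  with assms have "{m. mpoly_var R i m \<noteq> \<zero>} = {{#i#}}" by auto
  then show ?thesis by (simp add: total_degree_def)
qed

text \<open>Since \<open>w\<close> is an involution on the indices, the substitution is its own
  inverse.\<close>

lemma mpoly_subst_permutation_affine:
  assumes "\<one> \<noteq> \<zero>" and w: "\<And>i. i \<in> {1..n} \<Longrightarrow> w i \<in> {1..n}" "\<And>i. i \<in> {1..n} \<Longrightarrow> w (w i) = i"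
  shows "mpoly_subst R n (\<lambda>i. mpoly_var R (w i)) \<in> affine_automorphisms R n"
proof -
  have v: "(\<lambda>i. mpoly_var R (w i)) \<in> {1..n} \<rightarrow> mpolys n"
    using w(1) by (auto intro!: mpolys_var)
  have s: "mpoly_subst R n (\<lambda>i. mpoly_var R (w i)) (mpoly_var R i) = mpoly_var R (w i)"
    if "i \<in> {1..n}" for i
    by (rule mpoly_subst_var[OF v that])
  have "mpoly_subst R n (\<lambda>i. mpoly_var R (w i)) \<in> carrier (GA R n)"
    using s[OF w(1)] w(2) by (intro mpoly_subst_GA[OF v v]) simp_all
  then show ?thesis
    using total_degree_var[OF assms(1)] by (simp add: affine_automorphisms_def s)
qed

end

section \<open>Divided powers and derivations over the rationals\<close>

text \<open>The rational structure is recorded as a ring homomorphism \<open>\<theta>\<close> from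
  the rationals, a form that can be pushed forward along any homomorphism of rings.\<close>

locale rat_cring = cring R for R (structure) +
  fixes \<theta> :: "rat \<Rightarrow> 'a"
  assumes theta_hom: "\<theta> \<in> ring_hom rat_field R"
begin

lemma theta_closed [simp, intro]: "\<theta> r \<in> carrier R"
  using ring_hom_closed[OF theta_hom, of r] by (simp add: ring_of_type_algebra_def)

lemma theta_add: "\<theta> (r + s) = \<theta> r \<oplus> \<theta> s"
  using ring_hom_add[OF theta_hom, of r s] by (simp add: ring_of_type_algebra_def)

lemma theta_mult: "\<theta> (r * s) = \<theta> r \<otimes> \<theta> s"
  using ring_hom_mult[OF theta_hom, of r s] by (simp add: ring_of_type_algebra_def)

lemma theta_one [simp]: "\<theta> 1 = \<one>"
  using ring_hom_one[OF theta_hom] by (simp add: ring_of_type_algebra_def)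

lemma theta_zero [simp]: "\<theta> 0 = \<zero>"
  using theta_add[of 0 0] by (metis add_0 add.r_cancel_one' theta_closed)

text \<open>Division by a nonzero rational. Identities containing \<open>1 / fact (Suc k)\<close>
  are proved below after multiplying by \<open>Suc k\<close>, and this removes the factor
  again.\<close>

lemma theta_cancel:
  assumes "r \<noteq> 0" "\<theta> r \<otimes> x = \<theta> r \<otimes> y" "x \<in> carrier R" "y \<in> carrier R"
  shows "x = y"
proof -
  have "\<theta> (1 / r) \<otimes> (\<theta> r \<otimes> z) = z" if "z \<in> carrier R" for z
    using assms(1) that by (simp add: m_assoc[symmetric] theta_mult[symmetric])
  then show ?thesis using assms by metis
qed

definition dpow :: "'a \<Rightarrow> nat \<Rightarrow> 'a"
  where "dpow t l = \<theta> (1 / fact l) \<otimes> t [^] l"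

lemma dpow_closed [simp, intro]: "t \<in> carrier R \<Longrightarrow> dpow t l \<in> carrier R"
  by (simp add: dpow_def)

lemma dpow_0 [simp]: "t \<in> carrier R \<Longrightarrow> dpow t 0 = \<one>"
  by (simp add: dpow_def)

lemma dpow_Suc_0 [simp]: "t \<in> carrier R \<Longrightarrow> dpow t (Suc 0) = t"
  by (simp add: dpow_def)

lemma theta_fact_Suc: "\<theta> (of_nat (Suc l)) \<otimes> \<theta> (1 / fact (Suc l)) = \<theta> (1 / fact l)"
proof -
  have "of_nat (Suc l) * (1 / fact (Suc l)) = (1 / fact l :: rat)"
    by (simp add: divide_simps del: of_nat_Suc)
  then show ?thesis by (simp only: theta_mult[symmetric])
qed

lemma theta_dpow_Suc: "t \<in> carrier R \<Longrightarrow> \<theta> (of_nat (Suc l)) \<otimes> dpow t (Suc l) = t \<otimes> dpow t l"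
  unfolding dpow_def using theta_fact_Suc[of l]
  by (simp add: m_assoc[symmetric] del: fact_Suc of_nat_Suc) (simp add: m_ac del: of_nat_Suc)

text \<open>This is the rule (AB)' = A'B + AB' for formal power series with coefficients
  \<open>a i\<close> and \<open>b i\<close>, read off in degree \<open>k\<close>. It rests on
  splitting the factor \<open>Suc k\<close> as \<open>i + (Suc k - i)\<close> in each term. It
  drives both the binomial theorem \<open>dpow_add\<close> and the Leibniz rule
  \<open>divD_mult\<close>.\<close>

lemma theta_conv_Suc:
  assumes a: "\<And>i. a i \<in> carrier R" and b: "\<And>i. b i \<in> carrier R"
  shows "\<theta> (of_nat (Suc k)) \<otimes> (\<Oplus>i\<in>{..Suc k}. a i \<otimes> b (Suc k - i)) =
    (\<Oplus>i\<in>{..k}. (\<theta> (of_nat (Suc i)) \<otimes> a (Suc i)) \<otimes> b (k - i)) \<oplus>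
    (\<Oplus>i\<in>{..k}. a i \<otimes> (\<theta> (of_nat (Suc (k - i))) \<otimes> b (Suc (k - i))))"
proof -
  have "\<theta> (of_nat (Suc k)) \<otimes> (\<Oplus>i\<in>{..Suc k}. a i \<otimes> b (Suc k - i)) =
     (\<Oplus>i\<in>{..Suc k}. \<theta> (of_nat (Suc k)) \<otimes> (a i \<otimes> b (Suc k - i)))"
    using a b by (intro finsum_rdistr) auto
  also have "\<dots> = (\<Oplus>i\<in>{..Suc k}. (\<theta> (of_nat i) \<otimes> a i) \<otimes> b (Suc k - i) \<oplus>
      a i \<otimes> (\<theta> (of_nat (Suc k - i)) \<otimes> b (Suc k - i)))"
  proof (rule finsum_cong')
    fix i assume "i \<in> {..Suc k}"
    then have "of_nat (Suc k) = (of_nat i + of_nat (Suc k - i) :: rat)"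
      by (simp only: of_nat_add[symmetric]) simp
    then have "\<theta> (of_nat (Suc k)) = \<theta> (of_nat i) \<oplus> \<theta> (of_nat (Suc k - i))"
      by (simp only: theta_add)
    then show "\<theta> (of_nat (Suc k)) \<otimes> (a i \<otimes> b (Suc k - i)) =
      (\<theta> (of_nat i) \<otimes> a i) \<otimes> b (Suc k - i) \<oplus> a i \<otimes> (\<theta> (of_nat (Suc k - i)) \<otimes> b (Suc k - i))"
      using a b by (simp only: l_distr m_closed theta_closed) (simp add: m_ac)
  qed (use a b in auto)
  also have "\<dots> = (\<Oplus>i\<in>{..Suc k}. (\<theta> (of_nat i) \<otimes> a i) \<otimes> b (Suc k - i)) \<oplus>
      (\<Oplus>i\<in>{..Suc k}. a i \<otimes> (\<theta> (of_nat (Suc k - i)) \<otimes> b (Suc k - i)))"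
    using a b by (intro finsum_addf) auto
  \<comment> \<open>The term \<open>i = 0\<close> carries the factor \<open>\<theta> 0\<close> and
    drops out, which permits the shift of the index. In the other sum the last term drops out for
    the same reason.\<close>
  also have "(\<Oplus>i\<in>{..Suc k}. (\<theta> (of_nat i) \<otimes> a i) \<otimes> b (Suc k - i)) =
      (\<Oplus>i\<in>{..k}. (\<theta> (of_nat (Suc i)) \<otimes> a (Suc i)) \<otimes> b (k - i))"
    using a b by (subst finsum_Suc2) (auto simp del: of_nat_Suc finsum_Suc)
  also have "(\<Oplus>i\<in>{..Suc k}. a i \<otimes> (\<theta> (of_nat (Suc k - i)) \<otimes> b (Suc k - i))) =
      (\<Oplus>i\<in>{..k}. a i \<otimes> (\<theta> (of_nat (Suc k - i)) \<otimes> b (Suc k - i)))"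
    using a b by (subst finsum_Suc) auto
  also have "\<dots> = (\<Oplus>i\<in>{..k}. a i \<otimes> (\<theta> (of_nat (Suc (k - i))) \<otimes> b (Suc (k - i))))"
    using a b by (intro finsum_cong') (auto simp: Suc_diff_le simp del: of_nat_Suc)
  finally show ?thesis .
qed

text \<open>The binomial theorem with the binomial coefficients absorbed into divided powers. After
  multiplication by \<open>Suc k\<close> the left side is \<open>s \<oplus> t\<close> times the case
  \<open>k\<close>, and \<open>theta_conv_Suc\<close> brings the right side to the same
  form.\<close>

lemma dpow_add:
  assumes s: "s \<in> carrier R" and t: "t \<in> carrier R"
  shows "dpow (s \<oplus> t) k = (\<Oplus>i\<in>{..k}. dpow s i \<otimes> dpow t (k - i))"
proof (induction k)
  case 0 then show ?case using assms by simp
next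
  case (Suc k)
  have "\<theta> (of_nat (Suc k)) \<otimes> dpow (s \<oplus> t) (Suc k) = (s \<oplus> t) \<otimes> (\<Oplus>i\<in>{..k}. dpow s i \<otimes> dpow t (k - i))"
    using assms Suc by (simp add: theta_dpow_Suc del: of_nat_Suc)
  also have "\<dots> = (\<Oplus>i\<in>{..k}. s \<otimes> (dpow s i \<otimes> dpow t (k - i))) \<oplus> (\<Oplus>i\<in>{..k}. t \<otimes> (dpow s i \<otimes> dpow t (k - i)))"
    using assms by (simp add: l_distr finsum_rdistr Pi_def)
  also have "\<dots> = (\<Oplus>i\<in>{..k}. (s \<otimes> dpow s i) \<otimes> dpow t (k - i)) \<oplus> (\<Oplus>i\<in>{..k}. dpow s i \<otimes> (t \<otimes> dpow t (k - i)))"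
    using assms by (intro arg_cong2[where f="(\<oplus>)"] finsum_cong') (auto simp: m_ac)
  also have "\<dots> = \<theta> (of_nat (Suc k)) \<otimes> (\<Oplus>i\<in>{..Suc k}. dpow s i \<otimes> dpow t (Suc k - i))"
    using assms by (subst theta_conv_Suc) (simp_all add: theta_dpow_Suc del: of_nat_Suc)
  finally show ?case
    by (rule theta_cancel[rotated]) (use assms in \<open>auto intro!: finsum_closed simp del: finsum_Suc\<close>)
qed

text \<open>The pairs with \<open>i + j \<le> N\<close> are summed along antidiagonals and along
  rows. In \<open>Exp_Exp\<close> the inner truncation depends on the outer index, so the region is
  a triangle and not a square.\<close>

lemma finsum_triangle:
  fixes N :: nat
  assumes c: "\<And>i j. c i j \<in> carrier R"
  shows "(\<Oplus>k\<in>{..N}. \<Oplus>i\<in>{..k}. c i (k - i)) = (\<Oplus>i\<in>{..N}. \<Oplus>j\<in>{..N - i}. c i j)"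
proof (induction N)
  case 0 then show ?case using c by simp
next
  case (Suc N)
  have "(\<Oplus>i\<in>{..N}. \<Oplus>j\<in>{..Suc N - i}. c i j) = (\<Oplus>i\<in>{..N}. c i (Suc N - i) \<oplus> (\<Oplus>j\<in>{..N - i}. c i j))"
    using c by (intro finsum_cong') (auto simp: Suc_diff_le Pi_def)
  also have "\<dots> = (\<Oplus>i\<in>{..N}. c i (Suc N - i)) \<oplus> (\<Oplus>i\<in>{..N}. \<Oplus>j\<in>{..N - i}. c i j)"
    using c by (intro finsum_addf) auto
  finally show ?case
    using c Suc by (simp add: Pi_def a_assoc)
qed

end

section \<open>Rational derivations and the Leibniz rule in divided form\<close>

locale rat_derivation = rat_cring P \<theta> for P (structure) and \<theta> +
  fixes D
  assumes D_closed [simp, intro]: "p \<in> carrier P \<Longrightarrow> D p \<in> carrier P"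
    and D_add: "p \<in> carrier P \<Longrightarrow> q \<in> carrier P \<Longrightarrow> D (p \<oplus> q) = D p \<oplus> D q"
    and D_theta: "p \<in> carrier P \<Longrightarrow> D (\<theta> r \<otimes> p) = \<theta> r \<otimes> D p"
    and D_mult: "p \<in> carrier P \<Longrightarrow> q \<in> carrier P \<Longrightarrow> D (p \<otimes> q) = D p \<otimes> q \<oplus> p \<otimes> D q"
begin

lemma D_zero [simp]: "D \<zero> = \<zero>"
  using D_theta[of \<zero> 0] by simp

lemma D_pow_closed [simp, intro]: "p \<in> carrier P \<Longrightarrow> (D ^^ l) p \<in> carrier P"
  by (induction l) auto

lemma D_pow_zero [simp]: "(D ^^ l) \<zero> = \<zero>"
  by (induction l) auto

lemma D_pow_vanish: "(D ^^ N) p = \<zero> \<Longrightarrow> N \<le> l \<Longrightarrow> (D ^^ l) p = \<zero>"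
  by (metis D_pow_zero comp_apply funpow_add le_add_diff_inverse2)

lemma D_pow_add: "p \<in> carrier P \<Longrightarrow> q \<in> carrier P \<Longrightarrow> (D ^^ l) (p \<oplus> q) = (D ^^ l) p \<oplus> (D ^^ l) q"
  by (induction l) (auto simp: D_add)

lemma D_finsum:
  "finite A \<Longrightarrow> f \<in> A \<rightarrow> carrier P \<Longrightarrow> D (\<Oplus>i\<in>A. f i) = (\<Oplus>i\<in>A. D (f i))"
  by (induction A rule: finite_induct) (auto simp: D_add Pi_def)

text \<open>These operators form the higher (Hasse-Schmidt) derivation attached to \<open>D\<close>;
  dividing by \<open>fact l\<close> removes binomial coefficients from the Leibniz rule.\<close>

definition divD :: "nat \<Rightarrow> 'a \<Rightarrow> 'a"
  where "divD l p = \<theta> (1 / fact l) \<otimes> (D ^^ l) p"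

lemma divD_closed [simp, intro]: "p \<in> carrier P \<Longrightarrow> divD l p \<in> carrier P"
  by (simp add: divD_def)

lemma theta_divD_Suc: "p \<in> carrier P \<Longrightarrow> \<theta> (of_nat (Suc l)) \<otimes> divD (Suc l) p = D (divD l p)"
  unfolding divD_def using theta_fact_Suc[of l]
  by (simp add: m_assoc[symmetric] D_theta del: fact_Suc of_nat_Suc)

text \<open>Same scheme as \<open>dpow_add\<close>: multiplication by \<open>Suc k\<close> turns
  \<open>divD (Suc k)\<close> into \<open>D\<close> applied to \<open>divD k\<close>, and
  \<open>theta_conv_Suc\<close> matches the two halves of the product rule.\<close>

lemma divD_mult:
  assumes p: "p \<in> carrier P" and q: "q \<in> carrier P"
  shows "divD k (p \<otimes> q) = (\<Oplus>i\<in>{..k}. divD i p \<otimes> divD (k - i) q)"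
proof (induction k)
  case 0 then show ?case using assms by (simp add: divD_def)
next
  case (Suc k)
  have "\<theta> (of_nat (Suc k)) \<otimes> divD (Suc k) (p \<otimes> q) = D (\<Oplus>i\<in>{..k}. divD i p \<otimes> divD (k - i) q)"
    using assms Suc by (simp add: theta_divD_Suc del: of_nat_Suc)
  also have "\<dots> = (\<Oplus>i\<in>{..k}. D (divD i p) \<otimes> divD (k - i) q \<oplus> divD i p \<otimes> D (divD (k - i) q))"
    using assms by (simp add: D_finsum Pi_def D_mult)
  also have "\<dots> = (\<Oplus>i\<in>{..k}. D (divD i p) \<otimes> divD (k - i) q) \<oplus> (\<Oplus>i\<in>{..k}. divD i p \<otimes> D (divD (k - i) q))"
    using assms by (intro finsum_addf) auto
  also have "\<dots> = \<theta> (of_nat (Suc k)) \<otimes> (\<Oplus>i\<in>{..Suc k}. divD i p \<otimes> divD (Suc k - i) q)"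
    using assms by (subst theta_conv_Suc) (simp_all add: theta_divD_Suc del: of_nat_Suc)
  finally show ?case
    by (rule theta_cancel[rotated]) (use assms in \<open>auto intro!: finsum_closed simp del: finsum_Suc\<close>)
qed

lemma divD_eq_zero_iff: "p \<in> carrier P \<Longrightarrow> divD l p = \<zero> \<longleftrightarrow> (D ^^ l) p = \<zero>"
  using theta_cancel[of "1 / fact l" "(D ^^ l) p" \<zero>] by (auto simp: divD_def)

lemma D_nilpotent_add:
  assumes "p \<in> carrier P" "q \<in> carrier P" "\<exists>N. (D ^^ N) p = \<zero>" "\<exists>N. (D ^^ N) q = \<zero>"
  shows "\<exists>N. (D ^^ N) (p \<oplus> q) = \<zero>"
proof -
  obtain M N where "(D ^^ M) p = \<zero>" "(D ^^ N) q = \<zero>" using assms by blast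
  then have "(D ^^ max M N) p = \<zero>" "(D ^^ max M N) q = \<zero>" by (auto intro: D_pow_vanish)
  then show ?thesis using assms by (intro exI[of _ "max M N"]) (simp add: D_pow_add)
qed

text \<open>In the Leibniz expansion of order \<open>M + N\<close> every term has
  \<open>M \<le> i\<close> or \<open>N \<le> M + N - i\<close>, so one of its factors
  vanishes.\<close>

lemma D_nilpotent_mult:
  assumes p: "p \<in> carrier P" and q: "q \<in> carrier P" and "\<exists>N. (D ^^ N) p = \<zero>" "\<exists>N. (D ^^ N) q = \<zero>"
  shows "\<exists>N. (D ^^ N) (p \<otimes> q) = \<zero>"
proof -
  obtain M N where MN: "(D ^^ M) p = \<zero>" "(D ^^ N) q = \<zero>" using assms by blast
  have "divD i p \<otimes> divD (M + N - i) q = \<zero>" for i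
  proof (cases "M \<le> i")
    case True
    then have "divD i p = \<zero>" using MN p D_pow_vanish by (simp add: divD_eq_zero_iff)
    then show ?thesis using q by simp
  next
    case False
    then have "divD (M + N - i) q = \<zero>" using MN q D_pow_vanish by (simp add: divD_eq_zero_iff)
    then show ?thesis using p by simp
  qed
  then have "divD (M + N) (p \<otimes> q) = \<zero>" using assms by (simp add: divD_mult)
  then show ?thesis using p q by (auto simp: divD_eq_zero_iff)
qed

end

section \<open>Exponentials of nilpotent derivations\<close>

text \<open>The parameter \<open>t\<close> and the values of the base map \<open>j\<close> lie in a
  target ring on which no derivation is given, so \<open>t\<close> acts as a mere scalar. The index
  set has the same shape as in \<open>exp_derivation\<close>; it is finite when some power of
  \<open>D\<close> kills \<open>p\<close>.\<close>

definition exp_sum ::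
  "('a, 'm) ring_scheme \<Rightarrow> ('a \<Rightarrow> 'a) \<Rightarrow> ('b, 'n) ring_scheme \<Rightarrow> (rat \<Rightarrow> 'b) \<Rightarrow> ('a \<Rightarrow> 'b) \<Rightarrow> 'b \<Rightarrow> 'a \<Rightarrow> 'b"
  where "exp_sum P D S \<eta> j t p =
    (\<Oplus>\<^bsub>S\<^esub>l\<in>{l. (D ^^ l) p \<noteq> \<zero>\<^bsub>P\<^esub>}. rat_cring.dpow S \<eta> t l \<otimes>\<^bsub>S\<^esub> j ((D ^^ l) p))"

locale nilpotent_rat_derivation = rat_derivation +
  assumes D_nilpotent: "p \<in> carrier P \<Longrightarrow> \<exists>N. (D ^^ N) p = \<zero>"

locale derivation_exp = nilpotent_rat_derivation P \<theta> D + S: rat_cring S \<eta>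
  for P (structure) and \<theta> and D and S (structure) and \<eta> +
  fixes j
  assumes j_hom: "j \<in> ring_hom P S"
    and j_theta: "j (\<theta> r) = \<eta> r"
begin

sublocale j: ring_hom_cring P S j
  by unfold_locales (rule j_hom)

abbreviation Exp where "Exp t p \<equiv> exp_sum P D S \<eta> j t p"

text \<open>Any exponent that annihilates \<open>p\<close> is a valid truncation. The term at
  \<open>N\<close> itself is zero and is kept, so that several elements can share one generous
  bound.\<close>

lemma Exp_eq:
  assumes "p \<in> carrier P" "t \<in> carrier S" "(D ^^ N) p = \<zero>"
  shows "Exp t p = (\<Oplus>\<^bsub>S\<^esub>l\<in>{..N}. S.dpow t l \<otimes>\<^bsub>S\<^esub> j ((D ^^ l) p))"
  unfolding exp_sum_def
proof (rule S.add.finprod_mono_neutral_cong_left)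
  show "{l. (D ^^ l) p \<noteq> \<zero>} \<subseteq> {..N}"
    using D_pow_vanish[OF assms(3)] by (metis (mono_tags) atMost_iff mem_Collect_eq nat_le_linear subsetI)
qed (use assms in auto)

lemma Exp_closed [simp, intro]: "p \<in> carrier P \<Longrightarrow> t \<in> carrier S \<Longrightarrow> Exp t p \<in> carrier S"
  unfolding exp_sum_def by (intro S.finsum_closed) auto

lemma Exp_const:
  assumes "p \<in> carrier P" "t \<in> carrier S" "D p = \<zero>" shows "Exp t p = j p"
  using assms Exp_eq[of p t 1] by simp

lemma Exp_linear:
  assumes "p \<in> carrier P" "t \<in> carrier S" "D (D p) = \<zero>"
  shows "Exp t p = j p \<oplus>\<^bsub>S\<^esub> t \<otimes>\<^bsub>S\<^esub> j (D p)"
  using assms Exp_eq[of p t "Suc (Suc 0)"] by (simp add: S.a_comm)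

lemma Exp_zero:
  assumes "p \<in> carrier P" shows "Exp \<zero>\<^bsub>S\<^esub> p = j p"
proof -
  have d: "S.dpow \<zero>\<^bsub>S\<^esub> (Suc l) = \<zero>\<^bsub>S\<^esub>" for l by (simp add: S.dpow_def)
  obtain N where N: "(D ^^ N) p = \<zero>" using D_nilpotent assms by blast
  then have "(D ^^ Suc N) p = \<zero>" by (rule D_pow_vanish) simp
  then have "Exp \<zero>\<^bsub>S\<^esub> p = (\<Oplus>\<^bsub>S\<^esub>l\<in>{..Suc N}. S.dpow \<zero>\<^bsub>S\<^esub> l \<otimes>\<^bsub>S\<^esub> j ((D ^^ l) p))"
    using assms by (intro Exp_eq) auto
  also have "\<dots> = j p"
    using assms by (subst S.finsum_Suc2) (auto simp: d simp del: S.finsum_Suc)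
  finally show ?thesis .
qed

text \<open>For products, the Leibniz rule in divided form makes the series of
  \<open>p \<otimes> q\<close> the Cauchy product of the series of \<open>p\<close> and
  \<open>q\<close>. All powers of \<open>t\<close> are multiplied in \<open>S\<close>, so no
  constancy of \<open>t\<close> enters.\<close>

lemma Exp_ring_hom:
  assumes t: "t \<in> carrier S" shows "Exp t \<in> ring_hom P S"
proof (rule ring_hom_memI)
  fix p q assume pq: "p \<in> carrier P" "q \<in> carrier P"
  obtain M N where "(D ^^ M) p = \<zero>" "(D ^^ N) q = \<zero>"
    using D_nilpotent pq by meson
  then have m: "(D ^^ max M N) p = \<zero>" "(D ^^ max M N) q = \<zero>"
    by (auto intro: D_pow_vanish)
  then have "(D ^^ max M N) (p \<oplus> q) = \<zero>"
    using pq by (simp add: D_pow_add)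
  with m pq t show "Exp t (p \<oplus> q) = Exp t p \<oplus>\<^bsub>S\<^esub> Exp t q"
    by (simp add: Exp_eq[of _ _ "max M N"] D_pow_add S.r_distr S.finsum_addf Pi_def)
next
  fix p q assume pq: "p \<in> carrier P" "q \<in> carrier P"
  \<comment> \<open>The factor \<open>1 / fact l\<close> moves from the power of \<open>t\<close> to
    the power of \<open>D\<close> through \<open>j_theta\<close>, so that \<open>divD_mult\<close>
    becomes applicable.\<close>
  have Exp_eq': "Exp t r = (\<Oplus>\<^bsub>S\<^esub>l\<in>{..K}. t [^]\<^bsub>S\<^esub> l \<otimes>\<^bsub>S\<^esub> j (divD l r))"
    if "r \<in> carrier P" "(D ^^ K) r = \<zero>" for r K
    unfolding Exp_eq[OF that(1) t that(2)] S.dpow_def divD_def using that t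
    by (intro S.finsum_cong') (auto simp: j_theta S.m_ac)
  obtain M N K where MNK: "(D ^^ M) p = \<zero>" "(D ^^ N) q = \<zero>" "(D ^^ K) (p \<otimes> q) = \<zero>"
    using D_nilpotent pq m_closed by meson
  \<comment> \<open>One bound truncates both factors, and its double truncates the product, which is
    the shape that \<open>cauchy_product\<close> requires.\<close>
  let ?N = "max K (max M N)"
  let ?a = "\<lambda>l. t [^]\<^bsub>S\<^esub> l \<otimes>\<^bsub>S\<^esub> j (divD l p)" and ?b = "\<lambda>l. t [^]\<^bsub>S\<^esub> l \<otimes>\<^bsub>S\<^esub> j (divD l q)"
  have z: "(D ^^ ?N) p = \<zero>" "(D ^^ ?N) q = \<zero>" "(D ^^ (?N + ?N)) (p \<otimes> q) = \<zero>"
    using MNK by (auto intro: D_pow_vanish)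
  have "Exp t (p \<otimes> q) = (\<Oplus>\<^bsub>S\<^esub>k\<in>{..?N + ?N}. t [^]\<^bsub>S\<^esub> k \<otimes>\<^bsub>S\<^esub> j (divD k (p \<otimes> q)))"
    using pq z by (intro Exp_eq') auto
  also have "\<dots> = (\<Oplus>\<^bsub>S\<^esub>k\<in>{..?N + ?N}. \<Oplus>\<^bsub>S\<^esub>i\<in>{..k}. ?a i \<otimes>\<^bsub>S\<^esub> ?b (k - i))"
  proof (rule S.finsum_cong')
    fix k
    have "t [^]\<^bsub>S\<^esub> k \<otimes>\<^bsub>S\<^esub> j (divD k (p \<otimes> q))
        = t [^]\<^bsub>S\<^esub> k \<otimes>\<^bsub>S\<^esub> (\<Oplus>\<^bsub>S\<^esub>i\<in>{..k}. j (divD i p) \<otimes>\<^bsub>S\<^esub> j (divD (k - i) q))"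
      using pq by (simp add: divD_mult Pi_def comp_def)
    also have "\<dots> = (\<Oplus>\<^bsub>S\<^esub>i\<in>{..k}. t [^]\<^bsub>S\<^esub> k \<otimes>\<^bsub>S\<^esub> (j (divD i p) \<otimes>\<^bsub>S\<^esub> j (divD (k - i) q)))"
      using pq t by (intro S.finsum_rdistr) auto
    also have "\<dots> = (\<Oplus>\<^bsub>S\<^esub>i\<in>{..k}. ?a i \<otimes>\<^bsub>S\<^esub> ?b (k - i))"
    proof (rule S.finsum_cong')
      fix i assume "i \<in> {..k}"
      then have "t [^]\<^bsub>S\<^esub> k = t [^]\<^bsub>S\<^esub> i \<otimes>\<^bsub>S\<^esub> t [^]\<^bsub>S\<^esub> (k - i)"
        using t by (simp add: S.nat_pow_mult)
      then show "t [^]\<^bsub>S\<^esub> k \<otimes>\<^bsub>S\<^esub> (j (divD i p) \<otimes>\<^bsub>S\<^esub> j (divD (k - i) q)) = ?a i \<otimes>\<^bsub>S\<^esub> ?b (k - i)"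
        using pq t by (simp add: S.m_ac)
    qed (use pq t in auto)
    finally show "t [^]\<^bsub>S\<^esub> k \<otimes>\<^bsub>S\<^esub> j (divD k (p \<otimes> q)) = (\<Oplus>\<^bsub>S\<^esub>i\<in>{..k}. ?a i \<otimes>\<^bsub>S\<^esub> ?b (k - i))" .
  qed (use pq t in \<open>auto intro!: S.finsum_closed\<close>)
  also have "\<dots> = (\<Oplus>\<^bsub>S\<^esub>i\<in>{..?N}. ?a i) \<otimes>\<^bsub>S\<^esub> (\<Oplus>\<^bsub>S\<^esub>i\<in>{..?N}. ?b i)"
  proof (rule S.cauchy_product)
    have "?a m = \<zero>\<^bsub>S\<^esub>" "?b m = \<zero>\<^bsub>S\<^esub>" if "?N < m" for m
    proof -
      have "divD m p = \<zero>" "divD m q = \<zero>"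
        using that pq z D_pow_vanish[of ?N] by (auto simp: divD_eq_zero_iff less_imp_le)
      with t show "?a m = \<zero>\<^bsub>S\<^esub>" "?b m = \<zero>\<^bsub>S\<^esub>" by simp_all
    qed
    then show "bound \<zero>\<^bsub>S\<^esub> ?N ?a" "bound \<zero>\<^bsub>S\<^esub> ?N ?b" by (auto intro!: bound.intro)
  qed (use pq t in auto)
  also have "\<dots> = Exp t p \<otimes>\<^bsub>S\<^esub> Exp t q"
    using pq z by (simp add: Exp_eq')
  finally show "Exp t (p \<otimes> q) = Exp t p \<otimes>\<^bsub>S\<^esub> Exp t q" .
next
  \<comment> \<open>The product rule at \<open>\<one> \<otimes> \<one>\<close> gives D(1) = D(1) +
    D(1).\<close>
  have "D \<one> = \<zero>"
    using D_mult[of \<one> \<one>] add.r_cancel_one'[of "D \<one>" "D \<one>"] by simp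
  then show "Exp t \<one> = \<one>\<^bsub>S\<^esub>" using t by (simp add: Exp_const)
qed (use t in auto)

lemma Exp_theta:
  assumes "t \<in> carrier S" shows "Exp t (\<theta> r) = \<eta> r"
proof -
  have "D \<one> = \<zero>"
    using D_mult[of \<one> \<one>] add.r_cancel_one'[of "D \<one>" "D \<one>"] by simp
  then have "D (\<theta> r) = \<zero>" using D_theta[of \<one> r] by simp
  with assms show ?thesis by (simp add: Exp_const j_theta)
qed

text \<open>The double series has terms with \<open>dpow u i\<close>, \<open>dpow t k\<close> and
  the power \<open>i + k\<close> of \<open>D\<close>. Collecting equal values of
  \<open>i + k\<close> leaves the binomial sum for \<open>u \<oplus> t\<close>.\<close>

lemma Exp_Exp:
  assumes t: "t \<in> carrier S" and u: "u \<in> carrier S" and p: "p \<in> carrier P"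
  shows "exp_sum P D S \<eta> (Exp t) u p = Exp (u \<oplus>\<^bsub>S\<^esub> t) p"
proof -
  interpret E: derivation_exp P \<theta> D S \<eta> "Exp t"
    by unfold_locales (simp_all add: Exp_ring_hom Exp_theta t)
  obtain N where N: "(D ^^ N) p = \<zero>" using D_nilpotent p by blast
  let ?c = "\<lambda>i k. S.dpow u i \<otimes>\<^bsub>S\<^esub> (S.dpow t k \<otimes>\<^bsub>S\<^esub> j ((D ^^ (i + k)) p))"
  have "exp_sum P D S \<eta> (Exp t) u p = (\<Oplus>\<^bsub>S\<^esub>l\<in>{..N}. S.dpow u l \<otimes>\<^bsub>S\<^esub> Exp t ((D ^^ l) p))"
    using p u N by (rule E.Exp_eq)
  also have "\<dots> = (\<Oplus>\<^bsub>S\<^esub>l\<in>{..N}. \<Oplus>\<^bsub>S\<^esub>k\<in>{..N - l}. ?c l k)"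
  proof (rule S.finsum_cong')
    fix l assume l: "l \<in> {..N}"
    have e: "(D ^^ k) ((D ^^ l) p) = (D ^^ (l + k)) p" for k
      by (simp add: add.commute[of l k] funpow_add)
    \<comment> \<open>After \<open>l\<close> applications of \<open>D\<close>, already
      \<open>N - l\<close> further ones give zero; this is what bounds the inner sum.\<close>
    with l N have "Exp t ((D ^^ l) p) = (\<Oplus>\<^bsub>S\<^esub>k\<in>{..N - l}. S.dpow t k \<otimes>\<^bsub>S\<^esub> j ((D ^^ (l + k)) p))"
      using p t by (subst Exp_eq[of _ _ "N - l"]) auto
    then show "S.dpow u l \<otimes>\<^bsub>S\<^esub> Exp t ((D ^^ l) p) = (\<Oplus>\<^bsub>S\<^esub>k\<in>{..N - l}. ?c l k)"
      using p t u by (simp add: S.finsum_rdistr Pi_def)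
  qed (use p t u in \<open>auto intro!: S.finsum_closed\<close>)
  also have "\<dots> = (\<Oplus>\<^bsub>S\<^esub>k\<in>{..N}. \<Oplus>\<^bsub>S\<^esub>i\<in>{..k}. ?c i (k - i))"
    using p t u by (intro S.finsum_triangle[symmetric]) auto
  also have "\<dots> = (\<Oplus>\<^bsub>S\<^esub>k\<in>{..N}. S.dpow (u \<oplus>\<^bsub>S\<^esub> t) k \<otimes>\<^bsub>S\<^esub> j ((D ^^ k) p))"
  proof (rule S.finsum_cong')
    fix k
    have "(\<Oplus>\<^bsub>S\<^esub>i\<in>{..k}. ?c i (k - i)) = (\<Oplus>\<^bsub>S\<^esub>i\<in>{..k}. (S.dpow u i \<otimes>\<^bsub>S\<^esub> S.dpow t (k - i)) \<otimes>\<^bsub>S\<^esub> j ((D ^^ k) p))"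
      using p t u by (intro S.finsum_cong') (auto simp: S.m_assoc)
    also have "\<dots> = S.dpow (u \<oplus>\<^bsub>S\<^esub> t) k \<otimes>\<^bsub>S\<^esub> j ((D ^^ k) p)"
      using p t u by (subst S.finsum_ldistr[symmetric]) (auto simp: S.dpow_add)
    finally show "(\<Oplus>\<^bsub>S\<^esub>i\<in>{..k}. ?c i (k - i)) = S.dpow (u \<oplus>\<^bsub>S\<^esub> t) k \<otimes>\<^bsub>S\<^esub> j ((D ^^ k) p)" .
  qed (use p t u in auto)
  also have "\<dots> = Exp (u \<oplus>\<^bsub>S\<^esub> t) p"
    using p t u N by (intro Exp_eq[symmetric]) auto
  finally show ?thesis .
qed

text \<open>The index set of \<open>exp_sum\<close> depends on \<open>p\<close> and \<open>D\<close>
  only, so \<open>F\<close> can be applied term by term; the base map becomes its composite with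
  \<open>F\<close>.\<close>

lemma hom_Exp:
  assumes T: "rat_cring T \<zeta>" and F: "F \<in> ring_hom S T" and \<zeta>: "\<And>r. F (\<eta> r) = \<zeta> r"
    and t: "t \<in> carrier S" and p: "p \<in> carrier P"
  shows "F (Exp t p) = exp_sum P D T \<zeta> (\<lambda>x. F (j x)) (F t) p"
proof -
  interpret T: rat_cring T \<zeta> by (rule T)
  interpret F: ring_hom_cring S T F by unfold_locales (rule F)
  show ?thesis
    unfolding exp_sum_def S.dpow_def T.dpow_def using p t
    by (subst F.hom_finsum) (auto intro!: T.finsum_cong' simp: \<zeta> F.hom_pow)
qed

end

section \<open>The residue field\<close>

context primeideal
begin

abbreviation denoms where "denoms \<equiv> carrier R - I"
abbreviation fracs where "fracs \<equiv> carrier R \<times> denoms"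

lemma denoms_carrier [simp]: "s \<in> denoms \<Longrightarrow> s \<in> carrier R"
  by simp

lemma denoms_one: "\<one> \<in> denoms"
  using I_notcarr one_imp_carrier by auto

lemma denoms_mult: "s \<in> denoms \<Longrightarrow> t \<in> denoms \<Longrightarrow> s \<otimes> t \<in> denoms"
  using I_prime by auto

lemma fraction_rel_iff:
  "((a, s), (b, t)) \<in> fraction_rel R I \<longleftrightarrow> a \<in> carrier R \<and> b \<in> carrier R \<and> s \<in> denoms \<and> t \<in> denoms \<and>
    (\<exists>u\<in>denoms. u \<otimes> (a \<otimes> t) = u \<otimes> (b \<otimes> s))"
proof -
  have "u \<otimes> (a \<otimes> t \<ominus> b \<otimes> s) = \<zero> \<longleftrightarrow> u \<otimes> (a \<otimes> t) = u \<otimes> (b \<otimes> s)"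
    if "a \<in> carrier R" "b \<in> carrier R" "s \<in> carrier R" "t \<in> carrier R" "u \<in> carrier R" for u
  proof -
    have "u \<otimes> (a \<otimes> t \<ominus> b \<otimes> s) = u \<otimes> (a \<otimes> t) \<ominus> u \<otimes> (b \<otimes> s)"
      using that by (simp add: a_minus_def r_distr r_minus)
    then show ?thesis using that by simp
  qed
  then show ?thesis unfolding fraction_rel_def by auto
qed

lemma equiv_fraction_rel: "equiv fracs (fraction_rel R I)"
proof (rule equivI)
  show "fraction_rel R I \<subseteq> fracs \<times> fracs" by (auto simp: fraction_rel_iff)
  show "refl_on fracs (fraction_rel R I)"
    using denoms_one by (auto simp: refl_on_def fraction_rel_iff)
  show "sym (fraction_rel R I)"
  proof (rule symI, clarify)
    fix a s b t assume "((a, s), (b, t)) \<in> fraction_rel R I"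
    then show "((b, t), (a, s)) \<in> fraction_rel R I"
      unfolding fraction_rel_iff by metis
  qed
  show "trans (fraction_rel R I)"
  proof (rule transI, clarify)
    fix a s b t c v
    assume "((a, s), (b, t)) \<in> fraction_rel R I" "((b, t), (c, v)) \<in> fraction_rel R I"
    then obtain u w where c: "a \<in> carrier R" "b \<in> carrier R" "c \<in> carrier R"
      and d: "s \<in> denoms" "t \<in> denoms" "v \<in> denoms" "u \<in> denoms" "w \<in> denoms"
      and e: "u \<otimes> (a \<otimes> t) = u \<otimes> (b \<otimes> s)" "w \<otimes> (b \<otimes> v) = w \<otimes> (c \<otimes> t)"
      by (auto simp: fraction_rel_iff)
    note cl = c d[THEN denoms_carrier]
    \<comment> \<open>The witness for transitivity is the product of both given witnesses and the
      middle denominator \<open>t\<close>; the extra \<open>t\<close> makes the two relations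
      applicable in turn.\<close>
    have "(u \<otimes> w \<otimes> t) \<otimes> (a \<otimes> v) = (w \<otimes> v) \<otimes> (u \<otimes> (a \<otimes> t))"
      using cl by (simp add: m_ac)
    also have "\<dots> = (u \<otimes> s) \<otimes> (w \<otimes> (b \<otimes> v))" unfolding e(1) using cl by (simp add: m_ac)
    also have "\<dots> = (u \<otimes> w \<otimes> t) \<otimes> (c \<otimes> s)" unfolding e(2) using cl by (simp add: m_ac)
    finally show "((a, s), (c, v)) \<in> fraction_rel R I"
      using c d denoms_mult by (auto simp: fraction_rel_iff)
  qed
qed

abbreviation frac where "frac \<equiv> fraction R I"

lemma frac_eq_iff:
  assumes "a \<in> carrier R" "b \<in> carrier R" "s \<in> denoms" "t \<in> denoms"
  shows "frac a s = frac b t \<longleftrightarrow> (\<exists>u\<in>denoms. u \<otimes> (a \<otimes> t) = u \<otimes> (b \<otimes> s))"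
  unfolding fraction_def
  using assms by (subst eq_equiv_class_iff[OF equiv_fraction_rel]) (auto simp: fraction_rel_iff)

lemma frac_eqI:
  assumes "a \<in> carrier R" "b \<in> carrier R" "s \<in> denoms" "t \<in> denoms" "a \<otimes> t = b \<otimes> s"
  shows "frac a s = frac b t"
  using assms denoms_one by (subst frac_eq_iff) auto

lemma localization_carrier: "carrier (localization R I) = {frac a s | a s. a \<in> carrier R \<and> s \<in> denoms}"
  by (auto simp: localization_def fraction_def quotient_def)

lemma frac_closed [simp, intro]:
  "a \<in> carrier R \<Longrightarrow> s \<in> denoms \<Longrightarrow> frac a s \<in> carrier (localization R I)"
  by (auto simp: localization_carrier)

text \<open>When \<open>f\<close> does not depend on representatives, the union runs over copies of
  one set. It equals that set because the two classes are nonempty, by reflexivity.\<close>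

lemma localization_UN:
  assumes "a \<in> carrier R" "s \<in> denoms" "b \<in> carrier R" "t \<in> denoms"
    and "\<And>a' s' b' t'. ((a, s), (a', s')) \<in> fraction_rel R I \<Longrightarrow> ((b, t), (b', t')) \<in> fraction_rel R I \<Longrightarrow>
      f a' s' b' t' = f a s b t"
  shows "(\<Union>(a', s')\<in>frac a s. \<Union>(b', t')\<in>frac b t. f a' s' b' t') = f a s b t"
proof -
  have r: "((a, s), (a, s)) \<in> fraction_rel R I" "((b, t), (b, t)) \<in> fraction_rel R I"
    using assms(1-4) denoms_one by (auto simp: fraction_rel_iff)
  have "(\<Union>(a', s')\<in>frac a s. \<Union>(b', t')\<in>frac b t. f a' s' b' t') =
      (\<Union>x\<in>frac a s. \<Union>y\<in>frac b t. f a s b t)"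
    using assms(5) by (intro SUP_cong refl) (auto simp: fraction_def)
  also have "\<dots> = f a s b t"
    using r by (auto simp: fraction_def)
  finally show ?thesis .
qed

text \<open>Regroupings that expose the two equivalences of fractions inside one product. The first
  form serves products and the first summand of a sum; the crossed form serves the second
  summand.\<close>

lemma m_swap:
  assumes "u \<in> carrier R" "w \<in> carrier R" "p \<in> carrier R" "q \<in> carrier R" "x \<in> carrier R" "y \<in> carrier R"
  shows "(u \<otimes> w) \<otimes> ((p \<otimes> q) \<otimes> (x \<otimes> y)) = (u \<otimes> (p \<otimes> x)) \<otimes> (w \<otimes> (q \<otimes> y))"
    and "(u \<otimes> w) \<otimes> ((p \<otimes> q) \<otimes> (x \<otimes> y)) = (u \<otimes> (q \<otimes> x)) \<otimes> (w \<otimes> (p \<otimes> y))"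
proof -
  have swap: "(a \<otimes> b) \<otimes> (c \<otimes> d) = (a \<otimes> c) \<otimes> (b \<otimes> d)"
    if "a \<in> carrier R" "b \<in> carrier R" "c \<in> carrier R" "d \<in> carrier R" for a b c d
    using that by (simp add: m_ac)
  have 1: "(u \<otimes> w) \<otimes> ((p \<otimes> q) \<otimes> (x \<otimes> y)) = (u \<otimes> (p \<otimes> x)) \<otimes> (w \<otimes> (q \<otimes> y))"
    if "p \<in> carrier R" "q \<in> carrier R" for p q
    using that assms swap[of p q x y] swap[of u w "p \<otimes> x" "q \<otimes> y"] by simp
  show "(u \<otimes> w) \<otimes> ((p \<otimes> q) \<otimes> (x \<otimes> y)) = (u \<otimes> (p \<otimes> x)) \<otimes> (w \<otimes> (q \<otimes> y))"
    using assms by (intro 1)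
  show "(u \<otimes> w) \<otimes> ((p \<otimes> q) \<otimes> (x \<otimes> y)) = (u \<otimes> (q \<otimes> x)) \<otimes> (w \<otimes> (p \<otimes> y))"
    using 1[of q p] assms by (simp only: m_comm[of p q])
qed

lemma localization_mult:
  assumes "a \<in> carrier R" "s \<in> denoms" "b \<in> carrier R" "t \<in> denoms"
  shows "frac a s \<otimes>\<^bsub>localization R I\<^esub> frac b t = frac (a \<otimes> b) (s \<otimes> t)"
proof -
  have "frac (a' \<otimes> b') (s' \<otimes> t') = frac (a \<otimes> b) (s \<otimes> t)"
    if rel: "((a, s), (a', s')) \<in> fraction_rel R I" "((b, t), (b', t')) \<in> fraction_rel R I" for a' s' b' t'
  proof -
    obtain u w where c: "a' \<in> carrier R" "b' \<in> carrier R"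
      and d: "s' \<in> denoms" "t' \<in> denoms" "u \<in> denoms" "w \<in> denoms"
      and e: "u \<otimes> (a \<otimes> s') = u \<otimes> (a' \<otimes> s)" "w \<otimes> (b \<otimes> t') = w \<otimes> (b' \<otimes> t)"
      using rel by (auto simp: fraction_rel_iff)
    note cl = c assms(1,3) d[THEN denoms_carrier] assms(2,4)[THEN denoms_carrier]
    have "(u \<otimes> w) \<otimes> ((a' \<otimes> b') \<otimes> (s \<otimes> t)) = (u \<otimes> w) \<otimes> ((a \<otimes> b) \<otimes> (s' \<otimes> t'))"
      using cl e by (simp only: m_swap(1))
    then show ?thesis
      using assms c d denoms_mult by (subst frac_eq_iff) auto
  qed
  then show ?thesis
    unfolding localization_def using assms by (simp add: localization_UN[where f = "\<lambda>a s b t. frac (a \<otimes> b) (s \<otimes> t)"])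
qed

lemma localization_add:
  assumes "a \<in> carrier R" "s \<in> denoms" "b \<in> carrier R" "t \<in> denoms"
  shows "frac a s \<oplus>\<^bsub>localization R I\<^esub> frac b t = frac (a \<otimes> t \<oplus> b \<otimes> s) (s \<otimes> t)"
proof -
  have "frac (a' \<otimes> t' \<oplus> b' \<otimes> s') (s' \<otimes> t') = frac (a \<otimes> t \<oplus> b \<otimes> s) (s \<otimes> t)"
    if rel: "((a, s), (a', s')) \<in> fraction_rel R I" "((b, t), (b', t')) \<in> fraction_rel R I" for a' s' b' t'
  proof -
    obtain u w where c: "a' \<in> carrier R" "b' \<in> carrier R"
      and d: "s' \<in> denoms" "t' \<in> denoms" "u \<in> denoms" "w \<in> denoms"
      and e: "u \<otimes> (a \<otimes> s') = u \<otimes> (a' \<otimes> s)" "w \<otimes> (b \<otimes> t') = w \<otimes> (b' \<otimes> t)"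
      using rel by (auto simp: fraction_rel_iff)
    note cl = c assms(1,3) d[THEN denoms_carrier] assms(2,4)[THEN denoms_carrier]
    have 1: "(u \<otimes> w) \<otimes> ((a' \<otimes> t') \<otimes> (s \<otimes> t)) = (u \<otimes> w) \<otimes> ((a \<otimes> t) \<otimes> (s' \<otimes> t'))"
      using cl e(1) m_comm[of t t'] by (simp only: m_swap(1))
    have 2: "(u \<otimes> w) \<otimes> ((b' \<otimes> s') \<otimes> (s \<otimes> t)) = (u \<otimes> w) \<otimes> ((b \<otimes> s) \<otimes> (s' \<otimes> t'))"
      using cl e(2) m_comm[of s s'] by (simp only: m_swap(2))
    have distr: "(u \<otimes> w) \<otimes> ((p \<oplus> y) \<otimes> x) = (u \<otimes> w) \<otimes> (p \<otimes> x) \<oplus> (u \<otimes> w) \<otimes> (y \<otimes> x)"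
      if "p \<in> carrier R" "y \<in> carrier R" "x \<in> carrier R" for p x y
      using that cl by (simp only: m_closed l_distr r_distr)
    have "(u \<otimes> w) \<otimes> ((a' \<otimes> t' \<oplus> b' \<otimes> s') \<otimes> (s \<otimes> t))
        = (u \<otimes> w) \<otimes> ((a \<otimes> t \<oplus> b \<otimes> s) \<otimes> (s' \<otimes> t'))"
      using cl by (simp only: m_closed distr 1 2)
    then show ?thesis
      using assms c d denoms_mult by (subst frac_eq_iff) auto
  qed
  then show ?thesis
    unfolding localization_def using assms
    by (simp add: localization_UN[where f = "\<lambda>a s b t. frac (a \<otimes> t \<oplus> b \<otimes> s) (s \<otimes> t)"])
qed

lemma localization_one: "\<one>\<^bsub>localization R I\<^esub> = frac \<one> \<one>"
  and localization_zero: "\<zero>\<^bsub>localization R I\<^esub> = frac \<zero> \<one>"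
  by (simp_all add: localization_def)

lemma localization_cring: "cring (localization R I)"
proof -
  note sim = localization_mult localization_add localization_one localization_zero denoms_one denoms_mult
  show ?thesis
  proof (rule cringI)
    show "abelian_group (localization R I)"
    proof (rule abelian_groupI)
      fix x assume "x \<in> carrier (localization R I)"
      then obtain a s where x: "x = frac a s" "a \<in> carrier R" "s \<in> denoms"
        by (auto simp: localization_carrier)
      have "frac (\<ominus> a) s \<oplus>\<^bsub>localization R I\<^esub> x = \<zero>\<^bsub>localization R I\<^esub>"
        unfolding x(1) using x(2,3)
        by (simp add: sim del: Diff_iff) (rule frac_eqI, auto simp: denoms_one denoms_mult l_minus l_neg simp del: Diff_iff)
      then show "\<exists>y\<in>carrier (localization R I). y \<oplus>\<^bsub>localization R I\<^esub> x = \<zero>\<^bsub>localization R I\<^esub>"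
        using x by blast
    next
      fix x y z assume "x \<in> carrier (localization R I)" "y \<in> carrier (localization R I)" "z \<in> carrier (localization R I)"
      then obtain a s b t c v where x: "x = frac a s" "y = frac b t" "z = frac c v"
         "a \<in> carrier R" "b \<in> carrier R" "c \<in> carrier R" and d: "s \<in> denoms" "t \<in> denoms" "v \<in> denoms"
        by (auto simp: localization_carrier)
      note cl = d[THEN denoms_carrier]
      show "x \<oplus>\<^bsub>localization R I\<^esub> y \<oplus>\<^bsub>localization R I\<^esub> z = x \<oplus>\<^bsub>localization R I\<^esub> (y \<oplus>\<^bsub>localization R I\<^esub> z)"
        unfolding x(1-3) using x(4-) d cl by (simp add: sim l_distr r_distr m_ac a_ac del: Diff_iff)
    next
      fix x y assume "x \<in> carrier (localization R I)" "y \<in> carrier (localization R I)"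
      then obtain a s b t where x: "x = frac a s" "y = frac b t" 
         "a \<in> carrier R" "b \<in> carrier R" and d: "s \<in> denoms" "t \<in> denoms"
        by (auto simp: localization_carrier)
      note cl = d[THEN denoms_carrier]
      show "x \<oplus>\<^bsub>localization R I\<^esub> y = y \<oplus>\<^bsub>localization R I\<^esub> x"
        using x d cl by (simp add: sim m_ac a_ac del: Diff_iff)
      show "x \<oplus>\<^bsub>localization R I\<^esub> y \<in> carrier (localization R I)"
        using x d cl by (simp add: sim del: Diff_iff)
    next
      fix x assume "x \<in> carrier (localization R I)"
      then obtain a s where x: "x = frac a s" "a \<in> carrier R" "s \<in> denoms"
        by (auto simp: localization_carrier)
      then show "\<zero>\<^bsub>localization R I\<^esub> \<oplus>\<^bsub>localization R I\<^esub> x = x"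
        by (simp add: sim denoms_carrier del: Diff_iff)
    qed (simp add: localization_zero denoms_one del: Diff_iff)
    show "comm_monoid (localization R I)"
    proof (rule comm_monoidI)
      fix x y z assume "x \<in> carrier (localization R I)" "y \<in> carrier (localization R I)" "z \<in> carrier (localization R I)"
      then obtain a s b t c v where x: "x = frac a s" "y = frac b t" "z = frac c v"
         "a \<in> carrier R" "b \<in> carrier R" "c \<in> carrier R" and d: "s \<in> denoms" "t \<in> denoms" "v \<in> denoms"
        by (auto simp: localization_carrier)
      note cl = d[THEN denoms_carrier]
      show "x \<otimes>\<^bsub>localization R I\<^esub> y \<otimes>\<^bsub>localization R I\<^esub> z = x \<otimes>\<^bsub>localization R I\<^esub> (y \<otimes>\<^bsub>localization R I\<^esub> z)"
        using x d cl by (simp add: sim m_ac del: Diff_iff)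
    next
      fix x y assume "x \<in> carrier (localization R I)" "y \<in> carrier (localization R I)"
      then obtain a s b t where x: "x = frac a s" "y = frac b t" 
         "a \<in> carrier R" "b \<in> carrier R" and d: "s \<in> denoms" "t \<in> denoms"
        by (auto simp: localization_carrier)
      note cl = d[THEN denoms_carrier]
      show "x \<otimes>\<^bsub>localization R I\<^esub> y = y \<otimes>\<^bsub>localization R I\<^esub> x"
        using x d cl by (simp add: sim m_ac del: Diff_iff)
      show "x \<otimes>\<^bsub>localization R I\<^esub> y \<in> carrier (localization R I)"
        using x d cl by (simp add: sim del: Diff_iff)
    next
      fix x assume "x \<in> carrier (localization R I)"
      then obtain a s where x: "x = frac a s" "a \<in> carrier R" "s \<in> denoms"
        by (auto simp: localization_carrier)
      then show "\<one>\<^bsub>localization R I\<^esub> \<otimes>\<^bsub>localization R I\<^esub> x = x"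
        by (simp add: sim denoms_carrier del: Diff_iff)
    qed (simp add: localization_one denoms_one del: Diff_iff)
    fix x y z assume "x \<in> carrier (localization R I)" "y \<in> carrier (localization R I)" "z \<in> carrier (localization R I)"
    then obtain a s b t c v where x: "x = frac a s" "y = frac b t" "z = frac c v"
       "a \<in> carrier R" "b \<in> carrier R" "c \<in> carrier R" and d: "s \<in> denoms" "t \<in> denoms" "v \<in> denoms"
      by (auto simp: localization_carrier)
    note cl = d[THEN denoms_carrier]
    show "(x \<oplus>\<^bsub>localization R I\<^esub> y) \<otimes>\<^bsub>localization R I\<^esub> z =
        x \<otimes>\<^bsub>localization R I\<^esub> z \<oplus>\<^bsub>localization R I\<^esub> y \<otimes>\<^bsub>localization R I\<^esub> z"
      unfolding x(1-3) using x(4-) d cl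
      by (simp add: sim del: Diff_iff) (rule frac_eqI, simp_all add: denoms_mult l_distr r_distr m_ac del: Diff_iff)
  qed
qed

section \<open>The maximal ideal and the residue map\<close>

lemma fraction_ring_hom: "(\<lambda>a. frac a \<one>) \<in> ring_hom R (localization R I)"
  using denoms_one
  by (intro ring_hom_memI) (simp_all add: localization_mult localization_add localization_one del: Diff_iff)

lemma localization_max_ideal_ideal: "ideal (localization_max_ideal R I) (localization R I)"
proof -
  interpret L: cring "localization R I" by (rule localization_cring)
  have mem: "frac a s \<in> localization_max_ideal R I" if "a \<in> I" "s \<in> denoms" for a s
    using that by (auto simp: localization_max_ideal_def)
  \<comment> \<open>Absorption is isolated first, since closure under negation is derived from it
    below as multiplication by -1.\<close>
  have mult: "y \<otimes>\<^bsub>localization R I\<^esub> x \<in> localization_max_ideal R I"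
    if xy: "x \<in> localization_max_ideal R I" "y \<in> carrier (localization R I)" for x y
  proof -
    obtain a s where "x = frac a s" "a \<in> I" "s \<in> denoms"
      using xy(1) unfolding localization_max_ideal_def by blast
    moreover obtain b t where "y = frac b t" "b \<in> carrier R" "t \<in> denoms"
      using xy(2) unfolding localization_carrier by blast
    ultimately show ?thesis
      by (simp add: localization_mult mem denoms_mult I_l_closed del: Diff_iff)
  qed
  have sub: "localization_max_ideal R I \<subseteq> carrier (localization R I)"
    by (auto simp: localization_max_ideal_def)
  show ?thesis
  proof (rule idealI[OF L.ring_axioms])
    show "subgroup (localization_max_ideal R I) (add_monoid (localization R I))"
    proof (rule L.add.subgroupI)
      show "localization_max_ideal R I \<noteq> {}"
        using mem[of \<zero> \<one>] denoms_one by auto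
      fix x y assume x: "x \<in> localization_max_ideal R I" and "y \<in> localization_max_ideal R I"
      then obtain a s b t where xy: "x = frac a s" "y = frac b t" "a \<in> I" "b \<in> I" "s \<in> denoms" "t \<in> denoms"
        by (auto simp: localization_max_ideal_def)
      then show "x \<oplus>\<^bsub>localization R I\<^esub> y \<in> localization_max_ideal R I"
        by (simp add: localization_add mem denoms_mult I_r_closed del: Diff_iff)
      show "\<ominus>\<^bsub>localization R I\<^esub> x \<in> localization_max_ideal R I"
        using mult[OF x, of "\<ominus>\<^bsub>localization R I\<^esub> \<one>\<^bsub>localization R I\<^esub>"] x sub
        by (auto simp: L.l_minus)
    qed (rule sub)
  next
    fix x y assume x: "x \<in> localization_max_ideal R I" "y \<in> carrier (localization R I)"
    then show "y \<otimes>\<^bsub>localization R I\<^esub> x \<in> localization_max_ideal R I" by (rule mult)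
    moreover have "x \<in> carrier (localization R I)" using x sub by blast
    ultimately show "x \<otimes>\<^bsub>localization R I\<^esub> y \<in> localization_max_ideal R I"
      using x by (simp add: L.m_comm)
  qed
qed

lemma residue_field_cring: "cring (residue_field R I)"
  unfolding residue_field_def
  by (rule ideal.quotient_is_cring[OF localization_max_ideal_ideal localization_cring])

lemma residue_map_ring_hom: "residue_map R I \<in> ring_hom R (residue_field R I)"
  using ring_hom_trans[OF fraction_ring_hom ideal.rcos_ring_hom[OF localization_max_ideal_ideal]]
  unfolding residue_field_def residue_map_def comp_def .

text \<open>The inverse is the residue class of the fraction \<open>1/c\<close>, which exists
  because \<open>c\<close> lies outside the prime ideal.\<close>

lemma residue_map_unit:
  assumes "c \<in> denoms" shows "residue_map R I c \<in> Units (residue_field R I)"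
proof -
  interpret K: cring "residue_field R I" by (rule residue_field_cring)
  let ?M = "localization_max_ideal R I" and ?L = "localization R I"
  have hom: "(+>\<^bsub>?L\<^esub>) ?M \<in> ring_hom ?L (residue_field R I)"
    unfolding residue_field_def by (rule ideal.rcos_ring_hom[OF localization_max_ideal_ideal])
  have "frac c \<one> \<otimes>\<^bsub>?L\<^esub> frac \<one> c = \<one>\<^bsub>?L\<^esub>"
    using assms denoms_one
    by (simp add: localization_mult localization_one del: Diff_iff)
       (rule frac_eqI, simp_all del: Diff_iff)
  then have "residue_map R I c \<otimes>\<^bsub>residue_field R I\<^esub> (?M +>\<^bsub>?L\<^esub> frac \<one> c) = \<one>\<^bsub>residue_field R I\<^esub>"
    using ring_hom_mult[OF hom, of "frac c \<one>" "frac \<one> c"] ring_hom_one[OF hom] assms denoms_one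
    unfolding residue_map_def by simp
  then show ?thesis
    using ring_hom_closed[OF residue_map_ring_hom, of c] ring_hom_closed[OF hom, of "frac \<one> c"] assms
      K.m_comm[of "residue_map R I c" "?M +>\<^bsub>?L\<^esub> frac \<one> c"]
    unfolding Units_def by force
qed

text \<open>If 1 = a/s with \<open>a\<close> in the prime ideal, then u s = u a for some denominator
  \<open>u\<close>. This puts the product of the denominators \<open>u\<close> and \<open>s\<close>
  into the ideal, against primality. Nontriviality is used later to see that a transposition of
  variables has degree one.\<close>

lemma residue_field_nontrivial: "\<one>\<^bsub>residue_field R I\<^esub> \<noteq> \<zero>\<^bsub>residue_field R I\<^esub>"
proof
  interpret L: cring "localization R I" by (rule localization_cring)
  interpret M: ideal "localization_max_ideal R I" "localization R I" by (rule localization_max_ideal_ideal)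
  assume "\<one>\<^bsub>residue_field R I\<^esub> = \<zero>\<^bsub>residue_field R I\<^esub>"
  then have "\<one>\<^bsub>localization R I\<^esub> \<in> localization_max_ideal R I"
    unfolding residue_field_def FactRing_def using M.a_rcos_self by fastforce
  then obtain a s where as: "a \<in> I" "s \<in> denoms" "frac \<one> \<one> = frac a s"
    by (auto simp: localization_max_ideal_def localization_one)
  then obtain u where u: "u \<in> denoms" "u \<otimes> (\<one> \<otimes> s) = u \<otimes> (a \<otimes> \<one>)"
    using denoms_one by (subst (asm) frac_eq_iff) auto
  then have "u \<otimes> s \<in> I" using as I_l_closed by auto
  then show False using denoms_mult[OF u(1) as(2)] by simp
qed

end

section \<open>Rational structures on the rings involved\<close>

lemma rat_cring_hom:
  assumes "rat_cring R \<theta>" "F \<in> ring_hom R S" "cring S"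
  shows "rat_cring S (\<lambda>r. F (\<theta> r))"
proof -
  have "F \<circ> \<theta> \<in> ring_hom rat_field S"
    using assms(1,2) by (intro ring_hom_trans) (auto simp: rat_cring_def rat_cring_axioms_def)
  then show ?thesis
    using assms(3) by (simp add: rat_cring_def rat_cring_axioms_def comp_def)
qed

lemma algebra_rat_cring:
  assumes "algebra rat_field R" shows "rat_cring R (\<lambda>r. r \<odot>\<^bsub>R\<^esub> \<one>\<^bsub>R\<^esub>)"
proof -
  interpret A: algebra rat_field R by (rule assms)
  have [simp]: "carrier (rat_field :: rat ring) = UNIV" "monoid.mult (rat_field :: rat ring) = (*)"
     "add (rat_field :: rat ring) = (+)" "one (rat_field :: rat ring) = 1"
    by (simp_all add: ring_of_type_algebra_def fun_eq_iff)
  show ?thesis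
  proof unfold_locales
    show "(\<lambda>r. r \<odot>\<^bsub>R\<^esub> \<one>\<^bsub>R\<^esub>) \<in> ring_hom rat_field R"
    proof (rule ring_hom_memI)
      fix r s :: rat
      show "(r \<otimes>\<^bsub>rat_field\<^esub> s) \<odot>\<^bsub>R\<^esub> \<one>\<^bsub>R\<^esub> = (r \<odot>\<^bsub>R\<^esub> \<one>\<^bsub>R\<^esub>) \<otimes>\<^bsub>R\<^esub> (s \<odot>\<^bsub>R\<^esub> \<one>\<^bsub>R\<^esub>)"
        using A.smult_assoc1[of r s "\<one>\<^bsub>R\<^esub>"] A.smult_assoc2[of r "\<one>\<^bsub>R\<^esub>" "s \<odot>\<^bsub>R\<^esub> \<one>\<^bsub>R\<^esub>"]
          A.smult_closed[of s "\<one>\<^bsub>R\<^esub>"]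
        by simp
    qed (use A.smult_closed A.smult_l_distr A.smult_one[of "\<one>\<^bsub>R\<^esub>"] in auto)
  qed
qed

section \<open>Subrings in the first variables and elementary automorphisms\<close>

context cring
begin

text \<open>The operations recorded in \<open>mpoly_ring R n\<close> do not depend on
  \<open>n\<close>; only the carrier does. Closure for \<open>k\<close> is therefore closure in the
  smaller ring.\<close>

lemma mpolys_add_closed: "p \<in> mpolys k \<Longrightarrow> q \<in> mpolys k \<Longrightarrow> p \<oplus>\<^bsub>mpoly_ring R n\<^esub> q \<in> mpolys k"
  and mpolys_mult_closed: "p \<in> mpolys k \<Longrightarrow> q \<in> mpolys k \<Longrightarrow> p \<otimes>\<^bsub>mpoly_ring R n\<^esub> q \<in> mpolys k"
  and mpolys_zero_closed: "\<zero>\<^bsub>mpoly_ring R n\<^esub> \<in> mpolys k"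
  and mpolys_one_closed: "\<one>\<^bsub>mpoly_ring R n\<^esub> \<in> mpolys k"
  by (simp_all add: mpoly_ring_simps)

text \<open>The additive inverse is defined through the carrier and so does refer to
  \<open>n\<close>. Writing it as a product with the constant -1 reduces it to the preceding closure
  rules.\<close>

lemma mpolys_a_inv_closed:
  assumes "p \<in> mpolys k" "k \<le> n" shows "\<ominus>\<^bsub>mpoly_ring R n\<^esub> p \<in> mpolys k"
proof -
  interpret P: cring "mpoly_ring R n" by (rule mpoly_cring)
  have "p \<in> mpolys n" using assms mpolys_mono by blast
  then have "\<ominus>\<^bsub>mpoly_ring R n\<^esub> p = (\<ominus>\<^bsub>mpoly_ring R n\<^esub> \<one>\<^bsub>mpoly_ring R n\<^esub>) \<otimes>\<^bsub>mpoly_ring R n\<^esub> p"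
    by (simp add: P.l_minus)
  moreover have "\<ominus>\<^bsub>mpoly_ring R n\<^esub> \<one>\<^bsub>mpoly_ring R n\<^esub> = indexed_const (\<ominus> \<one>)"
    by (rule P.minus_equality) (simp_all add: mpoly_ring_simps indexed_padd_const l_neg)
  ultimately show ?thesis using assms by (simp add: mpolys_mult_closed)
qed

lemma mpolys_pow_closed:
  fixes l :: nat
  assumes "p \<in> mpolys k" shows "p [^]\<^bsub>mpoly_ring R n\<^esub> l \<in> mpolys k"
proof -
  interpret P: cring "mpoly_ring R n" by (rule mpoly_cring)
  show ?thesis
    by (induction l) (simp_all add: mpolys_one_closed mpolys_mult_closed assms)
qed

lemma mpolys_finsum_closed:
  assumes "finite A" "f \<in> A \<rightarrow> mpolys k" "k \<le> n"
  shows "(\<Oplus>\<^bsub>mpoly_ring R n\<^esub>i\<in>A. f i) \<in> mpolys k"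
proof -
  interpret P: cring "mpoly_ring R n" by (rule mpoly_cring)
  have "f \<in> A \<rightarrow> mpolys n" using assms mpolys_mono by blast
  with assms show ?thesis
    by (induction A rule: finite_induct)
       (simp_all add: mpolys_zero_closed mpolys_add_closed Pi_def)
qed

lemma id_ring_hom: "(\<lambda>p. p) \<in> ring_hom (mpoly_ring R n) (mpoly_ring R n)"
  by (rule ring_hom_memI) auto

text \<open>The inverse subtracts \<open>e\<close>: as \<open>e\<close> involves only variables that
  the substitution fixes, it is fixed as well.\<close>

lemma elementary_triangular:
  assumes n: "n \<ge> 1" and e: "e \<in> mpolys (n - 1)"
  shows "mpoly_subst R n (\<lambda>i. if i = n then mpoly_var R n \<oplus>\<^bsub>mpoly_ring R n\<^esub> e else mpoly_var R i)
    \<in> triangular_automorphisms R n"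
proof -
  interpret P: cring "mpoly_ring R n" by (rule mpoly_cring)
  let ?g = "\<lambda>e i. if i = n then mpoly_var R n \<oplus>\<^bsub>mpoly_ring R n\<^esub> e else mpoly_var R i"
  let ?e' = "\<ominus>\<^bsub>mpoly_ring R n\<^esub> e"
  have sub: "mpolys (n - 1) \<subseteq> mpolys n" by (intro mpolys_mono) simp
  have e': "?e' \<in> mpolys (n - 1)" using e by (simp add: mpolys_a_inv_closed)
  have nn: "n \<in> {1..n}" using n by simp
  have g: "?g d \<in> {1..n} \<rightarrow> mpolys n" if "d \<in> mpolys (n - 1)" for d
    using that sub nn by (auto intro!: mpolys_var mpolys_add_closed)
  have id_on: "mpoly_subst R n (?g d) q = q" if d: "d \<in> mpolys (n - 1)" and q: "q \<in> mpolys (n - 1)" for d q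
  proof (rule mpoly_hom_eqI[OF mpoly_subst_ring_hom[OF g[OF d]] id_ring_hom _ q])
    fix i assume "i \<in> {1..n - 1}"
    then show "mpoly_subst R n (?g d) (mpoly_var R i) = mpoly_var R i"
      using mpoly_subst_var[OF g[OF d], of i] by auto
  qed (simp_all add: mpoly_subst_const[OF g[OF d]])
  \<comment> \<open>Stated for any \<open>d\<close> and \<open>d'\<close> with sum zero, so that it
    yields both orders of composition.\<close>
  have inv: "mpoly_subst R n (?g d) (?g d' i) = mpoly_var R i"
    if "d \<in> mpolys (n - 1)" "d' \<in> mpolys (n - 1)" "d \<oplus>\<^bsub>mpoly_ring R n\<^esub> d' = \<zero>\<^bsub>mpoly_ring R n\<^esub>" "i \<in> {1..n}"
    for d d' i
  proof (cases "i = n")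
    case True
    have dd: "d \<in> mpolys n" "d' \<in> mpolys n" using that sub by auto
    have "mpoly_subst R n (?g d) (?g d' n)
        = (mpoly_var R n \<oplus>\<^bsub>mpoly_ring R n\<^esub> d) \<oplus>\<^bsub>mpoly_ring R n\<^esub> d'"
      using ring_hom_add[OF mpoly_subst_ring_hom[OF g[OF that(1)]], of "mpoly_var R n" d'] dd
        mpolys_var[OF nn] mpoly_subst_var[OF g[OF that(1)] nn] id_on[OF that(1,2)] by simp
    also have "\<dots> = mpoly_var R n"
      using dd mpolys_var[OF nn] that(3) by (simp add: P.a_assoc)
    finally show ?thesis using True by simp
  next
    case False
    then show ?thesis using mpoly_subst_var[OF g[OF that(1)] that(4)] by simp
  qed
  have en: "e \<in> mpolys n" using e sub by blast
  have "mpoly_subst R n (?g e) \<in> carrier (GA R n)"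
    using inv[OF e e'] inv[OF e' e] en
    by (intro mpoly_subst_GA[OF g[OF e] g[OF e']]) (simp_all add: P.r_neg P.l_neg)
  moreover have "\<exists>u\<in>Units R. \<exists>d\<in>mpolys (i - 1).
      mpoly_subst R n (?g e) (mpoly_var R i) = u \<odot>\<^bsub>mpoly_ring R n\<^esub> mpoly_var R i \<oplus>\<^bsub>mpoly_ring R n\<^esub> d"
    if i: "i \<in> {1..n}" for i
  proof (intro bexI)
    show "mpoly_subst R n (?g e) (mpoly_var R i) = \<one> \<odot>\<^bsub>mpoly_ring R n\<^esub> mpoly_var R i
        \<oplus>\<^bsub>mpoly_ring R n\<^esub> (if i = n then e else \<zero>\<^bsub>mpoly_ring R n\<^esub>)"
      using mpoly_subst_var[OF g[OF e] i] mpolys_var[OF i] ring_hom_one[OF const_ring_hom, of n]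
      by (simp add: smult_mpoly_eq)
  qed (use e in \<open>auto simp: mpolys_zero_closed\<close>)
  ultimately show ?thesis
    by (simp add: triangular_automorphisms_def)
qed

end

context derivation_exp
begin

text \<open>Separating the term of order zero leaves a remainder built from \<open>D p\<close> and
  its iterates, which for a triangular derivation and a variable lie in a smaller polynomial
  ring.\<close>

lemma Exp_split:
  assumes "p \<in> carrier P" "t \<in> carrier S"
  obtains N where "Exp t p = j p \<oplus>\<^bsub>S\<^esub> (\<Oplus>\<^bsub>S\<^esub>l\<in>{..N}. S.dpow t (Suc l) \<otimes>\<^bsub>S\<^esub> j ((D ^^ Suc l) p))"
proof -
  obtain N where N: "(D ^^ N) p = \<zero>" using D_nilpotent assms by blast
  then have "(D ^^ Suc N) p = \<zero>" by (rule D_pow_vanish) simp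
  with assms have "Exp t p = (\<Oplus>\<^bsub>S\<^esub>l\<in>{..Suc N}. S.dpow t l \<otimes>\<^bsub>S\<^esub> j ((D ^^ l) p))"
    by (intro Exp_eq)
  also have "\<dots> = j p \<oplus>\<^bsub>S\<^esub> (\<Oplus>\<^bsub>S\<^esub>l\<in>{..N}. S.dpow t (Suc l) \<otimes>\<^bsub>S\<^esub> j ((D ^^ Suc l) p))"
    using assms by (subst S.finsum_Suc2) (auto simp: S.a_comm Pi_def simp del: S.finsum_Suc funpow.simps)
  finally show ?thesis by (rule that)
qed

lemma exp_sum_cong:
  assumes "p \<in> carrier P" "t \<in> carrier S" "\<And>q. q \<in> carrier P \<Longrightarrow> j' q = j q"
  shows "exp_sum P D S \<eta> j' t p = Exp t p"
  unfolding exp_sum_def using assms by (intro S.finsum_cong') auto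

end

section \<open>Triangular derivations\<close>

context cring
begin

lemma derivation_const:
  assumes \<delta>: "mpoly_derivation R n \<delta>" and a: "a \<in> carrier R"
  shows "\<delta> (indexed_const a) = \<zero>\<^bsub>mpoly_ring R n\<^esub>"
proof -
  interpret P: cring "mpoly_ring R n" by (rule mpoly_cring)
  let ?o = "\<one>\<^bsub>mpoly_ring R n\<^esub>"
  have c: "\<delta> ?o \<in> mpolys n" and m: "\<delta> (?o \<otimes>\<^bsub>mpoly_ring R n\<^esub> ?o)
      = (\<delta> ?o \<otimes>\<^bsub>mpoly_ring R n\<^esub> ?o) \<oplus>\<^bsub>mpoly_ring R n\<^esub> (?o \<otimes>\<^bsub>mpoly_ring R n\<^esub> \<delta> ?o)"
    using \<delta> P.one_closed unfolding mpoly_derivation_def Let_def by blast+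
  then have z: "\<delta> ?o = \<zero>\<^bsub>mpoly_ring R n\<^esub>"
    using P.add.r_cancel_one'[of "\<delta> ?o" "\<delta> ?o"] by simp
  have "\<delta> (a \<odot>\<^bsub>mpoly_ring R n\<^esub> ?o) = a \<odot>\<^bsub>mpoly_ring R n\<^esub> \<delta> ?o"
    using \<delta> a P.one_closed unfolding mpoly_derivation_def Let_def by blast
  then show ?thesis
    using a z by (simp add: smult_mpoly_eq)
qed

end

lemma (in rat_cring) rat_derivation_mpoly:
  assumes \<delta>: "mpoly_derivation R n \<delta>"
  shows "rat_derivation (mpoly_ring R n) (\<lambda>r. indexed_const (\<theta> r)) \<delta>"
proof -
  interpret P: cring "mpoly_ring R n" by (rule mpoly_cring)
  have "rat_cring (mpoly_ring R n) (\<lambda>r. indexed_const (\<theta> r))"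
    by (rule rat_cring_hom[OF _ const_ring_hom mpoly_cring]) unfold_locales
  then show ?thesis
  proof (rule rat_derivation.intro, unfold_locales)
    fix p r assume p: "p \<in> mpolys n"
    then have "\<delta> (\<theta> r \<odot>\<^bsub>mpoly_ring R n\<^esub> p) = \<theta> r \<odot>\<^bsub>mpoly_ring R n\<^esub> \<delta> p"
      and "\<delta> p \<in> mpolys n"
      using \<delta> theta_closed unfolding mpoly_derivation_def Let_def by blast+
    with p show "\<delta> (indexed_const (\<theta> r) \<otimes>\<^bsub>mpoly_ring R n\<^esub> p)
        = indexed_const (\<theta> r) \<otimes>\<^bsub>mpoly_ring R n\<^esub> \<delta> p"
      by (simp add: smult_mpoly_eq)
  qed (use \<delta> in \<open>auto simp: mpoly_derivation_def Let_def\<close>)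
qed

text \<open>The elements whose derivative stays in the subring are closed under sums and products by
  the product rule, and triangularity puts the variables among them.\<close>

lemma (in cring) triangular_derivation_closed:
  assumes \<delta>: "triangular_derivation R n \<delta>" and k: "k \<le> n" and p: "p \<in> mpolys k"
  shows "\<delta> p \<in> mpolys k"
proof -
  have \<delta>': "mpoly_derivation R n \<delta>" using \<delta> by (simp add: triangular_derivation_def)
  have sub: "mpolys k \<subseteq> mpolys n" using k by (rule mpolys_mono)
  have "p \<in> {p \<in> mpolys k. \<delta> p \<in> mpolys k}"
  proof (rule mpoly_hom_closed[OF id_ring_hom k p])
    fix a assume "a \<in> carrier R"
    then show "indexed_const a \<in> {p \<in> mpolys k. \<delta> p \<in> mpolys k}"
      using derivation_const[OF \<delta>'] by (simp add: mpolys_zero_closed)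
  next
    fix i assume i: "i \<in> {1..k}"
    then have "\<delta> (mpoly_var R i) \<in> mpolys (i - 1)"
      using \<delta> k by (auto simp: triangular_derivation_def)
    moreover have "mpolys (i - 1) \<subseteq> mpolys k" using i by (intro mpolys_mono) auto
    ultimately show "mpoly_var R i \<in> {p \<in> mpolys k. \<delta> p \<in> mpolys k}"
      using i by (auto intro!: mpolys_var)
  next
    fix p q assume pq: "p \<in> {p \<in> mpolys k. \<delta> p \<in> mpolys k}" "q \<in> {p \<in> mpolys k. \<delta> p \<in> mpolys k}"
    then have "p \<in> mpolys n" "q \<in> mpolys n" using sub by auto
    then have "\<delta> (p \<oplus>\<^bsub>mpoly_ring R n\<^esub> q) = \<delta> p \<oplus>\<^bsub>mpoly_ring R n\<^esub> \<delta> q"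
      "\<delta> (p \<otimes>\<^bsub>mpoly_ring R n\<^esub> q) = (\<delta> p \<otimes>\<^bsub>mpoly_ring R n\<^esub> q) \<oplus>\<^bsub>mpoly_ring R n\<^esub> (p \<otimes>\<^bsub>mpoly_ring R n\<^esub> \<delta> q)"
      using \<delta>' unfolding mpoly_derivation_def Let_def by blast+
    with pq show "p \<oplus>\<^bsub>mpoly_ring R n\<^esub> q \<in> {p \<in> mpolys k. \<delta> p \<in> mpolys k}"
      "p \<otimes>\<^bsub>mpoly_ring R n\<^esub> q \<in> {p \<in> mpolys k. \<delta> p \<in> mpolys k}"
      by (simp_all add: mpolys_add_closed mpolys_mult_closed)
  qed
  then show ?thesis by simp
qed

text \<open>Strong induction on the number of variables: the derivative of \<open>x\<^sub>i\<close>
  involves fewer variables and is killed by some power. The elements killed by some power are closed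
  under sums and products.\<close>

lemma (in rat_cring) triangular_derivation_nilpotent:
  assumes \<delta>: "triangular_derivation R n \<delta>" and k: "k \<le> n" and p: "p \<in> mpolys k"
  shows "\<exists>N. (\<delta> ^^ N) p = \<zero>\<^bsub>mpoly_ring R n\<^esub>"
  using k p
proof (induction k arbitrary: p rule: less_induct)
  case (less k)
  have \<delta>': "mpoly_derivation R n \<delta>" using \<delta> by (simp add: triangular_derivation_def)
  interpret D: rat_derivation "mpoly_ring R n" "\<lambda>r. indexed_const (\<theta> r)" \<delta>
    by (rule rat_derivation_mpoly[OF \<delta>'])
  have step: "\<exists>N. (\<delta> ^^ N) p = \<zero>\<^bsub>mpoly_ring R n\<^esub>" if "\<exists>N. (\<delta> ^^ N) (\<delta> p) = \<zero>\<^bsub>mpoly_ring R n\<^esub>" for p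
    using that by (metis comp_apply funpow_Suc_right)
  have "p \<in> {p \<in> mpolys n. \<exists>N. (\<delta> ^^ N) p = \<zero>\<^bsub>mpoly_ring R n\<^esub>}"
  proof (rule mpoly_hom_closed[OF id_ring_hom less.prems])
    fix a assume "a \<in> carrier R"
    then have "indexed_const a \<in> mpolys n" "(\<delta> ^^ 1) (indexed_const a) = \<zero>\<^bsub>mpoly_ring R n\<^esub>"
      using derivation_const[OF \<delta>'] by simp_all
    then show "indexed_const a \<in> {p \<in> mpolys n. \<exists>N. (\<delta> ^^ N) p = \<zero>\<^bsub>mpoly_ring R n\<^esub>}"
      by blast
  next
    fix i assume i: "i \<in> {1..k}"
    then have "\<delta> (mpoly_var R i) \<in> mpolys (i - 1)"
      using \<delta> less.prems by (auto simp: triangular_derivation_def)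
    then have "\<exists>N. (\<delta> ^^ N) (\<delta> (mpoly_var R i)) = \<zero>\<^bsub>mpoly_ring R n\<^esub>"
      using i less.prems by (intro less.IH[of "i - 1"]) auto
    from step[OF this] show "mpoly_var R i \<in> {p \<in> mpolys n. \<exists>N. (\<delta> ^^ N) p = \<zero>\<^bsub>mpoly_ring R n\<^esub>}"
      using i less.prems by (auto intro!: mpolys_var)
  qed (use D.D_nilpotent_add D.D_nilpotent_mult in \<open>simp_all add: mpolys_add_closed mpolys_mult_closed\<close>)
  then show ?case by simp
qed

lemma (in rat_cring) nilpotent_rat_derivation_mpoly:
  assumes "triangular_derivation R n \<delta>"
  shows "nilpotent_rat_derivation (mpoly_ring R n) (\<lambda>r. indexed_const (\<theta> r)) \<delta>"
  using assms triangular_derivation_nilpotent[OF assms order_refl] rat_derivation_mpoly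
  by (simp add: nilpotent_rat_derivation_def nilpotent_rat_derivation_axioms_def triangular_derivation_def)

section \<open>Straightening the exponential\<close>

text \<open>Only iterates of order at least one enter the correction \<open>g\<close>. They lie in
  the first \<open>i - 1\<close> variables, as does \<open>t\<close>, so the whole remainder
  does.\<close>

lemma exp_sum_var_triangular:
  assumes E: "derivation_exp (mpoly_ring R n) \<theta> \<delta> (mpoly_ring K n) (\<lambda>r. mpoly_const K (\<eta> r)) j"
    and R: "cring R" and K: "cring K" and \<eta>: "\<And>r. \<eta> r \<in> carrier K"
    and \<delta>: "triangular_derivation R n \<delta>" and i: "i \<in> {1..n}"
    and t: "t \<in> carrier (mpoly_ring K (i - 1))"
    and j: "\<And>p. p \<in> carrier (mpoly_ring R (i - 1)) \<Longrightarrow> j p \<in> carrier (mpoly_ring K (i - 1))"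
  shows "\<exists>g\<in>carrier (mpoly_ring K (i - 1)).
    exp_sum (mpoly_ring R n) \<delta> (mpoly_ring K n) (\<lambda>r. mpoly_const K (\<eta> r)) j t (mpoly_var R i)
    = j (mpoly_var R i) \<oplus>\<^bsub>mpoly_ring K n\<^esub> g"
proof -
  interpret derivation_exp "mpoly_ring R n" \<theta> \<delta> "mpoly_ring K n" "\<lambda>r. mpoly_const K (\<eta> r)" j by (rule E)
  interpret R: cring R by (rule R)
  interpret K: cring K by (rule K)
  have le: "i - 1 \<le> n" using i by auto
  have "t \<in> K.mpolys n" using t K.mpolys_mono[OF le] by blast
  then obtain N where N: "exp_sum (mpoly_ring R n) \<delta> (mpoly_ring K n) (\<lambda>r. mpoly_const K (\<eta> r)) j t (mpoly_var R i)
    = j (mpoly_var R i) \<oplus>\<^bsub>mpoly_ring K n\<^esub>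
      (\<Oplus>\<^bsub>mpoly_ring K n\<^esub>l\<in>{..N}. S.dpow t (Suc l) \<otimes>\<^bsub>mpoly_ring K n\<^esub> j ((\<delta> ^^ Suc l) (mpoly_var R i)))"
    using Exp_split[OF R.mpolys_var[OF i]] by blast
  have "(\<delta> ^^ Suc l) (mpoly_var R i) \<in> R.mpolys (i - 1)" for l
  proof (induction l)
    case 0 then show ?case using \<delta> i by (simp add: triangular_derivation_def)
  next
    case (Suc l) then show ?case using R.triangular_derivation_closed[OF \<delta> le] by simp
  qed
  then have "S.dpow t (Suc l) \<otimes>\<^bsub>mpoly_ring K n\<^esub> j ((\<delta> ^^ Suc l) (mpoly_var R i)) \<in> K.mpolys (i - 1)" for l
    unfolding S.dpow_def
    by (intro K.mpolys_mult_closed K.mpolys_pow_closed K.mpolys_const t j \<eta>)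
  then have "(\<Oplus>\<^bsub>mpoly_ring K n\<^esub>l\<in>{..N}. S.dpow t (Suc l) \<otimes>\<^bsub>mpoly_ring K n\<^esub> j ((\<delta> ^^ Suc l) (mpoly_var R i)))
      \<in> K.mpolys (i - 1)"
    using le by (intro K.mpolys_finsum_closed) auto
  with N show ?thesis by blast
qed

text \<open>The passage to the residue field is abstracted to a homomorphism into a nontrivial
  commutative ring that makes \<open>c\<close>, the constant with \<delta>(x_1) = c, a unit.\<close>

locale triangular_exp = ring_hom_cring R K \<iota>
  for R :: "(rat, 'a, 'm) module_scheme" (structure) and K :: "('c, 'd) ring_scheme" (structure) and \<iota> +
  fixes n :: nat and \<delta> and h and c
  assumes alg: "algebra rat_field R"
    and n: "n \<ge> 1"
    and \<delta>: "triangular_derivation R n \<delta>"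
    and h: "h \<in> carrier (mpoly_ring R n)" "\<delta> h = \<zero>\<^bsub>mpoly_ring R n\<^esub>"
    and c: "c \<in> carrier R" "\<delta> (mpoly_var R 1) = mpoly_const R c" "\<iota> c \<in> Units K"
    and K_nontrivial: "\<one>\<^bsub>K\<^esub> \<noteq> \<zero>\<^bsub>K\<^esub>"
begin

abbreviation "PR \<equiv> mpoly_ring R n"
abbreviation "PK \<equiv> mpoly_ring K n"
abbreviation "xR i \<equiv> mpoly_var R i"
abbreviation "xK i \<equiv> mpoly_var K i"
abbreviation "\<theta> r \<equiv> r \<odot>\<^bsub>R\<^esub> \<one>\<^bsub>R\<^esub>"
abbreviation "\<theta>P r \<equiv> mpoly_const R (\<theta> r)"
abbreviation "\<eta> r \<equiv> mpoly_const K (\<iota> (\<theta> r))"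
definition J :: "(nat multiset \<Rightarrow> 'a) \<Rightarrow> nat multiset \<Rightarrow> 'c" where "J = (\<circ>) \<iota>"
abbreviation "expo j t p \<equiv> exp_sum PR \<delta> PK \<eta> j t p"

sublocale PR: cring PR by (rule R.mpoly_cring)
sublocale PK: cring PK by (rule S.mpoly_cring)
sublocale QR: rat_cring R \<theta> by (rule algebra_rat_cring[OF alg])
sublocale QK: rat_cring PK \<eta>
proof -
  have "rat_cring K (\<lambda>r. \<iota> (\<theta> r))"
    by (rule rat_cring_hom[OF QR.rat_cring_axioms homh S.is_cring])
  then show "rat_cring PK \<eta>"
    by (rule rat_cring_hom[OF _ S.const_ring_hom PK.is_cring])
qed
sublocale D: nilpotent_rat_derivation PR \<theta>P \<delta>
  by (rule QR.nilpotent_rat_derivation_mpoly[OF \<delta>])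

text \<open>Any homomorphism extending \<open>\<iota>\<close> on constants respects the rational
  structure and can serve as base map. It is applied to \<open>J\<close>, to \<open>J\<close>
  followed by \<open>\<rho>\<close>, and to exponentials themselves.\<close>

lemma derivation_expI:
  assumes "j \<in> ring_hom PR PK" "\<And>a. a \<in> carrier R \<Longrightarrow> j (mpoly_const R a) = mpoly_const K (\<iota> a)"
  shows "derivation_exp PR \<theta>P \<delta> PK \<eta> j"
  using assms by unfold_locales auto

lemma J_const [simp]: "J (mpoly_const R a) = mpoly_const K (\<iota> a)"
  unfolding J_def by (rule comp_const)

lemma J_var [simp]: "J (xR i) = xK i"
  unfolding J_def by (rule comp_var)

sublocale E: derivation_exp PR \<theta>P \<delta> PK \<eta> J
  by (intro derivation_expI comp_ring_hom[folded J_def] J_const)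

lemma J_closed: "p \<in> R.mpolys k \<Longrightarrow> J p \<in> S.mpolys k"
  unfolding J_def by (rule comp_mpolys)

lemma one_in: "1 \<in> {1..n}" using n by simp

lemma xK_closed [simp]: "i \<in> {1..n} \<Longrightarrow> xK i \<in> carrier PK"
  by (rule S.mpolys_var)

lemma xR_closed [simp]: "i \<in> {1..n} \<Longrightarrow> xR i \<in> carrier PR"
  by (rule R.mpolys_var)

lemma derivation: "mpoly_derivation R n \<delta>"
  using \<delta> by (simp add: triangular_derivation_def)

lemma \<delta>_const [simp]: "a \<in> carrier R \<Longrightarrow> \<delta> (mpoly_const R a) = \<zero>\<^bsub>PR\<^esub>"
  by (rule R.derivation_const[OF derivation])

definition "s = mpoly_const K (inv\<^bsub>K\<^esub> \<iota> c) \<otimes>\<^bsub>PK\<^esub> xK 1"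

lemma s_closed: "k \<ge> 1 \<Longrightarrow> s \<in> S.mpolys k"
  unfolding s_def using c(3)
  by (intro S.mpolys_mult_closed S.mpolys_const S.mpolys_var) auto

lemma s_closed' [simp]: "s \<in> carrier PK"
  using n by (rule s_closed)

lemma ic_closed [simp]: "mpoly_const K (\<iota> c) \<in> carrier PK"
  using c(1) by simp

lemma inv_c [simp]: "mpoly_const K (inv\<^bsub>K\<^esub> \<iota> c) \<in> carrier PK"
  "mpoly_const K (inv\<^bsub>K\<^esub> \<iota> c) \<otimes>\<^bsub>PK\<^esub> mpoly_const K (\<iota> c) = \<one>\<^bsub>PK\<^esub>"
proof -
  have "mpoly_const K (inv\<^bsub>K\<^esub> \<iota> c) \<otimes>\<^bsub>PK\<^esub> mpoly_const K (\<iota> c) = mpoly_const K (inv\<^bsub>K\<^esub> \<iota> c \<otimes>\<^bsub>K\<^esub> \<iota> c)"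
    using c by (intro ring_hom_mult[OF S.const_ring_hom, symmetric]) auto
  then show "mpoly_const K (inv\<^bsub>K\<^esub> \<iota> c) \<otimes>\<^bsub>PK\<^esub> mpoly_const K (\<iota> c) = \<one>\<^bsub>PK\<^esub>"
    using c(3) ring_hom_one[OF S.const_ring_hom] by simp
qed (use c(3) in simp)

lemma s_c: "s \<otimes>\<^bsub>PK\<^esub> mpoly_const K (\<iota> c) = xK 1"
proof -
  have "s \<otimes>\<^bsub>PK\<^esub> mpoly_const K (\<iota> c)
      = (mpoly_const K (inv\<^bsub>K\<^esub> \<iota> c) \<otimes>\<^bsub>PK\<^esub> mpoly_const K (\<iota> c)) \<otimes>\<^bsub>PK\<^esub> xK 1"
    unfolding s_def using one_in by (simp add: PK.m_ac del: inv_c(2))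
  then show ?thesis using one_in by simp
qed

lemma hom_s:
  assumes "F \<in> ring_hom PK PK" "\<And>a. a \<in> carrier K \<Longrightarrow> F (mpoly_const K a) = mpoly_const K a"
  shows "F s = mpoly_const K (inv\<^bsub>K\<^esub> \<iota> c) \<otimes>\<^bsub>PK\<^esub> F (xK 1)"
  unfolding s_def using assms one_in c(3) by (subst ring_hom_mult[OF assms(1)]) auto

text \<open>Since \<delta>(x_1) is constant, the second derivative of \<open>x\<^sub>1\<close>
  vanishes and the series stops after its linear term.\<close>

lemma expo_X1:
  assumes "derivation_exp PR \<theta>P \<delta> PK \<eta> j" "t \<in> carrier PK"
    and "\<And>a. a \<in> carrier R \<Longrightarrow> j (mpoly_const R a) = mpoly_const K (\<iota> a)"
  shows "expo j t (xR 1) = j (xR 1) \<oplus>\<^bsub>PK\<^esub> t \<otimes>\<^bsub>PK\<^esub> mpoly_const K (\<iota> c)"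
proof -
  interpret G: derivation_exp PR \<theta>P \<delta> PK \<eta> j by (rule assms)
  show ?thesis
    using G.Exp_linear[of "xR 1" t] assms one_in c by simp
qed

lemma hom_const:
  assumes "F \<in> ring_hom PK PK" "\<And>a. a \<in> carrier K \<Longrightarrow> F (mpoly_const K a) = mpoly_const K a"
    and "derivation_exp PR \<theta>P \<delta> PK \<eta> j" "t \<in> carrier PK" "p \<in> carrier PR"
  shows "F (expo j t p) = expo (\<lambda>x. F (j x)) (F t) p"
proof -
  interpret G: derivation_exp PR \<theta>P \<delta> PK \<eta> j by (rule assms)
  show ?thesis
    using assms by (intro G.hom_Exp) (auto intro: QK.rat_cring_axioms)
qed

text \<open>Both sides are homomorphisms on R[x] that restrict to \<open>\<iota>\<close> on
  constants, so the variables decide. This converts a substitution, known only on variables, into an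
  exponential on the whole image of \<open>J\<close>.\<close>

lemma hom_J_eqI:
  assumes "F \<in> ring_hom PK PK" "\<And>a. a \<in> carrier K \<Longrightarrow> F (mpoly_const K a) = mpoly_const K a"
    and "derivation_exp PR \<theta>P \<delta> PK \<eta> j" "t \<in> carrier PK"
    and "\<And>a. a \<in> carrier R \<Longrightarrow> j (mpoly_const R a) = mpoly_const K (\<iota> a)"
    and "\<And>i. i \<in> {1..n} \<Longrightarrow> F (xK i) = expo j t (xR i)"
    and "p \<in> carrier PR"
  shows "F (J p) = expo j t p"
proof -
  interpret G: derivation_exp PR \<theta>P \<delta> PK \<eta> j by (rule assms)
  have "(\<lambda>p. F (J p)) \<in> ring_hom PR PK"
    using ring_hom_trans[OF E.j_hom assms(1)] by (simp add: comp_def)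
  then show ?thesis
  proof (rule R.mpoly_hom_eqI[OF _ G.Exp_ring_hom[OF assms(4)] order_refl assms(7)])
    fix a assume "a \<in> carrier R"
    then show "F (J (mpoly_const R a)) = expo j t (mpoly_const R a)"
      using assms by (simp add: G.Exp_const)
  next
    fix i assume "i \<in> {1..n}"
    then show "F (J (xR i)) = expo j t (xR i)"
      using assms(6) by simp
  qed
qed

end

section \<open>The induced automorphism and the straightening substitutions\<close>

context triangular_exp
begin

abbreviation "subst g \<equiv> mpoly_subst K n g"

definition "\<phi> = exp_derivation R n h \<delta>"
definition "g\<Phi> i = J (\<phi> (xR i))"
definition "\<Phi> = subst g\<Phi>"
definition "g\<rho> i = (if i = 1 then \<zero>\<^bsub>PK\<^esub> else xK i)"
definition "\<rho> = subst g\<rho>"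
text \<open>Index 1 is an exception because the series at \<open>-s\<close> sends
  \<open>x\<^sub>1\<close> to 0, whereas \<tau> has to be invertible.\<close>

definition "g\<tau> i = (if i = 1 then xK 1 else expo J (\<ominus>\<^bsub>PK\<^esub> s) (xR i))"
definition "\<tau> = subst g\<tau>"
text \<open>The base map kills \<open>x\<^sub>1\<close> because \<tau> after it is the exponential
  at \<open>-s\<close>, which the parameter \<open>s\<close> then cancels. At index 1 the series
  would again give \<open>x\<^sub>1\<close>, as the proof of \<open>\<tau>'_J\<close> shows.\<close>

definition "g\<tau>' i = (if i = 1 then xK 1 else expo (\<lambda>q. \<rho> (J q)) s (xR i))"
definition "\<tau>' = subst g\<tau>'"

lemma Jh_closed [simp]: "J h \<in> carrier PK"
  using h(1) by (rule J_closed)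

text \<open>\<open>exp_derivation\<close> is the series with the identity as base map, so
  \<open>hom_Exp\<close> carries it along \<open>J\<close>.\<close>

lemma \<phi>_var:
  assumes i: "i \<in> {1..n}" shows "J (\<phi> (xR i)) = expo J (J h) (xR i)"
proof -
  interpret I: derivation_exp PR \<theta>P \<delta> PR \<theta>P "\<lambda>p. p"
    by unfold_locales (rule R.id_ring_hom, rule refl)
  have "\<phi> (xR i) = (\<Oplus>\<^bsub>PR\<^esub>l\<in>{l. (\<delta> ^^ l) (xR i) \<noteq> \<zero>\<^bsub>PR\<^esub>}.
      \<theta> (1 / fact l) \<odot>\<^bsub>PR\<^esub> (h [^]\<^bsub>PR\<^esub> l \<otimes>\<^bsub>PR\<^esub> (\<delta> ^^ l) (xR i)))"
    unfolding \<phi>_def exp_derivation_def Let_def using xR_closed[OF i] by (rule restrict_apply')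
  also have "\<dots> = exp_sum PR \<delta> PR \<theta>P (\<lambda>p. p) h (xR i)"
    unfolding exp_sum_def D.dpow_def
  proof (rule PR.finsum_cong'[OF refl])
    fix l
    have cl: "h [^]\<^bsub>PR\<^esub> l \<in> carrier PR" "(\<delta> ^^ l) (xR i) \<in> carrier PR" "\<theta>P (1 / fact l) \<in> carrier PR"
      by (rule PR.nat_pow_closed[OF h(1)], rule D.D_pow_closed[OF xR_closed[OF i]], rule D.theta_closed)
    then show "\<theta> (1 / fact l) \<odot>\<^bsub>PR\<^esub> (h [^]\<^bsub>PR\<^esub> l \<otimes>\<^bsub>PR\<^esub> (\<delta> ^^ l) (xR i)) =
      \<theta>P (1 / fact l) \<otimes>\<^bsub>PR\<^esub> h [^]\<^bsub>PR\<^esub> l \<otimes>\<^bsub>PR\<^esub> (\<delta> ^^ l) (xR i)"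
      by (simp only: R.smult_mpoly_eq[OF QR.theta_closed PR.m_closed] PR.m_assoc)
  qed (use h(1) xR_closed[OF i] in \<open>intro Pi_I PR.m_closed PR.nat_pow_closed D.D_pow_closed D.theta_closed\<close>)
  finally have "\<phi> (xR i) = exp_sum PR \<delta> PR \<theta>P (\<lambda>p. p) h (xR i)" .
  then have "J (\<phi> (xR i)) = J (exp_sum PR \<delta> PR \<theta>P (\<lambda>p. p) h (xR i))" by simp
  also have "\<dots> = expo J (J h) (xR i)"
    by (rule I.hom_Exp[OF QK.rat_cring_axioms E.j_hom J_const h(1) xR_closed[OF i]])
  finally show ?thesis .
qed

lemma g\<Phi>: "i \<in> {1..n} \<Longrightarrow> g\<Phi> i = expo J (J h) (xR i)"
  by (simp only: g\<Phi>_def \<phi>_var)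

lemma g\<Phi>_Pi: "g\<Phi> \<in> {1..n} \<rightarrow> carrier PK"
  by (rule Pi_I) (simp only: g\<Phi> E.Exp_closed xR_closed Jh_closed)

lemmas \<Phi>_hom = S.mpoly_subst_ring_hom[OF g\<Phi>_Pi, folded \<Phi>_def]
  and \<Phi>_const = S.mpoly_subst_const[OF g\<Phi>_Pi, folded \<Phi>_def]
  and \<Phi>_var = S.mpoly_subst_var[OF g\<Phi>_Pi, folded \<Phi>_def]

lemma \<Phi>_J: "p \<in> carrier PR \<Longrightarrow> \<Phi> (J p) = expo J (J h) p"
  by (rule hom_J_eqI[OF \<Phi>_hom \<Phi>_const E.derivation_exp_axioms Jh_closed])
     (simp_all add: \<Phi>_var g\<Phi>)

lemma \<Phi>_x1: "\<Phi> (xK 1) = xK 1 \<oplus>\<^bsub>PK\<^esub> J h \<otimes>\<^bsub>PK\<^esub> mpoly_const K (\<iota> c)"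
  using expo_X1[OF E.derivation_exp_axioms Jh_closed] one_in by (simp add: \<Phi>_var g\<Phi>)

lemma \<Phi>_s: "\<Phi> s = s \<oplus>\<^bsub>PK\<^esub> J h"
proof -
  let ?u = "mpoly_const K (inv\<^bsub>K\<^esub> \<iota> c)"
  have "\<Phi> s = ?u \<otimes>\<^bsub>PK\<^esub> (xK 1 \<oplus>\<^bsub>PK\<^esub> J h \<otimes>\<^bsub>PK\<^esub> mpoly_const K (\<iota> c))"
    using hom_s[OF \<Phi>_hom \<Phi>_const] \<Phi>_x1 by simp
  also have "\<dots> = s \<oplus>\<^bsub>PK\<^esub> (?u \<otimes>\<^bsub>PK\<^esub> mpoly_const K (\<iota> c)) \<otimes>\<^bsub>PK\<^esub> J h"
    unfolding s_def using one_in by (simp add: PK.r_distr PK.m_ac del: inv_c(2))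
  finally show ?thesis by simp
qed

lemma minus_s_closed [simp]: "\<ominus>\<^bsub>PK\<^esub> s \<in> carrier PK" by simp

lemma hom_minus_s:
  assumes "F \<in> ring_hom PK PK" shows "F (\<ominus>\<^bsub>PK\<^esub> s) = \<ominus>\<^bsub>PK\<^esub> F s"
proof -
  interpret F: ring_hom_cring PK PK F by unfold_locales (rule assms)
  show ?thesis by simp
qed

text \<open>\<Phi> replaces the base map \<open>J\<close> by the exponential at \<open>J h\<close>,
  and the parameter \<open>-s\<close> by \<open>-s - J h\<close>. By \<open>Exp_Exp\<close> the
  parameters add up to \<open>-s\<close> again.\<close>

lemma \<Phi>_expo:
  assumes p: "p \<in> carrier PR"
  shows "\<Phi> (expo J (\<ominus>\<^bsub>PK\<^esub> s) p) = expo J (\<ominus>\<^bsub>PK\<^esub> s) p"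
proof -
  interpret F: derivation_exp PR \<theta>P \<delta> PK \<eta> "E.Exp (J h)"
    by (intro derivation_expI E.Exp_ring_hom) (simp_all add: E.Exp_const)
  have "\<Phi> (expo J (\<ominus>\<^bsub>PK\<^esub> s) p) = expo (\<lambda>q. \<Phi> (J q)) (\<Phi> (\<ominus>\<^bsub>PK\<^esub> s)) p"
    by (rule hom_const[OF \<Phi>_hom \<Phi>_const E.derivation_exp_axioms minus_s_closed p])
  also have "\<dots> = expo (E.Exp (J h)) (\<Phi> (\<ominus>\<^bsub>PK\<^esub> s)) p"
    using \<Phi>_J p ring_hom_closed[OF \<Phi>_hom minus_s_closed] by (intro F.exp_sum_cong)
  also have "\<dots> = expo J (\<Phi> (\<ominus>\<^bsub>PK\<^esub> s) \<oplus>\<^bsub>PK\<^esub> J h) p"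
    using p ring_hom_closed[OF \<Phi>_hom minus_s_closed] by (intro E.Exp_Exp) auto
  also have "\<Phi> (\<ominus>\<^bsub>PK\<^esub> s) \<oplus>\<^bsub>PK\<^esub> J h = \<ominus>\<^bsub>PK\<^esub> s"
    by (simp add: hom_minus_s[OF \<Phi>_hom] \<Phi>_s PK.minus_add PK.a_assoc PK.l_neg)
  finally show ?thesis .
qed

lemma g\<rho>_Pi: "g\<rho> \<in> {1..n} \<rightarrow> carrier PK"
  by (rule Pi_I) (simp only: g\<rho>_def xK_closed PR.zero_closed PK.zero_closed split: if_split, simp)

lemmas \<rho>_hom = S.mpoly_subst_ring_hom[OF g\<rho>_Pi, folded \<rho>_def]
  and \<rho>_const = S.mpoly_subst_const[OF g\<rho>_Pi, folded \<rho>_def]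
  and \<rho>_var = S.mpoly_subst_var[OF g\<rho>_Pi, folded \<rho>_def]

lemma \<rho>J_hom: "(\<lambda>p. \<rho> (J p)) \<in> ring_hom PR PK"
  using ring_hom_trans[OF E.j_hom \<rho>_hom] by (simp add: comp_def)

sublocale G: derivation_exp PR \<theta>P \<delta> PK \<eta> "\<lambda>p. \<rho> (J p)"
  by (intro derivation_expI \<rho>J_hom) (simp add: \<rho>_const)

lemma \<rho>J_const: "a \<in> carrier R \<Longrightarrow> \<rho> (J (mpoly_const R a)) = mpoly_const K (\<iota> a)"
  by (simp add: \<rho>_const)

lemma \<rho>J_closed:
  assumes "k \<le> n" "p \<in> R.mpolys k" shows "\<rho> (J p) \<in> S.mpolys k"
proof (rule S.mpoly_hom_closed[OF \<rho>_hom assms(1) J_closed[OF assms(2)]])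
  fix i assume "i \<in> {1..k}"
  then show "\<rho> (xK i) \<in> S.mpolys k"
    using assms(1) \<rho>_var[of i] S.mpolys_var[of i k] by (simp add: g\<rho>_def S.mpolys_zero_closed)
qed (simp_all add: \<rho>_const S.mpolys_add_closed S.mpolys_mult_closed)

lemma g\<tau>_Pi: "g\<tau> \<in> {1..n} \<rightarrow> carrier PK"
  by (rule Pi_I) (simp only: g\<tau>_def xK_closed one_in E.Exp_closed xR_closed minus_s_closed split: if_split, simp)

lemma g\<tau>'_Pi: "g\<tau>' \<in> {1..n} \<rightarrow> carrier PK"
  by (rule Pi_I) (simp only: g\<tau>'_def xK_closed one_in G.Exp_closed xR_closed s_closed' split: if_split, simp)

lemmas \<tau>_hom = S.mpoly_subst_ring_hom[OF g\<tau>_Pi, folded \<tau>_def]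
  and \<tau>_const = S.mpoly_subst_const[OF g\<tau>_Pi, folded \<tau>_def]
  and \<tau>_var = S.mpoly_subst_var[OF g\<tau>_Pi, folded \<tau>_def]
  and \<tau>'_hom = S.mpoly_subst_ring_hom[OF g\<tau>'_Pi, folded \<tau>'_def]
  and \<tau>'_const = S.mpoly_subst_const[OF g\<tau>'_Pi, folded \<tau>'_def]
  and \<tau>'_var = S.mpoly_subst_var[OF g\<tau>'_Pi, folded \<tau>'_def]

lemma \<tau>_s: "\<tau> s = s"
  using hom_s[OF \<tau>_hom \<tau>_const] one_in by (simp add: \<tau>_var g\<tau>_def s_def)

lemma \<tau>'_s: "\<tau>' s = s"
  using hom_s[OF \<tau>'_hom \<tau>'_const] one_in by (simp add: \<tau>'_var g\<tau>'_def s_def)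

lemma expo_minus_s_x1: "expo J (\<ominus>\<^bsub>PK\<^esub> s) (xR 1) = \<zero>\<^bsub>PK\<^esub>"
  using expo_X1[OF E.derivation_exp_axioms minus_s_closed J_const] one_in
  by (simp add: PK.l_minus s_c PK.r_neg)

text \<open>Both sides send \<open>x\<^sub>1\<close> to 0, the left one because
  \<open>\<rho>\<close> kills it; on the other variables this is the definition of \<tau>. Applying
  \<open>\<rho>\<close> first thus removes the exception at index 1.\<close>

lemma \<tau>_\<rho>J: "p \<in> carrier PR \<Longrightarrow> \<tau> (\<rho> (J p)) = expo J (\<ominus>\<^bsub>PK\<^esub> s) p"
proof (rule hom_J_eqI[where F = "\<lambda>p. \<tau> (\<rho> p)", OF _ _ E.derivation_exp_axioms minus_s_closed J_const])
  interpret T: ring_hom_cring PK PK \<tau> by unfold_locales (rule \<tau>_hom)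
  show "(\<lambda>p. \<tau> (\<rho> p)) \<in> ring_hom PK PK"
    using ring_hom_trans[OF \<rho>_hom \<tau>_hom] by (simp add: comp_def)
  fix i assume i: "i \<in> {1..n}"
  show "\<tau> (\<rho> (xK i)) = expo J (\<ominus>\<^bsub>PK\<^esub> s) (xR i)"
  proof (cases "i = 1")
    case True
    then show ?thesis using i expo_minus_s_x1 by (simp add: \<rho>_var g\<rho>_def)
  next
    case False
    then show ?thesis using i by (simp add: \<rho>_var g\<rho>_def \<tau>_var g\<tau>_def)
  qed
qed (simp_all add: \<rho>_const \<tau>_const)

text \<open>Here index 1 fits as well: the base map contributes 0, and the linear term
  \<open>s\<close> times \<open>c\<close> restores \<open>x\<^sub>1\<close>.\<close>

lemma \<tau>'_J: "p \<in> carrier PR \<Longrightarrow> \<tau>' (J p) = G.Exp s p"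
proof (rule hom_J_eqI[OF \<tau>'_hom \<tau>'_const G.derivation_exp_axioms s_closed' \<rho>J_const])
  fix i assume i: "i \<in> {1..n}"
  show "\<tau>' (xK i) = G.Exp s (xR i)"
  proof (cases "i = 1")
    case True
    then show ?thesis
      using i expo_X1[OF G.derivation_exp_axioms s_closed' \<rho>J_const]
      by (simp add: \<tau>'_var g\<tau>'_def \<rho>_var g\<rho>_def s_c)
  next
    case False
    then show ?thesis using i by (simp add: \<tau>'_var g\<tau>'_def)
  qed
qed

text \<open>\<tau> fixes \<open>s\<close> and turns the base map of \<tau>' into the exponential at
  \<open>-s\<close>, so the parameters cancel and \<open>J\<close> remains.\<close>

lemma \<tau>_g\<tau>': assumes i: "i \<in> {1..n}" shows "\<tau> (g\<tau>' i) = xK i"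
proof (cases "i = 1")
  case True then show ?thesis using i by (simp add: g\<tau>'_def \<tau>_var g\<tau>_def)
next
  case False
  interpret F: derivation_exp PR \<theta>P \<delta> PK \<eta> "E.Exp (\<ominus>\<^bsub>PK\<^esub> s)"
    by (intro derivation_expI E.Exp_ring_hom) (simp_all add: E.Exp_const)
  have "\<tau> (g\<tau>' i) = expo (\<lambda>q. \<tau> (\<rho> (J q))) (\<tau> s) (xR i)"
    unfolding g\<tau>'_def using False i
    by (simp add: hom_const[OF \<tau>_hom \<tau>_const G.derivation_exp_axioms s_closed'])
  also have "\<dots> = expo (E.Exp (\<ominus>\<^bsub>PK\<^esub> s)) s (xR i)"
    unfolding \<tau>_s using i \<tau>_\<rho>J by (intro F.exp_sum_cong) auto
  also have "\<dots> = expo J (s \<oplus>\<^bsub>PK\<^esub> \<ominus>\<^bsub>PK\<^esub> s) (xR i)"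
    using i by (intro E.Exp_Exp) auto
  also have "\<dots> = xK i"
    using i E.Exp_zero[of "xR i"] by (simp add: PK.r_neg)
  finally show ?thesis .
qed

text \<open>Again the parameters cancel, this time leaving \<open>J\<close> followed by
  \<open>\<rho>\<close>, which agrees with \<open>J\<close> on the variables other than
  \<open>x\<^sub>1\<close>.\<close>

lemma \<tau>'_g\<tau>: assumes i: "i \<in> {1..n}" shows "\<tau>' (g\<tau> i) = xK i"
proof (cases "i = 1")
  case True then show ?thesis using i by (simp add: g\<tau>_def \<tau>'_var g\<tau>'_def)
next
  case False
  interpret F: derivation_exp PR \<theta>P \<delta> PK \<eta> "G.Exp s"
    by (intro derivation_expI G.Exp_ring_hom) (simp_all add: G.Exp_const \<rho>_const)
  have "\<tau>' (g\<tau> i) = expo (\<lambda>q. \<tau>' (J q)) (\<tau>' (\<ominus>\<^bsub>PK\<^esub> s)) (xR i)"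
    unfolding g\<tau>_def using False i
    by (simp add: hom_const[OF \<tau>'_hom \<tau>'_const E.derivation_exp_axioms])
  also have "\<dots> = expo (G.Exp s) (\<ominus>\<^bsub>PK\<^esub> s) (xR i)"
    unfolding hom_minus_s[OF \<tau>'_hom] \<tau>'_s using i \<tau>'_J by (intro F.exp_sum_cong) auto
  also have "\<dots> = G.Exp (\<ominus>\<^bsub>PK\<^esub> s \<oplus>\<^bsub>PK\<^esub> s) (xR i)"
    using i by (intro G.Exp_Exp) auto
  also have "\<dots> = xK i"
    using i False G.Exp_zero[of "xR i"] by (simp add: PK.l_neg \<rho>_var g\<rho>_def)
  finally show ?thesis .
qed

lemma triangularI:
  assumes "subst g \<in> carrier (GA K n)" "g \<in> {1..n} \<rightarrow> carrier PK"
    and "\<And>i. i \<in> {1..n} \<Longrightarrow> \<exists>d\<in>S.mpolys (i - 1). g i = xK i \<oplus>\<^bsub>PK\<^esub> d"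
  shows "subst g \<in> triangular_automorphisms K n"
proof -
  have "\<exists>u\<in>Units K. \<exists>d\<in>S.mpolys (i - 1). subst g (xK i) = u \<odot>\<^bsub>PK\<^esub> xK i \<oplus>\<^bsub>PK\<^esub> d"
    if i: "i \<in> {1..n}" for i
  proof -
    obtain d where "d \<in> S.mpolys (i - 1)" "g i = xK i \<oplus>\<^bsub>PK\<^esub> d" using assms(3)[OF i] by blast
    moreover have "\<one>\<^bsub>K\<^esub> \<odot>\<^bsub>PK\<^esub> xK i = xK i"
      using i ring_hom_one[OF S.const_ring_hom, of n] by (simp add: S.smult_mpoly_eq)
    ultimately show ?thesis
      using S.mpoly_subst_var[OF assms(2) i] by (intro bexI[of _ "\<one>\<^bsub>K\<^esub>"] bexI[of _ d]) simp_all
  qed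
  then show ?thesis using assms(1) by (simp add: triangular_automorphisms_def)
qed

lemma \<tau>_triangular: "\<tau> \<in> triangular_automorphisms K n"
  unfolding \<tau>_def
proof (rule triangularI[OF _ g\<tau>_Pi])
  show "subst g\<tau> \<in> carrier (GA K n)"
    by (rule S.mpoly_subst_GA[OF g\<tau>_Pi g\<tau>'_Pi \<tau>_g\<tau>'[unfolded \<tau>_def] \<tau>'_g\<tau>[unfolded \<tau>'_def]])
  fix i assume i: "i \<in> {1..n}"
  show "\<exists>d\<in>S.mpolys (i - 1). g\<tau> i = xK i \<oplus>\<^bsub>PK\<^esub> d"
  proof (cases "i = 1")
    case True
    then show ?thesis using one_in
      by (intro bexI[of _ "\<zero>\<^bsub>PK\<^esub>"]) (simp_all add: g\<tau>_def S.mpolys_zero_closed)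
  next
    case False
    \<comment> \<open>Here \<open>i\<close> is at least 2, so the first \<open>i - 1\<close>
      variables include \<open>x\<^sub>1\<close> and hence contain the slice.\<close>
    then have "\<ominus>\<^bsub>PK\<^esub> s \<in> S.mpolys (i - 1)"
      using i by (intro S.mpolys_a_inv_closed s_closed) auto
    then show ?thesis
      using False exp_sum_var_triangular[OF E.derivation_exp_axioms R.is_cring S.is_cring _ \<delta> i _ J_closed]
      by (simp add: g\<tau>_def)
  qed
qed

lemma \<tau>'_triangular: "\<tau>' \<in> triangular_automorphisms K n"
  unfolding \<tau>'_def
proof (rule triangularI[OF _ g\<tau>'_Pi])
  show "subst g\<tau>' \<in> carrier (GA K n)"
    by (rule S.mpoly_subst_GA[OF g\<tau>'_Pi g\<tau>_Pi \<tau>'_g\<tau>[unfolded \<tau>'_def] \<tau>_g\<tau>'[unfolded \<tau>_def]])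
  fix i assume i: "i \<in> {1..n}"
  show "\<exists>d\<in>S.mpolys (i - 1). g\<tau>' i = xK i \<oplus>\<^bsub>PK\<^esub> d"
  proof (cases "i = 1")
    case True
    then show ?thesis using one_in
      by (intro bexI[of _ "\<zero>\<^bsub>PK\<^esub>"]) (simp_all add: g\<tau>'_def S.mpolys_zero_closed)
  next
    case False
    then have s: "s \<in> S.mpolys (i - 1)" using i by (intro s_closed) auto
    have le: "i - 1 \<le> n" using i by auto
    have "\<rho> (J (xR i)) = xK i" using False i by (simp add: \<rho>_var g\<rho>_def)
    with False s show ?thesis
      using exp_sum_var_triangular[OF G.derivation_exp_axioms R.is_cring S.is_cring _ \<delta> i s \<rho>J_closed[OF le]]
      by (simp add: g\<tau>'_def)
  qed
qed

text \<open>
  Conjugation by the transposition of \<open>x\<^sub>1\<close> and \<open>x\<^sub>n\<close> turns the elementary automorphism that moves only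
  \<open>x\<^sub>1\<close> into a triangular one.
\<close>

definition "w i = (if i = 1 then n else if i = n then 1 else i)" for i :: nat
definition "\<pi> = subst (\<lambda>i. xK (w i))"
text \<open>The shift of \<open>x\<^sub>1\<close> by c \<rho>(h), transported by the transposition
  into a polynomial free of \<open>x\<^sub>n\<close>.\<close>

definition "e = mpoly_const K (\<iota> c) \<otimes>\<^bsub>PK\<^esub> \<pi> (\<rho> (J h))"
definition "\<psi> = subst (\<lambda>i. if i = n then xK n \<oplus>\<^bsub>PK\<^esub> e else xK i)"

lemma w: "i \<in> {1..n} \<Longrightarrow> w i \<in> {1..n}" "i \<in> {1..n} \<Longrightarrow> w (w i) = i"
  using n by (auto simp: w_def)

lemma g\<pi>_Pi: "(\<lambda>i. xK (w i)) \<in> {1..n} \<rightarrow> carrier PK"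
  using w(1) by (auto intro!: S.mpolys_var)

lemmas \<pi>_hom = S.mpoly_subst_ring_hom[OF g\<pi>_Pi, folded \<pi>_def]
  and \<pi>_const = S.mpoly_subst_const[OF g\<pi>_Pi, folded \<pi>_def]
  and \<pi>_var = S.mpoly_subst_var[OF g\<pi>_Pi, folded \<pi>_def]

lemma \<pi>_affine: "\<pi> \<in> affine_automorphisms K n"
  unfolding \<pi>_def by (rule S.mpoly_subst_permutation_affine[OF K_nontrivial w])

lemma \<pi>_\<pi>:
  assumes "p \<in> carrier PK" shows "\<pi> (\<pi> p) = p"
proof (rule S.mpoly_hom_eqI[where F = "\<lambda>p. \<pi> (\<pi> p)", OF _ S.id_ring_hom order_refl assms])
  show "(\<lambda>p. \<pi> (\<pi> p)) \<in> ring_hom PK PK"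
    using ring_hom_trans[OF \<pi>_hom \<pi>_hom] by (simp add: comp_def)
  fix i assume "i \<in> {1..n}"
  then show "\<pi> (\<pi> (xK i)) = xK i"
    using w[of i] by (simp only: \<pi>_var)
qed (simp add: \<pi>_const)

text \<open>\<open>\<rho>\<close> removes \<open>x\<^sub>1\<close>, and \<open>w\<close> maps the
  indices from 2 to \<open>n\<close> into those from 1 to \<open>n - 1\<close>.\<close>

lemma \<pi>\<rho>_closed: "p \<in> carrier PK \<Longrightarrow> \<pi> (\<rho> p) \<in> S.mpolys (n - 1)"
proof (rule S.mpoly_hom_closed[where F = "\<lambda>p. \<pi> (\<rho> p)", OF _ order_refl])
  interpret T: ring_hom_cring PK PK \<pi> by unfold_locales (rule \<pi>_hom)
  show "(\<lambda>p. \<pi> (\<rho> p)) \<in> ring_hom PK PK"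
    using ring_hom_trans[OF \<rho>_hom \<pi>_hom] by (simp add: comp_def)
  fix i assume i: "i \<in> {1..n}"
  show "\<pi> (\<rho> (xK i)) \<in> S.mpolys (n - 1)"
  proof (cases "i = 1")
    case True
    then show ?thesis using i by (simp add: \<rho>_var g\<rho>_def S.mpolys_zero_closed)
  next
    case False
    then have "w i \<in> {1..n - 1}" using i by (auto simp: w_def)
    with False i show ?thesis
      by (simp only: \<rho>_var g\<rho>_def if_False \<pi>_var S.mpolys_var)
  qed
qed (simp_all add: \<rho>_const \<pi>_const S.mpolys_add_closed S.mpolys_mult_closed)

lemma e_closed: "e \<in> S.mpolys (n - 1)"
  unfolding e_def using c(1) by (intro S.mpolys_mult_closed S.mpolys_const \<pi>\<rho>_closed) auto

lemma e_closed' [simp]: "e \<in> carrier PK"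
  using e_closed S.mpolys_mono[of "n - 1" n] by auto

lemma \<psi>_triangular: "\<psi> \<in> triangular_automorphisms K n"
  unfolding \<psi>_def by (rule S.elementary_triangular[OF n e_closed])

lemma g\<psi>_Pi: "(\<lambda>i. if i = n then xK n \<oplus>\<^bsub>PK\<^esub> e else xK i) \<in> {1..n} \<rightarrow> carrier PK"
  using n by (auto intro!: S.mpolys_var PK.a_closed)

lemmas \<psi>_hom = S.mpoly_subst_ring_hom[OF g\<psi>_Pi, folded \<psi>_def]
  and \<psi>_const = S.mpoly_subst_const[OF g\<psi>_Pi, folded \<psi>_def]
  and \<psi>_var = S.mpoly_subst_var[OF g\<psi>_Pi, folded \<psi>_def]

text \<open>The conjugation relation in product form, compared on variables. For index 1 both sides
  are x_1 + c h. For any other index, \<pi>\<psi>\<pi> fixes the variable and \<Phi> fixes its image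
  under \<tau>.\<close>

lemma \<Phi>_\<tau>:
  assumes "p \<in> carrier PK" shows "\<Phi> (\<tau> p) = \<tau> (\<pi> (\<psi> (\<pi> p)))"
proof (rule S.mpoly_hom_eqI[where F = "\<lambda>p. \<Phi> (\<tau> p)" and G = "\<lambda>p. \<tau> (\<pi> (\<psi> (\<pi> p)))", OF _ _ order_refl assms])
  interpret T: ring_hom_cring PK PK \<tau> by unfold_locales (rule \<tau>_hom)
  interpret \<pi>: ring_hom_cring PK PK \<pi> by unfold_locales (rule \<pi>_hom)
  show "(\<lambda>p. \<Phi> (\<tau> p)) \<in> ring_hom PK PK"
    using ring_hom_trans[OF \<tau>_hom \<Phi>_hom] by (simp add: comp_def)
  show "(\<lambda>p. \<tau> (\<pi> (\<psi> (\<pi> p)))) \<in> ring_hom PK PK"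
    using ring_hom_trans[OF \<pi>_hom ring_hom_trans[OF \<psi>_hom ring_hom_trans[OF \<pi>_hom \<tau>_hom]]]
    by (simp add: comp_def)
  fix i assume i: "i \<in> {1..n}"
  show "\<Phi> (\<tau> (xK i)) = \<tau> (\<pi> (\<psi> (\<pi> (xK i))))"
  proof (cases "i = 1")
    case True
    have nn: "n \<in> {1..n}" and wn: "w n = 1" "w 1 = n" using n by (auto simp: w_def)
    have \<rho>h: "\<rho> (J h) \<in> carrier PK" by (rule ring_hom_closed[OF \<rho>_hom Jh_closed])
    have "\<psi> (\<pi> (xK 1)) = xK n \<oplus>\<^bsub>PK\<^esub> e"
      using \<pi>_var[OF one_in] \<psi>_var[OF nn] wn by simp
    moreover have "\<pi> (xK n \<oplus>\<^bsub>PK\<^esub> e) = xK 1 \<oplus>\<^bsub>PK\<^esub> mpoly_const K (\<iota> c) \<otimes>\<^bsub>PK\<^esub> \<rho> (J h)"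
      using \<pi>_var[OF nn] wn \<rho>h c(1) xK_closed[OF nn] e_closed' \<pi>.hom_closed[OF \<rho>h]
      by (simp add: e_def \<pi>_const \<pi>_\<pi> del: One_nat_def)
    \<comment> \<open>The condition \<delta>(h) = 0 enters here: the exponential at
      \<open>-s\<close> of \<open>h\<close> is \<open>J h\<close>, and by
      \<open>\<tau>_\<rho>J\<close> it is also the image of \<rho>(h) under \<tau>.\<close>
    moreover have "\<tau> (xK 1 \<oplus>\<^bsub>PK\<^esub> mpoly_const K (\<iota> c) \<otimes>\<^bsub>PK\<^esub> \<rho> (J h))
        = xK 1 \<oplus>\<^bsub>PK\<^esub> mpoly_const K (\<iota> c) \<otimes>\<^bsub>PK\<^esub> J h"
      using \<tau>_var[OF one_in] \<rho>h c(1) xK_closed[OF one_in] \<tau>_\<rho>J[OF h(1)] E.Exp_const[OF h(1) minus_s_closed h(2)]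
      by (simp add: \<tau>_const g\<tau>_def del: One_nat_def)
    moreover have "\<Phi> (\<tau> (xK 1)) = xK 1 \<oplus>\<^bsub>PK\<^esub> mpoly_const K (\<iota> c) \<otimes>\<^bsub>PK\<^esub> J h"
      using \<Phi>_x1 \<tau>_var[OF one_in] by (simp add: g\<tau>_def PK.m_comm del: One_nat_def)
    ultimately show ?thesis using True by simp
  next
    case False
    have "w i \<noteq> n" using False i by (auto simp: w_def)
    then have "\<pi> (\<psi> (\<pi> (xK i))) = xK i"
      using \<pi>_var[OF i] \<psi>_var[OF w(1)[OF i]] \<pi>_var[OF w(1)[OF i]] w(2)[OF i] by simp
    moreover have "\<Phi> (\<tau> (xK i)) = \<tau> (xK i)"
      using False i \<Phi>_expo[of "xR i"] by (simp add: \<tau>_var g\<tau>_def)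
    ultimately show ?thesis by simp
  qed
qed (simp_all add: \<Phi>_const \<tau>_const \<pi>_const \<psi>_const)

lemma \<tau>_\<tau>':
  assumes "p \<in> carrier PK" shows "\<tau> (\<tau>' p) = p"
proof (rule S.mpoly_hom_eqI[where F = "\<lambda>p. \<tau> (\<tau>' p)", OF _ S.id_ring_hom order_refl assms])
  show "(\<lambda>p. \<tau> (\<tau>' p)) \<in> ring_hom PK PK"
    using ring_hom_trans[OF \<tau>'_hom \<tau>_hom] by (simp add: comp_def)
qed (simp_all add: \<tau>_const \<tau>'_const \<tau>'_var \<tau>_g\<tau>')

text \<open>Evaluating \<open>\<Phi>_\<tau>\<close> at \<open>\<tau>' p\<close> gives \<Phi> =
  \<tau>\<pi>\<psi>\<pi>\<tau>', whose factors are all triangular or affine.\<close>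

lemma base_change_exp_tame: "tame K n (base_change R K \<iota> n (exp_derivation R n h \<delta>))"
proof -
  have "compose (carrier PK) \<tau> (compose (carrier PK) \<pi> (compose (carrier PK) \<psi> (compose (carrier PK) \<pi> \<tau>')))
    \<in> TA K n \<inter> Bij (carrier PK)"
    using \<tau>_triangular \<tau>'_triangular \<pi>_affine \<psi>_triangular S.generators_TA[of n]
    by (intro S.TA_compose) auto
  moreover have "compose (carrier PK) \<tau> (compose (carrier PK) \<pi> (compose (carrier PK) \<psi> (compose (carrier PK) \<pi> \<tau>'))) = \<Phi>"
  proof (rule extensionalityI)
    show "\<Phi> \<in> extensional (carrier PK)"
      by (simp add: \<Phi>_def mpoly_subst_def Let_def)
    fix p assume p: "p \<in> carrier PK"
    then have "\<Phi> p = \<tau> (\<pi> (\<psi> (\<pi> (\<tau>' p))))"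
      using \<Phi>_\<tau>[OF ring_hom_closed[OF \<tau>'_hom p]] by (simp add: \<tau>_\<tau>')
    with p show "compose (carrier PK) \<tau> (compose (carrier PK) \<pi> (compose (carrier PK) \<psi> (compose (carrier PK) \<pi> \<tau>'))) p = \<Phi> p"
      by (simp add: compose_eq)
  qed (rule compose_extensional)
  moreover have "base_change R K \<iota> n (exp_derivation R n h \<delta>) = \<Phi>"
    by (simp add: base_change_def \<Phi>_def g\<Phi>_def[abs_def] \<phi>_def J_def)
  ultimately show ?thesis by (simp add: tame_def)
qed

end

section \<open>The theorem at a prime ideal\<close>

theorem theorem2:
  fixes R :: "(rat, 'a, 'm) module_scheme"
    and n :: nat
    and \<delta> :: "(nat multiset \<Rightarrow> 'a) \<Rightarrow> (nat multiset \<Rightarrow> 'a)"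
    and f :: "nat \<Rightarrow> nat multiset \<Rightarrow> 'a"
    and h :: "nat multiset \<Rightarrow> 'a"
    and \<phi> :: "(nat multiset \<Rightarrow> 'a) \<Rightarrow> (nat multiset \<Rightarrow> 'a)"
    and \<pp> :: "'a set"
  assumes "n \<ge> 1"
    and "algebra rat_field R"
    and "triangular_derivation R n \<delta>"
    and "\<And>i. i \<in> {1..n} \<Longrightarrow> f i = \<delta> (mpoly_var R i)"
    and "h \<in> carrier (mpoly_ring R n)"
    and "\<delta> h = \<zero>\<^bsub>mpoly_ring R n\<^esub>"
    and "\<phi> = exp_derivation R n h \<delta>"
    and "primeideal \<pp> R"
    and "f 1 \<notin> mpoly_const R ` \<pp>"
  shows "tame (residue_field R \<pp>) n (induced_automorphism R \<pp> n \<phi>)"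
proof -
  interpret I: primeideal \<pp> R by fact
  have one: "1 \<in> {1..n}" using assms(1) by simp
  have "f 1 \<in> I.mpolys (1 - 1)"
    using assms(3) one unfolding assms(4)[OF one] triangular_derivation_def by blast
  \<comment> \<open>With an empty set of variables the case of multiplication by a variable is
    vacuous, and sums of constants are constant.\<close>
  then have "f 1 \<in> mpoly_const R ` carrier R"
  proof (induction rule: I.mpolys_induct)
    case (padd p q)
    then show ?case by (auto simp: I.indexed_padd_const)
  qed auto
  then obtain c where c: "c \<in> carrier R" "f 1 = mpoly_const R c" by blast
  with assms(9) have "c \<in> carrier R - \<pp>" by auto
  then have "residue_map R \<pp> c \<in> Units (residue_field R \<pp>)"
    by (rule I.residue_map_unit)
  with c assms one interpret triangular_exp R "residue_field R \<pp>" "residue_map R \<pp>" n \<delta> h c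
    by (intro triangular_exp.intro triangular_exp_axioms.intro ring_hom_cring.intro ring_hom_cring_axioms.intro
        I.is_cring I.residue_field_cring I.residue_map_ring_hom I.residue_field_nontrivial) auto
  show ?thesis
    unfolding induced_automorphism_def assms(7) by (rule base_change_exp_tame)
qed

end
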